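(* Let $L\subset\mathbb{Z}^n$ be a sublattice of rank $n$, let $\Delta_1,\dots,\Delta_n$ be polytopes in $\mathbb{R}^n$ all of whose vertices lie in $L$, and let $\Delta_0$ be another polytope in $\mathbb{R}^n$ (not assumed to be integral). Then $$MV(\Delta_1,\dots,\Delta_n)=\sum_{J\subset\{1,\dots,n\}}(-1)^{\sharp J}\,\natural(\Delta_{\{0\}\sqcup J})=\sum_{J\subset\{1,\dots,n\}}(-1)^{n-\sharp J}\,\sharp(\Delta_{\{0\}\sqcup J}),$$ where $MV(\Delta_1,\dots,\Delta_n)\in\mathbb{Z}_+$ is the normalized $n$-dimensional mixed volume with respect to the lattice $L$.
   Context: Polytopes are (non-empty) convex hulls of finite sets. For a bounded set $A\subset\mathbb{R}^n$, $\sharp A$ denotes $\sharp(A\cap L)$. For a polytope $\Box$ in $\mathbb{R}^n$, $\natural(\Box)=(-1)^{\dim\Box}\,\sharp\{\mathrm{rel.int}(\Box)\cap L\}$, where $\mathrm{rel.int}$ is the relative interior. For $I\subset\{0,1,\dots,n\}$, $\Delta_I=\sum_{j\in I}\Delta_j$ (Minkowski sum); for a set of indices $J$, $\sharp J$ is its cardinality. Normalized mixed volume with respect to $L$: $MV(Q_1,\dots,Q_n)=\frac{1}{n!}\sum_{k=1}^n(-1)^{n-k}\sum_{I\subset\{1,\dots,n\},\,\sharp I=k}\mathrm{Vol}_L\big(\sum_{i\in I}Q_i\big)$, where $\mathrm{Vol}_L$ is $n!$ times the Lebesgue measure normalized so that a fundamental domain of $L$ has measure $1$. *)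

theory Defs
  imports "HOL-Analysis.Analysis" "HOL-Computational_Algebra.Group_Closure"
begin

text \<open>
  Here \<open>n = CARD('n)\<close>, so \<open>n \<ge> 1\<close>.  Minkowski sums of subsets of \<open>real ^ 'n\<close> are the
  sums of \<open>HOL-Library.Set_Algebras\<close>; the empty sum is \<open>{0}\<close>.
\<close>

text \<open>A lattice is the integer span of linearly independent vectors, its rank being their number.\<close>

definition lattice_of_rank :: "nat \<Rightarrow> (real ^ 'n) set \<Rightarrow> bool" where
  "lattice_of_rank r L \<longleftrightarrow> (\<exists>B. independent B \<and> card B = r \<and> L = group_closure B)"

definition integer_vectors :: "(real ^ 'n) set" where
  "integer_vectors = {x. \<forall>i. x $ i \<in> \<int>}"

definition fundamental_domain :: "(real ^ 'n) set \<Rightarrow> (real ^ 'n) set \<Rightarrow> bool" where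
  "fundamental_domain L F \<longleftrightarrow> F \<in> sets lebesgue \<and> (\<forall>x. \<exists>!v. v \<in> L \<and> x - v \<in> F)"

text \<open>For a lattice of full rank all fundamental domains have the same measure, so the choice
  made here is immaterial.\<close>

definition covolume :: "(real ^ 'n) set \<Rightarrow> real" where
  "covolume L = measure lebesgue (SOME F. fundamental_domain L F)"

definition lattice_vol :: "(real ^ 'n) set \<Rightarrow> (real ^ 'n) set \<Rightarrow> real" where
  "lattice_vol L A = fact CARD('n) * (measure lebesgue A / covolume L)"

definition mixed_volume :: "(real ^ 'n) set \<Rightarrow> (nat \<Rightarrow> (real ^ 'n) set) \<Rightarrow> real" where
  "mixed_volume L Q =
     1 / fact CARD('n) *
     (\<Sum>k = 1..CARD('n). (-1) ^ (CARD('n) - k) *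
        (\<Sum>I | I \<subseteq> {1..CARD('n)} \<and> card I = k. lattice_vol L (\<Sum>i\<in>I. Q i)))"

definition lattice_polytope :: "(real ^ 'n) set \<Rightarrow> (real ^ 'n) set \<Rightarrow> bool" where
  "lattice_polytope L P \<longleftrightarrow> polytope P \<and> P \<noteq> {} \<and> {x. x extreme_point_of P} \<subseteq> L"

definition lattice_count :: "(real ^ 'n) set \<Rightarrow> (real ^ 'n) set \<Rightarrow> int" where
  "lattice_count L A = int (card (A \<inter> L))"

text \<open>\<^const>\<open>aff_dim\<close> is integer-valued, but nonnegative on nonempty sets.\<close>

definition signed_interior_count :: "(real ^ 'n) set \<Rightarrow> (real ^ 'n) set \<Rightarrow> int" where
  "signed_interior_count L P = (-1) ^ nat (aff_dim P) * lattice_count L (rel_interior P)"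

end

theory Submission
  imports Defs
begin

text \<open>
  Write \<open>n = CARD('n)\<close> and \<open>P\<^sub>J = (\<Sum>j\<in>J. \<Delta> j)\<close>.  If \<open>P\<close> is the hull of a set \<open>V\<close> of \<open>m\<close> lattice points, then the
  translates of \<open>Q + (m - 1) P\<close> by points of \<open>V\<close> cover \<open>Q + m P\<close>, and inclusion-exclusion for this cover
  (an identity of Euler characteristics) shows that \<open>k \<mapsto> \<sharp>(Q + k P)\<close> has vanishing \<open>m\<close>-th
  differences.  Hence \<open>k \<mapsto> \<sharp>(Q + (\<Sum>j. k j *\<^sub>R \<Delta> j))\<close> is a polynomial in several variables, of total
  degree at most \<open>n\<close> by its growth.  Its part of degree \<open>n\<close> does not depend on \<open>Q\<close>, so neither does
  the mixed difference \<open>c = (\<Sum>J. (-1) ^ (n - card J) * \<sharp>(Q + P\<^sub>J))\<close>.  Taking \<open>Q = {- x}\<close> and averaging over \<open>x\<close> in a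
  fundamental domain turns the counts into volumes and identifies \<open>c\<close> with the mixed volume.

  If \<open>Q\<close> has full dimension, the lattice points in the interiors of the \<open>Q + P\<^sub>J\<close> are those of
  \<open>Q' + P\<^sub>J\<close> for a slightly smaller polytope \<open>Q'\<close>; the general case of the formula for interiors follows by
  thickening \<open>Q\<close> along segments, the signed interior count being a valuation.

  Nonnegativity follows an argument of Gromov: the volume of \<open>P\<^sub>J\<close> is the integral over the whole space of the
  Jacobian determinant of the gradient map of \<open>\<Sum>j\<in>J. ln (\<Sum>v\<in>V j. exp (v \<bullet> x))\<close>, where
  \<open>V j\<close> is the vertex set of \<open>\<Delta> j\<close>; thus the mixed volume is the
  integral of a mixed discriminant of positive semidefinite matrices.
\<close>

text \<open>Inclusion-exclusion is not applied to the translates themselves: the intersection of the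
  translates of \<open>Q + (m - 1) P\<close> by the points of a subset \<open>S\<close> of
  \<open>V\<close> can be larger than \<open>Q + (m - card S) P + \<Sum>S\<close>, for instance on
  the line with \<open>Q = {0}\<close> and \<open>V = {0, 1, 2}\<close>. It is applied, for one
  point x at a time, to the set of coefficient families on \<open>V\<close> that represent x. That
  set is convex, so every intersection with half-spaces has Euler characteristic 0 or 1 and only its
  emptiness matters.

  Since \<open>Q\<close> is never dilated, it need not be integral; this admits an arbitrary
  \<open>\<Delta> 0\<close> and also the averaging over all real translations.

  For interiors, shrinking \<open>Q\<close> works only in full dimension. Otherwise the dimension of
  the sums, and with it the sign, varies with \<open>J\<close>, and the points of \<open>Q\<close>
  do not absorb the passage to the interior.\<close>

section \<open>Euler characteristics of covers by half-spaces\<close>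

text \<open>Pairs each \<open>S\<close> avoiding \<open>i\<close> with \<open>insert i S\<close>.
  The inductions over index sets in alternating sums below rest on this.\<close>

lemma sum_Pow_insert:
  fixes f :: "'i set \<Rightarrow> 'a::comm_ring_1"
  assumes "finite I" "i \<notin> I"
  shows "(\<Sum>S\<in>Pow (insert i I). (-1) ^ card S * f S) =
    (\<Sum>S\<in>Pow I. (-1) ^ card S * (f S - f (insert i S)))"
proof -
  have inj: "inj_on (insert i) (Pow I)"
    proof (rule inj_onI)
    fix S T assume "S \<in> Pow I" "T \<in> Pow I" "insert i S = insert i T"
    then show "S = T" using insert_ident[of i S T] assms(2) by blast
  qed
  have disj: "Pow I \<inter> insert i ` Pow I = {}"
    using assms by auto
  have card: "card (insert i S) = Suc (card S)" if "S \<in> Pow I" for S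
    using that assms by (subst card_insert_disjoint) (auto dest: finite_subset)
  have "(\<Sum>S\<in>Pow (insert i I). (-1) ^ card S * f S) =
     (\<Sum>S\<in>Pow I. (-1) ^ card S * f S) + (\<Sum>S\<in>Pow I. (-1) ^ card (insert i S) * f (insert i S))"
    unfolding Pow_insert using assms disj
    by (subst sum.union_disjoint) (auto simp: sum.reindex[OF inj])
  also have "(\<Sum>S\<in>Pow I. (-1) ^ card (insert i S) * f (insert i S)) =
     (\<Sum>S\<in>Pow I. - ((-1) ^ card S * f (insert i S)))"
    by (intro sum.cong) (auto simp: card)
  finally show ?thesis
    by (simp add: sum_negf algebra_simps sum_subtractf)
qed

text \<open>The functions are coefficient families over an arbitrary index set, so convexity is
  stated pointwise and not in a Euclidean space of fixed dimension.\<close>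

definition fun_convex :: "('i \<Rightarrow> real) set \<Rightarrow> bool" where
  "fun_convex K \<longleftrightarrow>
    (\<forall>f\<in>K. \<forall>g\<in>K. \<forall>u. 0 \<le> u \<and> u \<le> 1 \<longrightarrow> (\<lambda>i. (1 - u) * f i + u * g i) \<in> K)"

lemma fun_convexD:
  "fun_convex K \<Longrightarrow> f \<in> K \<Longrightarrow> g \<in> K \<Longrightarrow> 0 \<le> u \<Longrightarrow> u \<le> 1 \<Longrightarrow> (\<lambda>i. (1 - u) * f i + u * g i) \<in> K"
  by (auto simp: fun_convex_def)

lemma fun_convex_Int: "fun_convex K \<Longrightarrow> fun_convex K' \<Longrightarrow> fun_convex (K \<inter> K')"
  by (auto simp: fun_convex_def)

lemma convex_comb_ge:
  fixes a b c u :: real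
  assumes "c \<le> a" "c \<le> b" "0 \<le> u" "u \<le> 1"
  shows "c \<le> (1 - u) * a + u * b"
  using convex_bound_le[of "-a" "-c" "-b" "1-u" u] assms by simp

lemma convex_comb_le:
  fixes a b c u :: real
  assumes "a \<le> c" "b \<le> c" "0 \<le> u" "u \<le> 1"
  shows "(1 - u) * a + u * b \<le> c"
  using convex_bound_le[of a c b "1-u" u] assms by simp

lemma fun_convex_ge: "fun_convex {f. c \<le> f i}"
  by (auto simp: fun_convex_def intro: convex_comb_ge)

lemma fun_convex_le: "fun_convex {f. f i \<le> c}"
  by (auto simp: fun_convex_def intro: convex_comb_le)

lemma fun_convex_eq: "fun_convex {f. f i = c}"
  using fun_convex_Int[OF fun_convex_ge[of c i] fun_convex_le[of i c]]
  by (rule back_subst[of fun_convex]) auto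

lemma fun_convex_all_ge: "fun_convex {f. \<forall>i\<in>S. c i \<le> f i}"
  by (auto simp: fun_convex_def intro: convex_comb_ge)

text \<open>Additivity of the Euler characteristic when a convex set is cut by a hyperplane. The
  point is an intermediate value argument: a segment joining the two sides meets the hyperplane, and
  \<open>u\<close> is the parameter of the meeting point.\<close>

lemma of_bool_split_hyperplane:
  assumes K: "fun_convex K"
  shows "of_bool (\<exists>f\<in>K. True) + of_bool (\<exists>f\<in>K. f i = c) =
    (of_bool (\<exists>f\<in>K. c \<le> f i) + of_bool (\<exists>f\<in>K. f i \<le> c) :: int)"
proof -
  have "\<exists>h\<in>K. h i = c" if fg: "f \<in> K" "g \<in> K" "c \<le> f i" "g i \<le> c" for f g
  proof (cases "f i = g i")
    case True
    then show ?thesis using fg by force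
  next
    case False
    define u where "u = (f i - c) / (f i - g i)"
    have "0 \<le> u" "u \<le> 1" using fg False by (auto simp: u_def field_simps)
    moreover have "u * (f i - g i) = f i - c"
      using False by (simp add: u_def)
    then have "(1 - u) * f i + u * g i = c"
      by (simp add: algebra_simps)
    ultimately show ?thesis using fun_convexD[OF K fg(1,2)] by force
  qed
  moreover have "(\<exists>f\<in>K. True) \<longleftrightarrow> (\<exists>f\<in>K. c \<le> f i) \<or> (\<exists>f\<in>K. f i \<le> c)"
    using linear by blast
  moreover have "(\<exists>f\<in>K. f i = c) \<longrightarrow> (\<exists>f\<in>K. c \<le> f i) \<and> (\<exists>f\<in>K. f i \<le> c)"
    using linear by blast
  ultimately show ?thesis by (smt (verit, best) of_bool_eq)
qed

text \<open>Since the Euler characteristic is 1 on nonempty convex sets, this is inclusion-exclusion for the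
  cover of \<open>K\<close> by half-spaces.\<close>

lemma euler_halfspace_cover:
  assumes "finite I" "fun_convex K" "\<And>f. f \<in> K \<Longrightarrow> \<exists>i\<in>I. 1 \<le> f i"
  shows "(\<Sum>S\<in>Pow I. (-1) ^ card S * of_bool (\<exists>f\<in>K. \<forall>i\<in>S. 1 \<le> f i)) = (0::int)"
  using assms
proof (induction I arbitrary: K rule: finite_induct)
  case empty
  then show ?case by auto
next
  case (insert i I K)
  let ?e = "\<lambda>K. (\<Sum>S\<in>Pow I. (-1) ^ card S * of_bool (\<exists>f\<in>K. \<forall>i\<in>S. 1 \<le> f i)) :: int"
  let ?H = "K \<inter> {f. f i \<le> 1}" and ?h = "K \<inter> {f. f i = 1}"
  have *: "(of_bool (\<exists>f\<in>K. \<forall>j\<in>S. 1 \<le> f j) - of_bool (\<exists>f\<in>K. \<forall>j\<in>insert i S. 1 \<le> f j) :: int)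
    = of_bool (\<exists>f\<in>?H. \<forall>j\<in>S. 1 \<le> f j) - of_bool (\<exists>f\<in>?h. \<forall>j\<in>S. 1 \<le> f j)" for S
  proof -
    have "fun_convex (K \<inter> {f. \<forall>j\<in>S. 1 \<le> f j})"
      by (intro fun_convex_Int insert.prems(1) fun_convex_all_ge)
    from of_bool_split_hyperplane[OF this, of i 1]
    have "of_bool (\<exists>f\<in>K. \<forall>j\<in>S. 1 \<le> f j) + of_bool (\<exists>f\<in>?h. \<forall>j\<in>S. 1 \<le> f j) =
      (of_bool (\<exists>f\<in>K. \<forall>j\<in>insert i S. 1 \<le> f j) + of_bool (\<exists>f\<in>?H. \<forall>j\<in>S. 1 \<le> f j) :: int)"
      by (simp add: Bex_def conj_ac)
    then show ?thesis by linarith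
  qed
  have eq: "(\<Sum>S\<in>Pow (insert i I). (-1) ^ card S * of_bool (\<exists>f\<in>K. \<forall>i\<in>S. 1 \<le> f i)) = ?e ?H - ?e ?h"
    unfolding sum_Pow_insert[OF insert.hyps] * by (simp add: algebra_simps sum_subtractf)
  show ?case
  \<comment> \<open>If \<open>K\<close> has no point with \<open>f i < 1\<close>, both slices
    coincide and their sums cancel. Otherwise the half-spaces of \<open>I\<close> alone cover both
    slices, and each sum vanishes by induction.\<close>
  proof (cases "\<exists>g\<in>K. g i < 1")
    case False
    then have "?H = ?h" by force
    then show ?thesis using eq by simp
  next
    case True
    then obtain g where g: "g \<in> K" "g i < 1" by blast
    \<comment> \<open>A point of the slice missed by all half-spaces of \<open>I\<close>, pushed
      slightly towards \<open>g\<close>, leaves the half-space of \<open>i\<close> strictly and by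
      continuity still misses the others, so the cover of \<open>K\<close> would fail.\<close>
    have cover: "\<exists>j\<in>I. 1 \<le> f j" if f: "f \<in> ?H" for f
    proof (rule ccontr)
      assume neg: "\<not> ?thesis"
      have "\<forall>\<^sub>F u in at_right 0. (1 - u) * f j + u * g j < 1" if "j \<in> I" for j
      proof -
        have "((\<lambda>u. (1 - u) * f j + u * g j) \<longlongrightarrow> (1 - 0) * f j + 0 * g j) (at_right 0)"
          by (intro tendsto_intros)
        then show ?thesis using neg that by (intro order_tendstoD(2)) auto
      qed
      then have "\<forall>\<^sub>F u in at_right (0::real). \<forall>j\<in>I. (1 - u) * f j + u * g j < 1"
        using insert.hyps(1) by (simp add: eventually_ball_finite)
      moreover have "\<forall>\<^sub>F u in at_right (0::real). 0 < u \<and> u < 1"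
        using eventually_at_right_real[of 0 1] by simp
      ultimately have "\<forall>\<^sub>F u in at_right (0::real).
          0 < u \<and> u < 1 \<and> (\<forall>j\<in>I. (1 - u) * f j + u * g j < 1)"
        by eventually_elim auto
      then obtain u where u: "0 < u" "u < 1" "\<forall>j\<in>I. (1 - u) * f j + u * g j < 1"
        using eventually_happens'[OF trivial_limit_at_right_real] by blast
      have "(1 - u) * f i + u * g i < 1"
      proof -
        have "(1 - u) * f i \<le> (1 - u) * 1" using f u by (intro mult_left_mono) auto
        moreover have "u * g i < u * 1" using g u by (intro mult_strict_left_mono) auto
        ultimately show ?thesis by simp
      qed
      moreover have "(\<lambda>j. (1 - u) * f j + u * g j) \<in> K"
        using fun_convexD[OF insert.prems(1)] f g u by auto
      ultimately show False using insert.prems(2) u(3) by force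
    qed
    have "?e ?H = 0"
      using cover by (intro insert.IH fun_convex_Int insert.prems(1) fun_convex_le)
    moreover have "?e ?h = 0"
      using cover by (intro insert.IH fun_convex_Int insert.prems(1) fun_convex_eq) auto
    ultimately show ?thesis using eq by simp
  qed
qed

section \<open>Finite differences and polynomial functions\<close>

definition fdiff :: "(nat \<Rightarrow> real) \<Rightarrow> nat \<Rightarrow> real" where
  "fdiff h t = h (Suc t) - h t"

text \<open>This expands a power of (shift minus identity): each element of \<open>V\<close> left
  out of \<open>S\<close> contributes one shift, each element taken contributes a sign.\<close>

lemma sum_Pow_eq_fdiff:
  assumes "finite V"
  shows "(\<Sum>S\<in>Pow V. (-1) ^ card S * h (t + (card V - card S))) = (fdiff ^^ card V) h t"
  using assms
proof (induction V arbitrary: h rule: finite_induct)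
  case (insert v V)
  have "(\<Sum>S\<in>Pow (insert v V). (-1) ^ card S * h (t + (card (insert v V) - card S))) =
    (\<Sum>S\<in>Pow V. (-1) ^ card S * fdiff h (t + (card V - card S)))"
    unfolding sum_Pow_insert[OF insert.hyps]
  proof (intro sum.cong refl)
    fix S assume "S \<in> Pow V"
    then have "card S \<le> card V" "v \<notin> S" "finite S"
      using insert.hyps by (auto intro: card_mono finite_subset)
    then show "(-1) ^ card S * (h (t + (card (insert v V) - card S)) -
        h (t + (card (insert v V) - card (insert v S)))) = (-1) ^ card S * fdiff h (t + (card V - card S))"
      using insert.hyps by (simp add: fdiff_def Suc_diff_le)
  qed
  then show ?case using insert.hyps by (simp add: insert.IH funpow_swap1)
qed simp

lemma newton_expansion:
  assumes "(fdiff ^^ m) h = (\<lambda>_. 0)"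
  shows "h t = (\<Sum>a<m. real (t choose a) * (fdiff ^^ a) h 0)"
  using assms
proof (induction m arbitrary: h t)
  case (Suc m)
  have *: "fdiff h t = (\<Sum>a<m. real (t choose a) * (fdiff ^^ Suc a) h 0)" for t
    using Suc.IH[of "fdiff h"] Suc.prems by (simp add: funpow_swap1)
  show ?case
  proof (induction t)
    case 0
    show ?case by (subst sum.lessThan_Suc_shift) simp
  next
    case (Suc t)
    have "h (Suc t) = h t + fdiff h t" by (simp add: fdiff_def)
    also have "\<dots> = (\<Sum>a<Suc m. real (t choose a) * (fdiff ^^ a) h 0) +
        (\<Sum>a<m. real (t choose a) * (fdiff ^^ Suc a) h 0)"
      using Suc.IH * by simp
    also have "\<dots> = (\<Sum>a<Suc m. real (Suc t choose a) * (fdiff ^^ a) h 0)"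
      unfolding sum.lessThan_Suc_shift by (simp add: sum.distrib[symmetric] algebra_simps)
    finally show ?case .
  qed
qed simp

section \<open>Polynomials in several variables, recognized by vanishing differences\<close>

definition pdiff :: "'i \<Rightarrow> (('i \<Rightarrow> nat) \<Rightarrow> real) \<Rightarrow> ('i \<Rightarrow> nat) \<Rightarrow> real" where
  "pdiff i g k = g (k(i := Suc (k i))) - g k"

lemma funpow_pdiff: "(pdiff i ^^ a) g k = (fdiff ^^ a) (\<lambda>t. g (k(i := t))) (k i)"
proof -
  have "(pdiff i ^^ a) g (k(i := t)) = (fdiff ^^ a) (\<lambda>t. g (k(i := t))) t" for t
    by (induction a arbitrary: t) (simp_all add: pdiff_def fdiff_def)
  from this[of "k i"] show ?thesis by simp
qed

lemma pdiff_zero [simp]: "(pdiff i ^^ a) (\<lambda>_. 0) = (\<lambda>_. 0)"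
  by (induction a) (simp_all add: pdiff_def fun_eq_iff)

lemma pdiff_commute: "pdiff i (pdiff j g) = pdiff j (pdiff i g)"
  by (cases "i = j") (auto simp: pdiff_def fun_eq_iff fun_upd_twist)

lemma funpow_pdiff_commute: "(pdiff i ^^ a) (pdiff j g) = pdiff j ((pdiff i ^^ a) g)"
  by (induction a) (simp_all add: pdiff_commute)

lemma funpow_funpow_pdiff_commute:
  "(pdiff i ^^ a) ((pdiff j ^^ b) g) = (pdiff j ^^ b) ((pdiff i ^^ a) g)"
  by (induction b) (simp_all add: funpow_pdiff_commute)

text \<open>Multiplication by one variable at a time still generates all polynomials and keeps rule
  inductions free of products of two unknown factors.\<close>

inductive polyfun :: "'i set \<Rightarrow> (('i \<Rightarrow> nat) \<Rightarrow> real) \<Rightarrow> bool" for I where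
  polyfun_const: "polyfun I (\<lambda>_. c)"
| polyfun_var_mult: "i \<in> I \<Longrightarrow> polyfun I g \<Longrightarrow> polyfun I (\<lambda>k. real (k i) * g k)"
| polyfun_add: "polyfun I g \<Longrightarrow> polyfun I h \<Longrightarrow> polyfun I (\<lambda>k. g k + h k)"

lemma polyfun_mono: "polyfun I g \<Longrightarrow> I \<subseteq> J \<Longrightarrow> polyfun J g"
  by (induction rule: polyfun.induct) (auto intro: polyfun.intros)

lemma polyfun_scale: "polyfun I g \<Longrightarrow> polyfun I (\<lambda>k. c * g k)"
proof (induction rule: polyfun.induct)
  case (polyfun_const d)
  show ?case by (rule polyfun.polyfun_const)
next
  case (polyfun_var_mult i g)
  from polyfun.polyfun_var_mult[OF polyfun_var_mult.hyps(1) polyfun_var_mult.IH]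
  show ?case by (simp add: algebra_simps)
next
  case (polyfun_add g h)
  from polyfun.polyfun_add[OF polyfun_add.IH] show ?case by (simp add: algebra_simps)
qed

lemma polyfun_diff: "polyfun I g \<Longrightarrow> polyfun I h \<Longrightarrow> polyfun I (\<lambda>k. g k - h k)"
  using polyfun_add[of I g "\<lambda>k. -1 * h k"] polyfun_scale[of I h "-1"] by simp

lemma polyfun_sum: "(\<And>a. a \<in> A \<Longrightarrow> polyfun I (g a)) \<Longrightarrow> polyfun I (\<lambda>k. \<Sum>a\<in>A. g a k)"
  by (induction A rule: infinite_finite_induct) (auto intro: polyfun.intros)

lemma polyfun_choose_mult:
  assumes "i \<in> I" "polyfun I g"
  shows "polyfun I (\<lambda>k. real (k i choose a) * g k)"
proof (induction a)
  case 0
  then show ?case using assms by simp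
next
  case (Suc a)
  have *: "real (t choose Suc a) = (1 / real (Suc a)) * ((real t - real a) * real (t choose a))" for t
  proof -
    have "Suc a * (t choose Suc a) = (t - a) * (t choose a)"
      unfolding binomial_absorption binomial_absorb_comp ..
    then have "real (Suc a) * real (t choose Suc a) = real (t - a) * real (t choose a)"
      by (metis of_nat_mult)
    also have "\<dots> = (real t - real a) * real (t choose a)"
      by (cases "a \<le> t") (auto simp: of_nat_diff)
    finally show ?thesis by (simp add: field_simps)
  qed
  have "polyfun I (\<lambda>k. (1 / real (Suc a)) * (real (k i) * (real (k i choose a) * g k) -
      real a * (real (k i choose a) * g k)))"
    by (intro polyfun_scale polyfun_diff polyfun_var_mult Suc.IH assms)
  then show ?case unfolding * by (simp add: algebra_simps)
qed

text \<open>Newton's expansion in one variable has as coefficients the iterated differences at 0.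
  These no longer depend on that variable and still satisfy the hypotheses in the others, because
  differences in distinct variables commute.\<close>

lemma polyfunI_pdiff:
  assumes "finite I" "\<And>k k'. (\<And>i. i \<in> I \<Longrightarrow> k i = k' i) \<Longrightarrow> g k = g k'"
    "\<And>i. i \<in> I \<Longrightarrow> \<exists>m. (pdiff i ^^ m) g = (\<lambda>_. 0)"
  shows "polyfun I g"
  using assms
proof (induction I arbitrary: g rule: finite_induct)
  case empty
  then have "g = (\<lambda>_. g (\<lambda>_. 0))" by auto
  then show ?case by (metis polyfun_const)
next
  case (insert i I g)
  obtain m where m: "(pdiff i ^^ m) g = (\<lambda>_. 0)" using insert.prems(2) by blast
  define G where "G a k = (pdiff i ^^ a) g (k(i := 0))" for a k
  have expand: "g k = (\<Sum>a<m. real (k i choose a) * G a k)" for k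
  proof -
    have "(fdiff ^^ m) (\<lambda>t. g (k(i := t))) t = 0" for t
      using fun_cong[OF m, of "k(i := t)"] by (simp add: funpow_pdiff)
    then have "(fdiff ^^ m) (\<lambda>t. g (k(i := t))) = (\<lambda>_. 0)"
      by (rule ext)
    from newton_expansion[OF this, of "k i"] show ?thesis by (simp add: G_def funpow_pdiff)
  qed
  have "polyfun I (G a)" for a
  proof (rule insert.IH)
    fix k k' :: "'a \<Rightarrow> nat" assume *: "\<And>j. j \<in> I \<Longrightarrow> k j = k' j"
    have "g (k(i := t)) = g (k'(i := t))" for t
      using * insert.hyps by (intro insert.prems(1)) auto
    then show "G a k = G a k'" by (simp add: G_def funpow_pdiff)
  next
    fix j assume j: "j \<in> I"
    then obtain b where b: "(pdiff j ^^ b) g = (\<lambda>_. 0)" using insert.prems(2) by blast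
    have "i \<noteq> j" using j insert.hyps by auto
    then have "(pdiff j ^^ b) (\<lambda>k. h (k(i := 0))) = (\<lambda>k. (pdiff j ^^ b) h (k(i := 0)))" for h
      by (simp add: funpow_pdiff fun_eq_iff fun_upd_twist)
    then have "(pdiff j ^^ b) (G a) = (\<lambda>k. (pdiff j ^^ b) ((pdiff i ^^ a) g) (k(i := 0)))"
      unfolding G_def by simp
    also have "\<dots> = (\<lambda>_. 0)" by (simp add: funpow_funpow_pdiff_commute b)
    finally show "\<exists>b. (pdiff j ^^ b) (G a) = (\<lambda>_. 0)" by blast
  qed
  then have "polyfun (insert i I) (G a)" for a
    by (rule polyfun_mono) auto
  then have "polyfun (insert i I) (\<lambda>k. \<Sum>a<m. real (k i choose a) * G a k)"
    by (intro polyfun_sum polyfun_choose_mult) auto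
  moreover have "g = (\<lambda>k. \<Sum>a<m. real (k i choose a) * G a k)"
    using expand by auto
  ultimately show ?case by simp
qed

section \<open>Homogeneous components and growth\<close>

inductive homfun :: "'i set \<Rightarrow> nat \<Rightarrow> (('i \<Rightarrow> nat) \<Rightarrow> real) \<Rightarrow> bool" for I where
  homfun_const: "homfun I 0 (\<lambda>_. c)"
| homfun_zero: "homfun I e (\<lambda>_. 0)"
| homfun_var_mult: "i \<in> I \<Longrightarrow> homfun I e g \<Longrightarrow> homfun I (Suc e) (\<lambda>k. real (k i) * g k)"
| homfun_add: "homfun I e g \<Longrightarrow> homfun I e h \<Longrightarrow> homfun I e (\<lambda>k. g k + h k)"

lemma homfun_scale: "homfun I e g \<Longrightarrow> g (\<lambda>i. t * k i) = real t ^ e * g k"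
  by (induction rule: homfun.induct) (simp_all add: algebra_simps)

lemma homfun_decomposition:
  assumes "polyfun I g"
  obtains E h where "\<And>e. homfun I e (h e)" "\<And>k. g k = (\<Sum>e<E. h e k)"
proof -
  have "\<exists>E h. (\<forall>e. homfun I e (h e)) \<and> (\<forall>k. g k = (\<Sum>e<E. h e k)) \<and> (\<forall>e\<ge>E. h e = (\<lambda>_. 0))"
    using assms
  proof (induction rule: polyfun.induct)
    case (polyfun_const c)
    show ?case
      by (rule exI[of _ 1], rule exI[of _ "\<lambda>e. if e = 0 then (\<lambda>_. c) else (\<lambda>_. 0)"])
        (auto intro: homfun.intros)
  next
    case (polyfun_var_mult i g)
    then obtain E h where h: "\<And>e. homfun I e (h e)" "\<And>k. g k = (\<Sum>e<E. h e k)"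
      "\<And>e. e \<ge> E \<Longrightarrow> h e = (\<lambda>_. 0)" by blast
    define h' where "h' e = (case e of 0 \<Rightarrow> (\<lambda>_. 0) | Suc e \<Rightarrow> (\<lambda>k. real (k i) * h e k))" for e
    have "homfun I e (h' e)" for e
      using h(1) polyfun_var_mult(1) by (auto simp: h'_def split: nat.split intro: homfun.intros)
    moreover have "real (k i) * g k = (\<Sum>e<Suc E. h' e k)" for k
      unfolding sum.lessThan_Suc_shift h(2) by (simp add: h'_def sum_distrib_left)
    moreover have "h' e = (\<lambda>_. 0)" if "e \<ge> Suc E" for e
      using that h(3) by (auto simp: h'_def split: nat.split)
    ultimately show ?case by blast
  next
    case (polyfun_add g1 g2)
    then obtain E1 h1 E2 h2 where h1: "\<And>e. homfun I e (h1 e)" "\<And>k. g1 k = (\<Sum>e<E1. h1 e k)"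
        "\<And>e. e \<ge> E1 \<Longrightarrow> h1 e = (\<lambda>_. 0)"
      and h2: "\<And>e. homfun I e (h2 e)" "\<And>k. g2 k = (\<Sum>e<E2. h2 e k)"
        "\<And>e. e \<ge> E2 \<Longrightarrow> h2 e = (\<lambda>_. 0)" by blast
    have "g1 k = (\<Sum>e<max E1 E2. h1 e k)" "g2 k = (\<Sum>e<max E1 E2. h2 e k)" for k
      unfolding h1(2) h2(2)
      by (intro sum.mono_neutral_left; use h1(3) h2(3) in \<open>auto simp: not_less\<close>)+
    then show ?case using h1 h2
      by (intro exI[of _ "max E1 E2"] exI[of _ "\<lambda>e k. h1 e k + h2 e k"])
        (auto intro: homfun.intros simp: sum.distrib)
  qed
  then show ?thesis using that by blast
qed

lemma poly_growth_coeff_eq_0: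
  fixes c :: "nat \<Rightarrow> real"
  assumes bound: "\<And>t::nat. \<bar>\<Sum>e<E. c e * real t ^ e\<bar> \<le> C * (1 + real t) ^ d"
    and e: "d < e" "e < E"
  shows "c e = 0"
  using e
\<comment> \<open>The induction descends from the top degree: once the coefficients above
  \<open>e\<close> vanish, dividing by \<open>t ^ e\<close> and letting t tend to infinity isolates
  \<open>c e\<close>, while the bound of order \<open>d < e\<close> tends to 0.\<close>
proof (induction "E - e" arbitrary: e rule: less_induct)
  case less
  have top: "c e' = 0" if "e < e'" "e' < E" for e'
    using less(1)[of e'] that less.prems by auto
  have eq: "(\<Sum>e'<E. c e' * real t ^ e') = (\<Sum>e'\<le>e. c e' * real t ^ e')" for t :: nat
    using top less.prems by (intro sum.mono_neutral_right) auto
  have lim1: "((\<lambda>t. (\<Sum>e'\<le>e. c e' * (real t ^ e' / real t ^ e))) \<longlongrightarrow> (\<Sum>e'\<le>e. c e' * (if e' = e then 1 else 0))) sequentially"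
  proof (intro tendsto_intros)
    fix e' assume "e' \<in> {..e}"
    show "(\<lambda>t. real t ^ e' / real t ^ e) \<longlonglongrightarrow> (if e' = e then 1 else 0)"
    proof (cases "e' = e")
      case True
      have "\<forall>\<^sub>F t in sequentially. real t ^ e' / real t ^ e = 1"
        using eventually_gt_at_top[of 0] by eventually_elim (simp add: True)
      then show ?thesis using True by (simp add: tendsto_eventually)
    next
      case False
      then have "e' < e" using \<open>e' \<in> {..e}\<close> by auto
      have "(\<lambda>t. inverse (real t) ^ (e - e')) \<longlonglongrightarrow> 0 ^ (e - e')"
        by (intro tendsto_power lim_inverse_n)
      moreover have "\<forall>\<^sub>F t in sequentially. inverse (real t) ^ (e - e') = real t ^ e' / real t ^ e"
        using eventually_gt_at_top[of 0]
        by eventually_elim (use \<open>e' < e\<close> in \<open>simp add: power_diff field_simps\<close>)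
      ultimately have "(\<lambda>t. real t ^ e' / real t ^ e) \<longlonglongrightarrow> 0 ^ (e - e')"
        by (rule Lim_transform_eventually)
      then show ?thesis using \<open>e' < e\<close> by (simp add: power_0_left)
    qed
  qed
  have lim2: "(\<lambda>t. (C * (1 + real t) ^ d) / real t ^ e) \<longlonglongrightarrow> 0"
  proof -
    have "(\<lambda>t. C * (inverse (real t) + 1) ^ d * inverse (real t) ^ (e - d)) \<longlonglongrightarrow> C * (0 + 1) ^ d * 0 ^ (e - d)"
      by (intro tendsto_intros lim_inverse_n)
    moreover have "\<forall>\<^sub>F t in sequentially. C * (inverse (real t) + 1) ^ d * inverse (real t) ^ (e - d) = (C * (1 + real t) ^ d) / real t ^ e"
      using eventually_gt_at_top[of 0]
    proof eventually_elim
      case (elim t)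
      have "real t ^ e = real t ^ d * real t ^ (e - d)" using less.prems by (simp flip: power_add)
      moreover have "(inverse (real t) + 1) ^ d * real t ^ d = (1 + real t) ^ d"
        using elim by (simp add: power_mult_distrib[symmetric] field_simps)
      ultimately show ?case using elim by (simp add: field_simps power_inverse)
    qed
    ultimately have "(\<lambda>t. (C * (1 + real t) ^ d) / real t ^ e) \<longlonglongrightarrow> C * (0 + 1) ^ d * 0 ^ (e - d)"
      by (rule Lim_transform_eventually)
    then show ?thesis using less.prems by (simp add: power_0_left)
  qed
  have "(\<lambda>t. \<Sum>e'\<le>e. c e' * (real t ^ e' / real t ^ e)) \<longlonglongrightarrow> 0"
  proof (rule Lim_null_comparison[OF _ lim2], rule always_eventually, rule allI)
    fix t :: nat
    have "(\<Sum>e'\<le>e. c e' * (real t ^ e' / real t ^ e)) = (\<Sum>e'\<le>e. c e' * real t ^ e') / real t ^ e"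
      by (simp add: sum_divide_distrib)
    then show "norm (\<Sum>e'\<le>e. c e' * (real t ^ e' / real t ^ e)) \<le> C * (1 + real t) ^ d / real t ^ e"
      using bound[of t] by (simp add: eq divide_right_mono)
  qed
  from LIMSEQ_unique[OF lim1 this] show "c e = 0"
    by (simp add: if_distrib[of "(*) _"] sum.delta cong: if_cong)
qed

text \<open>Along the ray through \<open>k\<close>, \<open>g\<close> is a polynomial in the scaling
  factor whose coefficients are the values \<open>h e k\<close>; the growth bound forces those above
  degree \<open>d\<close> to vanish, for each \<open>k\<close> separately.\<close>

lemma homfun_decomposition_growth:
  assumes "polyfun I g" "finite I" "\<And>k. \<bar>g k\<bar> \<le> C * (1 + (\<Sum>i\<in>I. real (k i))) ^ d"
  obtains h where "\<And>e. homfun I e (h e)" "\<And>k. g k = (\<Sum>e\<le>d. h e k)"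
proof -
  obtain E h where h: "\<And>e. homfun I e (h e)" "\<And>k. g k = (\<Sum>e<E. h e k)"
    by (rule homfun_decomposition[OF assms(1)], erule that)
  have C: "0 \<le> C" using assms(3)[of "\<lambda>_. 0"] by simp
  have zero: "h e k = 0" if e: "d < e" "e < E" for e k
  proof (rule poly_growth_coeff_eq_0[OF _ e])
    fix t :: nat
    define s where "s = (\<Sum>i\<in>I. real (k i))"
    have s: "s \<ge> 0" by (simp add: s_def sum_nonneg)
    have "\<bar>\<Sum>e<E. h e k * real t ^ e\<bar> = \<bar>g (\<lambda>i. t * k i)\<bar>"
      unfolding h(2) homfun_scale[OF h(1)] by (simp add: mult.commute)
    also have "\<dots> \<le> C * (1 + real t * s) ^ d"
      using assms(3)[of "\<lambda>i. t * k i"] by (simp add: s_def sum_distrib_left)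
    also have "\<dots> \<le> C * ((1 + s) * (1 + real t)) ^ d"
      using C s by (intro mult_left_mono power_mono) (auto simp: algebra_simps)
    finally show "\<bar>\<Sum>e<E. h e k * real t ^ e\<bar> \<le> (C * (1 + s) ^ d) * (1 + real t) ^ d"
      by (simp only: power_mult_distrib mult.assoc)
  qed
  define h' where "h' e = (if e < E then h e else (\<lambda>_. 0))" for e
  have "g k = (\<Sum>e\<le>d. h' e k)" for k
  proof -
    have "g k = (\<Sum>e<E. h' e k)" by (simp add: h(2) h'_def)
    also have "\<dots> = (\<Sum>e\<in>{..<E} \<inter> {..d}. h' e k)"
      by (intro sum.mono_neutral_right) (use zero in \<open>auto simp: h'_def not_le\<close>)
    also have "\<dots> = (\<Sum>e\<le>d. h' e k)"
      by (intro sum.mono_neutral_left) (auto simp: h'_def)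
    finally show ?thesis .
  qed
  moreover have "homfun I e (h' e)" for e
    using h(1) by (simp add: h'_def homfun_zero)
  ultimately show ?thesis using that by blast
qed

definition ind :: "'i set \<Rightarrow> 'i \<Rightarrow> nat" where
  "ind J i = of_bool (i \<in> J)"

text \<open>Differences in more variables than the degree annihilate a homogeneous function.
  \<open>J0\<close> collects the variables already set to 1: for a factor \<open>k i\<close> with
  \<open>i \<in> T\<close> only the terms with \<open>k i = 1\<close> survive, so \<open>i\<close>
  moves from \<open>T\<close> to \<open>J0\<close> while both the degree and \<open>card T\<close>
  drop by one.\<close>

lemma homfun_mixed_difference:
  assumes "homfun I e g" "finite T" "T \<inter> J0 = {}" "e < card T"
  shows "(\<Sum>J\<in>Pow T. (-1) ^ card J * g (ind (J \<union> J0))) = 0"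
  using assms
proof (induction arbitrary: T J0 rule: homfun.induct)
  case (homfun_const c)
  then obtain i T' where T: "T = insert i T'" "i \<notin> T'" by (metis card_gt_0_iff equals0I mk_disjoint_insert)
  then have "finite T'" using homfun_const by simp
  then show ?case unfolding T(1) by (subst sum_Pow_insert) (use T in auto)
next
  case (homfun_var_mult i e g)
  show ?case
  proof (cases "i \<in> T")
    case True
    then obtain T' where T: "T = insert i T'" "i \<notin> T'" by (meson mk_disjoint_insert)
    then have fin: "finite T'" using homfun_var_mult by simp
    have "(\<Sum>J\<in>Pow T. (-1) ^ card J * (real (ind (J \<union> J0) i) * g (ind (J \<union> J0)))) =
      (\<Sum>J\<in>Pow T'. (-1) ^ card J * - g (ind (J \<union> insert i J0)))"
      unfolding T(1) sum_Pow_insert[OF fin T(2)]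
      by (intro sum.cong) (use T homfun_var_mult in \<open>auto simp: ind_def\<close>)
    also have "\<dots> = - (\<Sum>J\<in>Pow T'. (-1) ^ card J * g (ind (J \<union> insert i J0)))"
      by (simp add: sum_negf)
    also have "\<dots> = 0"
      using homfun_var_mult T fin by (subst homfun_var_mult.IH) auto
    finally show ?thesis .
  next
    case False
    have "(\<Sum>J\<in>Pow T. (-1) ^ card J * (real (ind (J \<union> J0) i) * g (ind (J \<union> J0)))) =
      (\<Sum>J\<in>Pow T. real (ind J0 i) * ((-1) ^ card J * g (ind (J \<union> J0))))"
      by (intro sum.cong) (use False in \<open>auto simp: ind_def\<close>)
    also have "\<dots> = 0"
      unfolding sum_distrib_left[symmetric] using homfun_var_mult by (subst homfun_var_mult.IH) auto
    finally show ?thesis .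
  qed
next
  case (homfun_add e g h)
  then show ?case by (simp add: algebra_simps sum.distrib)
qed simp

lemma mixed_difference_eq_0:
  assumes "polyfun I g" "finite I" "\<And>k. \<bar>g k\<bar> \<le> C * (1 + (\<Sum>i\<in>I. real (k i))) ^ d" "d < card I"
  shows "(\<Sum>J\<in>Pow I. (-1) ^ card J * g (ind J)) = 0"
proof -
  obtain h where h: "\<And>e. homfun I e (h e)" "\<And>k. g k = (\<Sum>e\<le>d. h e k)"
    by (rule homfun_decomposition_growth[OF assms(1-3)], erule that)
  have "(\<Sum>J\<in>Pow I. (-1) ^ card J * g (ind J)) =
      (\<Sum>e\<le>d. \<Sum>J\<in>Pow I. (-1) ^ card J * h e (ind (J \<union> {})))"
    unfolding h(2) sum_distrib_left by (subst sum.swap) simp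
  also have "\<dots> = 0"
    using assms(2,4) by (intro sum.neutral ballI homfun_mixed_difference[OF h(1)]) auto
  finally show ?thesis .
qed

lemma homfun_bound:
  assumes "homfun I e h" "finite I"
  obtains C where "\<And>k. \<bar>h k\<bar> \<le> C * (1 + (\<Sum>i\<in>I. real (k i))) ^ e" "C \<ge> 0"
proof -
  have "\<exists>C\<ge>0. \<forall>k. \<bar>h k\<bar> \<le> C * (1 + (\<Sum>i\<in>I. real (k i))) ^ e"
    using assms(1)
  proof (induction rule: homfun.induct)
    case (homfun_const c)
    show ?case by (rule exI[of _ "\<bar>c\<bar>"]) simp
  next
    case (homfun_var_mult i e g)
    then obtain C where C: "C \<ge> 0" "\<And>k. \<bar>g k\<bar> \<le> C * (1 + (\<Sum>i\<in>I. real (k i))) ^ e" by blast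
    have "\<bar>real (k i) * g k\<bar> \<le> C * (1 + (\<Sum>i\<in>I. real (k i))) ^ Suc e" for k
    proof -
      have "real (k i) \<le> (\<Sum>i\<in>I. real (k i))"
        using homfun_var_mult assms(2) by (intro member_le_sum) auto
      then have "real (k i) * \<bar>g k\<bar> \<le> (1 + (\<Sum>i\<in>I. real (k i))) * (C * (1 + (\<Sum>i\<in>I. real (k i))) ^ e)"
        using C(2)[of k] by (intro mult_mono) auto
      then show ?thesis by (simp add: abs_mult algebra_simps)
    qed
    then show ?case using C(1) by blast
  next
    case (homfun_add e g h)
    then obtain C D where "C \<ge> 0" "D \<ge> 0" "\<And>k. \<bar>g k\<bar> \<le> C * (1 + (\<Sum>i\<in>I. real (k i))) ^ e"
      "\<And>k. \<bar>h k\<bar> \<le> D * (1 + (\<Sum>i\<in>I. real (k i))) ^ e" by blast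
    then show ?case
      by (intro exI[of _ "C + D"]) (auto simp: algebra_simps intro: order_trans[OF abs_triangle_ineq] add_mono)
  qed auto
  then show ?thesis using that by blast
qed

text \<open>The extra factor on the left expresses the loss of one degree without a truncated
  exponent \<open>e - 1\<close>; for \<open>e = 0\<close> the difference itself is zero.\<close>

lemma homfun_pdiff_bound:
  assumes "homfun I e h" "finite I" "i \<in> I"
  obtains C where "\<And>k. \<bar>pdiff i h k\<bar> * (1 + (\<Sum>i\<in>I. real (k i))) \<le> C * (1 + (\<Sum>i\<in>I. real (k i))) ^ e"
proof -
  define s where "s k = 1 + (\<Sum>i\<in>I. real (k i))" for k :: "'a \<Rightarrow> nat"
  have s1: "1 \<le> s k" for k by (simp add: s_def sum_nonneg)
  have sup: "s (k(i := Suc (k i))) = s k + 1" for k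
  proof -
    have "(\<Sum>j\<in>I. real ((k(i := Suc (k i))) j)) = (\<Sum>j\<in>I. real (k j) + of_bool (j = i))"
      by (intro sum.cong) auto
    also have "\<dots> = (\<Sum>j\<in>I. real (k j)) + 1"
      using assms by (simp add: sum.distrib of_bool_def sum.delta')
    finally show ?thesis by (simp add: s_def)
  qed
  have "\<exists>C\<ge>0. \<forall>k. \<bar>pdiff i h k\<bar> * s k \<le> C * s k ^ e"
    using assms(1)
  proof (induction rule: homfun.induct)
    case (homfun_var_mult j e g)
    then obtain C where C: "C \<ge> 0" "\<And>k. \<bar>pdiff i g k\<bar> * s k \<le> C * s k ^ e" by blast
    obtain D where D: "D \<ge> 0" "\<And>k. \<bar>g k\<bar> \<le> D * s k ^ e"
      using homfun_bound[OF homfun_var_mult(2) assms(2)] unfolding s_def by metis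
    \<comment> \<open>By the product rule only \<open>j = i\<close> adds a value of \<open>g\<close>
      at the shifted argument, where \<open>s\<close> has grown by 1. The constant
      \<open>2 ^ e\<close> comes from \<open>s k + 1 \<le> 2 * s k\<close>.\<close>
    have "\<bar>pdiff i (\<lambda>k. real (k j) * g k) k\<bar> * s k \<le> (C + D * 2 ^ e) * s k ^ Suc e" for k
    proof -
      let ?k = "k(i := Suc (k i))"
      have "pdiff i (\<lambda>k. real (k j) * g k) k = real (k j) * pdiff i g k + of_bool (j = i) * g ?k"
        by (auto simp: pdiff_def algebra_simps)
      then have "\<bar>pdiff i (\<lambda>k. real (k j) * g k) k\<bar> \<le> real (k j) * \<bar>pdiff i g k\<bar> + \<bar>g ?k\<bar>"
        by (auto simp: abs_mult intro: order_trans[OF abs_triangle_ineq])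
      then have "\<bar>pdiff i (\<lambda>k. real (k j) * g k) k\<bar> * s k \<le>
          (real (k j) * \<bar>pdiff i g k\<bar> + \<bar>g ?k\<bar>) * s k"
        using s1[of k] by (intro mult_right_mono) auto
      also have "\<dots> = real (k j) * (\<bar>pdiff i g k\<bar> * s k) + \<bar>g ?k\<bar> * s k"
        by (simp only: distrib_right mult.assoc)
      also have "real (k j) * (\<bar>pdiff i g k\<bar> * s k) \<le> s k * (C * s k ^ e)"
      proof (rule mult_mono[OF _ C(2)])
        have "real (k j) \<le> (\<Sum>i\<in>I. real (k i))"
          using homfun_var_mult assms(2) by (intro member_le_sum) auto
        then show "real (k j) \<le> s k" by (simp add: s_def)
      qed (use s1[of k] in auto)
      also have "\<bar>g ?k\<bar> * s k \<le> (D * (2 ^ e * s k ^ e)) * s k"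
      proof (intro mult_right_mono)
        have "\<bar>g ?k\<bar> \<le> D * (s k + 1) ^ e" using D(2)[of ?k] by (simp add: sup)
        also have "\<dots> \<le> D * (2 * s k) ^ e"
          using D(1) s1[of k] by (intro mult_left_mono power_mono) auto
        finally show "\<bar>g ?k\<bar> \<le> D * (2 ^ e * s k ^ e)" by (simp add: power_mult_distrib)
      qed (use s1[of k] in auto)
      finally show ?thesis by (simp add: algebra_simps)
    qed
    moreover have "C + D * 2 ^ e \<ge> 0" using C(1) D(1) by simp
    ultimately show ?case by blast
  next
    case (homfun_add e g h)
    then obtain C D where C: "C \<ge> 0" "D \<ge> 0" "\<And>k. \<bar>pdiff i g k\<bar> * s k \<le> C * s k ^ e"
      "\<And>k. \<bar>pdiff i h k\<bar> * s k \<le> D * s k ^ e" by blast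
    have "\<bar>pdiff i (\<lambda>k. g k + h k) k\<bar> * s k \<le> (C + D) * s k ^ e" for k
    proof -
      have "pdiff i (\<lambda>k. g k + h k) k = pdiff i g k + pdiff i h k" by (simp add: pdiff_def)
      then have "\<bar>pdiff i (\<lambda>k. g k + h k) k\<bar> * s k \<le> (\<bar>pdiff i g k\<bar> + \<bar>pdiff i h k\<bar>) * s k"
        using s1[of k] by (intro mult_right_mono) (auto intro: abs_triangle_ineq)
      then show ?thesis using C(3,4)[of k] by (simp add: algebra_simps)
    qed
    then show ?case using C(1,2) by (meson add_nonneg_nonneg)
  qed (auto simp: pdiff_def)
  then show ?thesis using that unfolding s_def by blast
qed

text \<open>For a general function a growth bound yields no better bound on its differences. Here a
  degree is gained because \<open>g\<close> splits into homogeneous components, each of which loses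
  one.\<close>

lemma pdiff_growth:
  assumes "polyfun I g" "finite I" "\<And>k. \<bar>g k\<bar> \<le> C * (1 + (\<Sum>i\<in>I. real (k i))) ^ Suc d" "i \<in> I"
  obtains D where "\<And>k. \<bar>pdiff i g k\<bar> \<le> D * (1 + (\<Sum>i\<in>I. real (k i))) ^ d"
proof -
  define s where "s k = 1 + (\<Sum>i\<in>I. real (k i))" for k :: "'a \<Rightarrow> nat"
  have s1: "1 \<le> s k" for k by (simp add: s_def sum_nonneg)
  obtain h where h: "\<And>e. homfun I e (h e)" "\<And>k. g k = (\<Sum>e\<le>Suc d. h e k)"
    by (rule homfun_decomposition_growth[OF assms(1-3)], erule that)
  have "\<exists>C. \<forall>k. \<bar>pdiff i (h e) k\<bar> * s k \<le> C * s k ^ e" for e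
    using homfun_pdiff_bound[OF h(1) assms(2,4)] unfolding s_def by metis
  then obtain D where D: "\<And>e k. \<bar>pdiff i (h e) k\<bar> * s k \<le> D e * s k ^ e" by metis
  have "\<bar>pdiff i g k\<bar> \<le> (\<Sum>e\<le>Suc d. \<bar>D e\<bar>) * s k ^ d" for k
  proof -
    have "\<bar>pdiff i g k\<bar> * s k = \<bar>\<Sum>e\<le>Suc d. pdiff i (h e) k\<bar> * s k"
      unfolding pdiff_def h(2) sum_subtractf[symmetric] ..
    also have "\<dots> \<le> (\<Sum>e\<le>Suc d. \<bar>pdiff i (h e) k\<bar>) * s k"
      using s1[of k] by (intro mult_right_mono sum_abs) auto
    also have "\<dots> \<le> (\<Sum>e\<le>Suc d. \<bar>D e\<bar> * s k ^ Suc d)"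
      unfolding sum_distrib_right
    proof (intro sum_mono)
      fix e assume "e \<in> {..Suc d}"
      have "\<bar>pdiff i (h e) k\<bar> * s k \<le> \<bar>D e\<bar> * s k ^ e"
        using D[of e k] s1[of k] by (smt (verit) mult_right_mono zero_le_power)
      also have "\<dots> \<le> \<bar>D e\<bar> * s k ^ Suc d"
        using s1[of k] \<open>e \<in> _\<close> by (intro mult_left_mono power_increasing) auto
      finally show "\<bar>pdiff i (h e) k\<bar> * s k \<le> \<bar>D e\<bar> * s k ^ Suc d" .
    qed
    finally have "\<bar>pdiff i g k\<bar> * s k \<le> ((\<Sum>e\<le>Suc d. \<bar>D e\<bar>) * s k ^ d) * s k"
      by (simp only: sum_distrib_right power_Suc2 mult.assoc)
    then show ?thesis using s1[of k] by (simp add: mult_le_cancel_right)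
  qed
  then show ?thesis using that unfolding s_def by blast
qed

section \<open>Lattice points of Minkowski sums with dilates\<close>

text \<open>Stated without division by the total weight, which may be 0; in that case any point of
  the hull serves.\<close>

lemma convex_hull_scaled_combination:
  fixes V :: "'a::real_vector set"
  assumes V: "finite V" "V \<noteq> {}" and h: "\<And>v. v \<in> V \<Longrightarrow> 0 \<le> h v"
  shows "\<exists>p\<in>convex hull V. (\<Sum>v\<in>V. h v *\<^sub>R v) = (\<Sum>v\<in>V. h v) *\<^sub>R p"
proof (cases "(\<Sum>v\<in>V. h v) = 0")
  case True
  then have "h v = 0" if "v \<in> V" for v
    using that h V by (simp add: sum_nonneg_eq_0_iff)
  then show ?thesis using V hull_inc[of _ V convex] by (auto simp: True)
next
  case False
  define c where "c = (\<Sum>v\<in>V. h v)"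
  have c: "c > 0" using False h by (simp add: c_def sum_nonneg order_less_le)
  have "(\<Sum>v\<in>V. (h v / c) *\<^sub>R v) \<in> convex hull V"
    unfolding convex_hull_finite[OF V(1)] mem_Collect_eq
    using h c by (intro exI[of _ "\<lambda>v. h v / c"]) (auto simp: sum_divide_distrib[symmetric] c_def[symmetric])
  moreover have "(\<Sum>v\<in>V. h v *\<^sub>R v) = c *\<^sub>R (\<Sum>v\<in>V. (h v / c) *\<^sub>R v)"
    using c by (simp add: scaleR_sum_right)
  ultimately show ?thesis unfolding c_def by blast
qed

text \<open>The nonnegative families in \<open>K\<close> have mean value 1, so some coefficient is
  at least 1: the half-spaces \<open>1 \<le> f v\<close> cover \<open>K\<close>. This is why the
  total weight is \<open>card V\<close>. Subtracting 1 from the coefficients in \<open>S\<close>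
  turns the families in all half-spaces of \<open>S\<close> into representations of \<open>x\<close>
  by \<open>Q\<close>, the dilate of factor \<open>card V - card S\<close>, and
  \<open>\<Sum>S\<close>.\<close>

lemma dilate_inclusion_exclusion:
  fixes V :: "'a::real_vector set"
  assumes V: "finite V" "V \<noteq> {}" and Q: "convex Q"
  shows "(\<Sum>S\<in>Pow V. (-1) ^ card S *
    of_bool (\<exists>q\<in>Q. \<exists>p\<in>convex hull V. x = q + real (card V - card S) *\<^sub>R p + \<Sum>S)) = (0::int)"
proof -
  define K where "K = {f. (\<forall>v\<in>V. 0 \<le> f v) \<and> (\<Sum>v\<in>V. f v) = real (card V) \<and> x - (\<Sum>v\<in>V. f v *\<^sub>R v) \<in> Q}"
  have "fun_convex K"
    unfolding fun_convex_def
  proof (intro ballI allI impI)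
    fix f g and u :: real assume f: "f \<in> K" and g: "g \<in> K" and u: "0 \<le> u \<and> u \<le> 1"
    have "x - (\<Sum>v\<in>V. ((1 - u) * f v + u * g v) *\<^sub>R v) =
      (1 - u) *\<^sub>R (x - (\<Sum>v\<in>V. f v *\<^sub>R v)) + u *\<^sub>R (x - (\<Sum>v\<in>V. g v *\<^sub>R v))"
      by (simp add: algebra_simps scaleR_sum_right sum.distrib sum_subtractf)
    also have "\<dots> \<in> Q" using f g u by (intro convexD[OF Q]) (auto simp: K_def)
    finally have "x - (\<Sum>v\<in>V. ((1 - u) * f v + u * g v) *\<^sub>R v) \<in> Q" .
    moreover have "(\<Sum>v\<in>V. (1 - u) * f v + u * g v) = (1 - u) * (\<Sum>v\<in>V. f v) + u * (\<Sum>v\<in>V. g v)"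
      by (simp add: sum.distrib sum_distrib_left)
    then have "(\<Sum>v\<in>V. (1 - u) * f v + u * g v) = real (card V)"
      using f g by (simp add: K_def algebra_simps)
    ultimately show "(\<lambda>i. (1 - u) * f i + u * g i) \<in> K"
      using f g u by (auto simp: K_def intro!: convex_comb_ge)
  qed
  moreover have "\<exists>v\<in>V. 1 \<le> f v" if "f \<in> K" for f
  proof (rule ccontr)
    assume "\<not> ?thesis"
    then have "(\<Sum>v\<in>V. f v) < (\<Sum>v\<in>V. 1)" by (intro sum_strict_mono V) auto
    then show False using that by (simp add: K_def)
  qed
  moreover have "(\<exists>f\<in>K. \<forall>v\<in>S. 1 \<le> f v) \<longleftrightarrow>
      (\<exists>q\<in>Q. \<exists>p\<in>convex hull V. x = q + real (card V - card S) *\<^sub>R p + \<Sum>S)" if S: "S \<in> Pow V" for S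
  proof -
    have SV: "S \<subseteq> V" "finite S" "card S \<le> card V"
      using S V by (auto intro: finite_subset card_mono)
    have ind: "(\<Sum>v\<in>V. of_bool (v \<in> S) *\<^sub>R v) = \<Sum>S"
      using SV V by (simp add: if_distrib[of "\<lambda>c. c *\<^sub>R _"] of_bool_def sum.If_cases Int_absorb1 cong: if_cong)
    have ind1: "(\<Sum>v\<in>V. of_bool (v \<in> S)) = real (card S)"
      using SV V by (simp add: of_bool_def sum.If_cases Int_absorb1)
    show ?thesis
    proof safe
      fix f assume f: "f \<in> K" "\<forall>v\<in>S. 1 \<le> f v"
      define h where "h v = f v - of_bool (v \<in> S)" for v
      have "\<And>v. v \<in> V \<Longrightarrow> 0 \<le> h v" using f by (auto simp: h_def K_def)
      from convex_hull_scaled_combination[of V h, OF V this] obtain p where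
        p: "p \<in> convex hull V" "(\<Sum>v\<in>V. h v *\<^sub>R v) = (\<Sum>v\<in>V. h v) *\<^sub>R p" by blast
      have "(\<Sum>v\<in>V. h v) = real (card V - card S)"
        using f SV by (simp add: h_def sum_subtractf ind1 K_def of_nat_diff)
      moreover have "(\<Sum>v\<in>V. h v *\<^sub>R v) = (\<Sum>v\<in>V. f v *\<^sub>R v) - \<Sum>S"
        by (simp only: h_def scaleR_diff_left sum_subtractf ind)
      ultimately have "x = (x - (\<Sum>v\<in>V. f v *\<^sub>R v)) + real (card V - card S) *\<^sub>R p + \<Sum>S"
        using p(2) by (simp add: algebra_simps)
      then show "\<exists>q\<in>Q. \<exists>p\<in>convex hull V. x = q + real (card V - card S) *\<^sub>R p + \<Sum>S"
        using p(1) f(1) by (intro bexI[of _ "x - (\<Sum>v\<in>V. f v *\<^sub>R v)"] bexI[of _ p]) (auto simp: K_def)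
    next
      fix q p assume q: "q \<in> Q" "p \<in> convex hull V" "x = q + real (card V - card S) *\<^sub>R p + \<Sum>S"
      then obtain u where u: "\<forall>v\<in>V. 0 \<le> u v" "sum u V = 1" "(\<Sum>v\<in>V. u v *\<^sub>R v) = p"
        using convex_hull_finite[OF V(1)] by auto
      define f where "f v = real (card V - card S) * u v + of_bool (v \<in> S)" for v
      have "(\<Sum>v\<in>V. f v) = real (card V)"
        using SV u(2) by (simp add: f_def sum.distrib ind1 of_nat_diff flip: sum_distrib_left)
      moreover have "(\<Sum>v\<in>V. f v *\<^sub>R v) = real (card V - card S) *\<^sub>R p + \<Sum>S"
        by (simp only: f_def scaleR_add_left sum.distrib ind flip: u(3) scaleR_scaleR scaleR_sum_right)
      ultimately have "f \<in> K" using u q by (auto simp: K_def f_def)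
      moreover have "\<forall>v\<in>S. 1 \<le> f v" using u SV by (auto simp: f_def)
      ultimately show "\<exists>f\<in>K. \<forall>v\<in>S. 1 \<le> f v" by blast
    qed
  qed
  ultimately show ?thesis
    using euler_halfspace_cover[OF V(1), of K] by simp
qed

section \<open>Minkowski sums of polytopes and lattice point counts\<close>

lemma bounded_set_plus: "bounded A \<Longrightarrow> bounded B \<Longrightarrow> bounded (A + B)"
  for A B :: "'a::real_normed_vector set"
  unfolding set_plus_image by (rule bounded_plus)

lemma polytope_set_plus:
  fixes A B :: "'a::real_vector set"
  assumes "polytope A" "polytope B"
  shows "polytope (A + B)"
proof -
  obtain V W where "finite V" "A = convex hull V" "finite W" "B = convex hull W"
    using assms by (auto simp: polytope_def)
  then have "A + B = convex hull (V + W)" "finite (V + W)"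
    by (auto simp: convex_hull_set_plus finite_set_plus)
  then show ?thesis by (simp add: polytope_convex_hull)
qed

lemma polytope_set_sum:
  fixes B :: "'i \<Rightarrow> 'a::real_vector set"
  shows "(\<And>i. i \<in> A \<Longrightarrow> polytope (B i)) \<Longrightarrow> polytope (\<Sum>i\<in>A. B i)"
  by (induction A rule: infinite_finite_induct) (auto intro: polytope_set_plus polytope_sing)

lemma set_plus_nonempty: "A \<noteq> {} \<Longrightarrow> B \<noteq> {} \<Longrightarrow> A + B \<noteq> {}"
  for A B :: "'a::plus set"
  by (auto simp: set_plus_def)

lemma set_sum_nonempty: "(\<And>i. i \<in> A \<Longrightarrow> B i \<noteq> {}) \<Longrightarrow> (\<Sum>i\<in>A. B i) \<noteq> {}"
  for B :: "'i \<Rightarrow> 'a::comm_monoid_add set"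
  by (induction A rule: infinite_finite_induct) (auto intro: set_plus_nonempty)

locale full_lattice =
  fixes L :: "(real ^ 'n) set" and B
  assumes indep: "independent B" and card_B: "card B = CARD('n)" and L_eq: "L = group_closure B"
    and integral: "L \<subseteq> integer_vectors"
begin

lemma L_add: "x \<in> L \<Longrightarrow> y \<in> L \<Longrightarrow> x + y \<in> L"
  by (simp add: L_eq group_closure_add)

lemma L_diff: "x \<in> L \<Longrightarrow> y \<in> L \<Longrightarrow> x - y \<in> L"
  by (simp add: L_eq group_closure.diff)

lemma L_0 [simp]: "0 \<in> L"
  by (simp add: L_eq)

lemma L_sum: "(\<And>a. a \<in> A \<Longrightarrow> f a \<in> L) \<Longrightarrow> sum f A \<in> L"
  by (induction A rule: infinite_finite_induct) (auto intro: L_add)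

text \<open>Lattice points have integer coordinates, so those of norm at most \<open>r\<close> lie
  among the integer points of a cube. The bound is explicit in \<open>r\<close> because the degree
  of the counting polynomials is read off from it.\<close>

lemma card_box_bound:
  fixes A :: "(real ^ 'n) set"
  assumes "\<And>x. x \<in> A \<Longrightarrow> norm x \<le> r" "0 \<le> r"
  shows "finite (A \<inter> L) \<and> real (card (A \<inter> L)) \<le> (2 * r + 1) ^ CARD('n)"
proof -
  define X where "X = (\<lambda>f. \<chi> i. real_of_int (f i)) ` (PiE (UNIV :: 'n set) (\<lambda>_. {-\<lfloor>r\<rfloor>..\<lfloor>r\<rfloor>}))"
  have sub: "A \<inter> L \<subseteq> (X :: (real ^ 'n) set)"
  proof
    fix x assume x: "x \<in> A \<inter> L"
    then have int: "x $ i \<in> \<int>" for i using integral by (auto simp: integer_vectors_def)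
    have "\<bar>x $ i\<bar> \<le> r" for i using assms(1)[of x] x component_le_norm_cart[of x i] by auto
    then have "\<lfloor>x $ i\<rfloor> \<in> {-\<lfloor>r\<rfloor>..\<lfloor>r\<rfloor>}" for i
    proof -
      obtain z where z: "x $ i = of_int z" using int[of i] by (auto elim: Ints_cases)
      have "real_of_int z \<le> r" "real_of_int (- z) \<le> r"
        using \<open>\<And>i. \<bar>x $ i\<bar> \<le> r\<close>[of i] by (simp_all add: z abs_le_iff)
      then have "z \<le> \<lfloor>r\<rfloor>" "- z \<le> \<lfloor>r\<rfloor>" unfolding le_floor_iff .
      then show ?thesis by (simp add: z)
    qed
    moreover have "x = (\<chi> i. real_of_int \<lfloor>x $ i\<rfloor>)"
      using int by (simp add: vec_eq_iff)
    ultimately show "x \<in> X" by (auto simp: X_def PiE_def)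
  qed
  have "finite X" by (simp add: X_def finite_PiE)
  moreover have "card X \<le> nat (2 * \<lfloor>r\<rfloor> + 1) ^ CARD('n)"
  proof -
    have "card X \<le> card (PiE (UNIV :: 'n set) (\<lambda>_. {-\<lfloor>r\<rfloor>..\<lfloor>r\<rfloor>}))"
      unfolding X_def by (intro card_image_le finite_PiE) auto
    then show ?thesis by (simp add: card_PiE)
  qed
  moreover have "real (nat (2 * \<lfloor>r\<rfloor> + 1) ^ CARD('n)) \<le> (2 * r + 1) ^ CARD('n)"
    unfolding of_nat_power using assms(2) by (intro power_mono) (auto simp: of_nat_nat)
  ultimately show ?thesis
    using sub by (meson card_mono finite_subset of_nat_le_iff order_trans)
qed

lemma finite_L: "bounded A \<Longrightarrow> finite (A \<inter> L)"
  using card_box_bound[of A] by (meson bounded_pos less_imp_le)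

lemma lattice_count_eq_sum:
  assumes "finite X" "A \<inter> L \<subseteq> X" "X \<subseteq> L"
  shows "lattice_count L A = (\<Sum>x\<in>X. of_bool (x \<in> A))"
proof -
  have "A \<inter> L = {x \<in> X. x \<in> A}" using assms by auto
  then show ?thesis using assms(1) by (simp add: lattice_count_def of_bool_def sum.If_cases Int_def)
qed

lemma lattice_count_translate:
  assumes "v \<in> L"
  shows "lattice_count L ((\<lambda>y. y + v) ` A) = lattice_count L A"
proof -
  have "((\<lambda>y. y + v) ` A) \<inter> L = (\<lambda>y. y + v) ` (A \<inter> L)"
    using assms by (auto simp: image_iff intro: L_add dest: L_diff[of _ v])
  then show ?thesis by (simp add: lattice_count_def card_image inj_on_def)
qed

lemma lattice_count_mono:
  assumes "A \<subseteq> A'" "bounded A'"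
  shows "lattice_count L A \<le> lattice_count L A'"
  unfolding lattice_count_def using assms by (auto intro!: card_mono finite_L)

text \<open>Sums \<open>dilate_inclusion_exclusion\<close> over a finite set \<open>X\<close>
  holding all lattice points of the translated sets. The translations by \<open>\<Sum>S\<close> do
  not affect the counts, since \<open>V\<close> consists of lattice points; this is the only use of
  integrality.\<close>

lemma lattice_count_dilates:
  assumes V: "finite V" "V \<noteq> {}" "V \<subseteq> L" and Q: "convex Q" "bounded Q"
  shows "(\<Sum>S\<in>Pow V. (-1) ^ card S *
    lattice_count L (Q + (*\<^sub>R) (real (card V - card S)) ` (convex hull V))) = 0"
proof -
  let ?A = "\<lambda>S. Q + (*\<^sub>R) (real (card V - card S)) ` (convex hull V)"
  have bdd: "bounded (?A S)" for S
    using Q V by (intro bounded_set_plus bounded_scaling finite_imp_bounded_convex_hull) auto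
  define X where "X = (\<Union>S\<in>Pow V. ((\<lambda>y. y + \<Sum>S) ` ?A S) \<inter> L)"
  have "bounded ((\<lambda>y. y + \<Sum>S) ` ?A S)" for S
    using bounded_translation[OF bdd, of "\<Sum>S" S] by (simp add: add.commute)
  then have X: "finite X" "X \<subseteq> L"
    unfolding X_def using V by (auto intro!: finite_L)
  have "lattice_count L (?A S) = (\<Sum>x\<in>X. of_bool (\<exists>q\<in>Q. \<exists>p\<in>convex hull V. x = q + real (card V - card S) *\<^sub>R p + \<Sum>S))"
    if "S \<in> Pow V" for S
  proof -
    have mem: "\<And>x. x \<in> (\<lambda>y. y + \<Sum>S) ` ?A S \<longleftrightarrow> (\<exists>q\<in>Q. \<exists>p\<in>convex hull V. x = q + real (card V - card S) *\<^sub>R p + \<Sum>S)"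
      by (auto simp: set_plus_def image_iff)
    have "\<Sum>S \<in> L" using that V by (intro L_sum) auto
    then have "lattice_count L (?A S) = lattice_count L ((\<lambda>y. y + \<Sum>S) ` ?A S)"
      by (simp add: lattice_count_translate)
    also have "\<dots> = (\<Sum>x\<in>X. of_bool (x \<in> (\<lambda>y. y + \<Sum>S) ` ?A S))"
      by (rule lattice_count_eq_sum[OF X(1) _ X(2)]) (use that in \<open>auto simp: X_def\<close>)
    finally show ?thesis by (simp only: mem)
  qed
  then have "(\<Sum>S\<in>Pow V. (-1) ^ card S * lattice_count L (?A S)) =
    (\<Sum>x\<in>X. \<Sum>S\<in>Pow V. (-1) ^ card S * of_bool (\<exists>q\<in>Q. \<exists>p\<in>convex hull V. x = q + real (card V - card S) *\<^sub>R p + \<Sum>S))"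
    by (simp add: sum_distrib_left sum.swap[of _ X])
  also have "\<dots> = 0"
    using dilate_inclusion_exclusion[OF V(1,2) Q(1)] by simp
  finally show ?thesis .
qed

end

section \<open>Sums of dilates\<close>

lemma scaleR_set_add:
  fixes P :: "'a::real_vector set"
  assumes P: "convex P" and ab: "0 \<le> a" "0 \<le> b"
  shows "(*\<^sub>R) (a + b) ` P = (*\<^sub>R) a ` P + (*\<^sub>R) b ` P"
proof
  show "(*\<^sub>R) (a + b) ` P \<subseteq> (*\<^sub>R) a ` P + (*\<^sub>R) b ` P"
    by (auto simp: set_plus_def scaleR_add_left)
next
  show "(*\<^sub>R) a ` P + (*\<^sub>R) b ` P \<subseteq> (*\<^sub>R) (a + b) ` P"
  proof
    fix x assume "x \<in> (*\<^sub>R) a ` P + (*\<^sub>R) b ` P"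
    then obtain p q where x: "x = a *\<^sub>R p + b *\<^sub>R q" "p \<in> P" "q \<in> P"
      by (auto simp: set_plus_def)
    show "x \<in> (*\<^sub>R) (a + b) ` P"
    proof (cases "a + b = 0")
      case True
      then have "a = 0" "b = 0" using ab by auto
      then show ?thesis using x by auto
    next
      case False
      have "(a / (a + b)) *\<^sub>R p + (b / (a + b)) *\<^sub>R q \<in> P"
        using ab False x by (intro convexD[OF P]) (auto simp: add_divide_distrib[symmetric])
      moreover have "x = (a + b) *\<^sub>R ((a / (a + b)) *\<^sub>R p + (b / (a + b)) *\<^sub>R q)"
        using False by (simp add: scaleR_add_right x)
      ultimately show ?thesis by blast
    qed
  qed
qed

definition dilate_sum :: "('i \<Rightarrow> 'a::real_vector set) \<Rightarrow> 'i set \<Rightarrow> ('i \<Rightarrow> nat) \<Rightarrow> 'a set" where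
  "dilate_sum P I k = (\<Sum>j\<in>I. (*\<^sub>R) (real (k j)) ` P j)"

lemma dilate_sum_cong: "(\<And>j. j \<in> I \<Longrightarrow> k j = k' j) \<Longrightarrow> dilate_sum P I k = dilate_sum P I k'"
  by (simp add: dilate_sum_def)

text \<open>Nonemptiness ensures that a dilate by 0 is \<open>{0}\<close>, the neutral element, and
  not the empty set.\<close>

lemma dilate_sum_ind:
  assumes "finite I" "J \<subseteq> I" "\<And>j. j \<in> I \<Longrightarrow> P j \<noteq> {}"
  shows "dilate_sum P I (ind J) = (\<Sum>j\<in>J. P j)"
proof -
  have "dilate_sum P I (ind J) = (\<Sum>j\<in>J. (*\<^sub>R) (real (ind J j)) ` P j)"
    unfolding dilate_sum_def using assms
    by (intro sum.mono_neutral_right) (auto simp: ind_def image_constant_conv)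
  also have "\<dots> = (\<Sum>j\<in>J. P j)"
    by (intro sum.cong) (auto simp: ind_def)
  finally show ?thesis .
qed

lemma dilate_sum_upd:
  assumes "finite I" "i \<in> I" "convex (P i)"
  shows "dilate_sum P I (k(i := k i + c)) = dilate_sum P I k + (*\<^sub>R) (real c) ` P i"
proof -
  have "dilate_sum P I (k(i := k i + c)) = (*\<^sub>R) (real (k i) + real c) ` P i + dilate_sum P (I - {i}) k"
    unfolding dilate_sum_def using assms by (subst sum.remove[of I i]) auto
  also have "\<dots> = ((*\<^sub>R) (real (k i)) ` P i + dilate_sum P (I - {i}) k) + (*\<^sub>R) (real c) ` P i"
    using assms by (simp add: scaleR_set_add add_ac)
  also have "(*\<^sub>R) (real (k i)) ` P i + dilate_sum P (I - {i}) k = dilate_sum P I k"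
    unfolding dilate_sum_def
    using sum.remove[OF assms(1,2), of "\<lambda>j. (*\<^sub>R) (real (k j)) ` P j"] by simp
  finally show ?thesis .
qed

lemma polytope_dilate_sum: "(\<And>j. j \<in> I \<Longrightarrow> polytope (P j)) \<Longrightarrow> polytope (dilate_sum P I k)"
  unfolding dilate_sum_def by (intro polytope_set_sum polytope_scaling)

lemma norm_dilate_sum:
  fixes P :: "'i \<Rightarrow> 'a::real_normed_vector set"
  assumes "finite I" "x \<in> dilate_sum P I k" "\<And>j y. j \<in> I \<Longrightarrow> y \<in> P j \<Longrightarrow> norm y \<le> r"
  shows "norm x \<le> r * (\<Sum>j\<in>I. real (k j))"
proof -
  from assms(2) obtain s where s: "x = sum s I" "\<And>j. j \<in> I \<Longrightarrow> s j \<in> (*\<^sub>R) (real (k j)) ` P j"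
    unfolding dilate_sum_def set_sum_alt[OF assms(1)] by auto
  have "norm x \<le> (\<Sum>j\<in>I. norm (s j))" unfolding s(1) by (rule norm_sum)
  also have "\<dots> \<le> (\<Sum>j\<in>I. r * real (k j))"
  proof (intro sum_mono)
    fix j assume j: "j \<in> I"
    then obtain y where "y \<in> P j" "s j = real (k j) *\<^sub>R y" using s(2) by blast
    then show "norm (s j) \<le> r * real (k j)"
      using assms(3)[OF j] by (simp add: mult.commute[of r] mult_left_mono)
  qed
  finally show ?thesis by (simp add: sum_distrib_left)
qed

lemma lattice_polytope_hull:
  assumes "lattice_polytope L P"
  obtains V where "finite V" "V \<noteq> {}" "V \<subseteq> L" "P = convex hull V"
proof -
  let ?V = "{x. x extreme_point_of P}"
  have P: "polytope P" "P \<noteq> {}" "?V \<subseteq> L" using assms by (auto simp: lattice_polytope_def)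
  obtain W where W: "finite W" "P = convex hull W" using P by (auto simp: polytope_def)
  have "finite ?V"
    unfolding W(2) by (rule finite_subset[OF _ W(1)]) (auto dest: extreme_point_of_convex_hull)
  moreover have "P = convex hull ?V"
    using P by (intro Krein_Milman_Minkowski polytope_imp_compact polytope_imp_convex)
  moreover from this have "?V \<noteq> {}" using P(2) by force
  ultimately show ?thesis using that P(3) by blast
qed

lemma lattice_polytope_convex_hull:
  fixes V :: "(real ^ 'n) set"
  assumes "finite V" "V \<noteq> {}" "V \<subseteq> L"
  shows "lattice_polytope L (convex hull V)"
  using assms unfolding lattice_polytope_def
  by (auto intro: polytope_convex_hull dest: extreme_point_of_convex_hull)

section \<open>Counting polynomials and their dependence on \<open>Q\<close>\<close>

context full_lattice
begin

lemma finite_B: "finite B"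
  using indep by (rule independent_imp_finite)

lemma span_B: "span B = UNIV"
  using card_eq_dim[of B UNIV] indep finite_B card_B by auto

definition dilate_count :: "(real ^ 'n) set \<Rightarrow> (nat \<Rightarrow> (real ^ 'n) set) \<Rightarrow> nat set \<Rightarrow> (nat \<Rightarrow> nat) \<Rightarrow> real" where
  "dilate_count Q P I k = real_of_int (lattice_count L (Q + dilate_sum P I k))"

text \<open>The difference of order \<open>card V\<close> in direction \<open>i\<close> is
  \<open>lattice_count_dilates\<close>, with \<open>Q + dilate_sum P I k\<close> in the role of the
  convex set, and so it vanishes.\<close>

lemma dilate_count_polyfun:
  assumes I: "finite I" and P: "\<And>j. j \<in> I \<Longrightarrow> lattice_polytope L (P j)" and Q: "polytope Q"
  shows "polyfun I (dilate_count Q P I)"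
proof (rule polyfunI_pdiff[OF I])
  show "dilate_count Q P I k = dilate_count Q P I k'" if "\<And>i. i \<in> I \<Longrightarrow> k i = k' i" for k k'
    using dilate_sum_cong[of I k k' P] that by (simp add: dilate_count_def)
  fix i assume i: "i \<in> I"
  obtain V where V: "finite V" "V \<noteq> {}" "V \<subseteq> L" "P i = convex hull V"
    using lattice_polytope_hull[OF P[OF i]] by blast
  have "(pdiff i ^^ card V) (dilate_count Q P I) k = 0" for k
  proof -
    have poly: "polytope (Q + dilate_sum P I k)"
      using P Q by (intro polytope_set_plus polytope_dilate_sum) (auto simp: lattice_polytope_def)
    have "(pdiff i ^^ card V) (dilate_count Q P I) k =
      (\<Sum>S\<in>Pow V. (-1) ^ card S * dilate_count Q P I (k(i := k i + (card V - card S))))"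
      by (simp only: funpow_pdiff
        sum_Pow_eq_fdiff[OF V(1), of "\<lambda>t. dilate_count Q P I (k(i := t))" "k i"])
    also have "\<dots> = (\<Sum>S\<in>Pow V. (-1) ^ card S * real_of_int (lattice_count L
        ((Q + dilate_sum P I k) + (*\<^sub>R) (real (card V - card S)) ` (convex hull V))))"
      using I i V by (simp only: dilate_count_def dilate_sum_upd convex_convex_hull add.assoc)
    also have "\<dots> = real_of_int (\<Sum>S\<in>Pow V. (-1) ^ card S * lattice_count L
        ((Q + dilate_sum P I k) + (*\<^sub>R) (real (card V - card S)) ` (convex hull V)))"
      by simp
    also have "\<dots> = 0"
      using poly by (subst lattice_count_dilates[OF V(1-3)])
        (auto intro: polytope_imp_convex polytope_imp_bounded)
    finally show ?thesis .
  qed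
  then show "\<exists>m. (pdiff i ^^ m) (dilate_count Q P I) = (\<lambda>_. 0)" by blast
qed

lemma dilate_count_growth:
  assumes I: "finite I" and P: "\<And>j. j \<in> I \<Longrightarrow> polytope (P j)" and Q: "polytope Q"
  obtains C where "\<And>k. \<bar>dilate_count Q P I k\<bar> \<le> C * (1 + (\<Sum>i\<in>I. real (k i))) ^ CARD('n)"
proof -
  have "bounded (Q \<union> (\<Union>j\<in>I. P j))"
    using I P Q by (auto intro: polytope_imp_bounded)
  then obtain r where r: "r > 0" "\<And>x. x \<in> Q \<union> (\<Union>j\<in>I. P j) \<Longrightarrow> norm x \<le> r"
    unfolding bounded_pos by blast
  have "\<bar>dilate_count Q P I k\<bar> \<le> (2 * r + 1) ^ CARD('n) * (1 + (\<Sum>i\<in>I. real (k i))) ^ CARD('n)" for k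
  proof -
    define s where "s = 1 + (\<Sum>i\<in>I. real (k i))"
    have s: "1 \<le> s" by (simp add: s_def sum_nonneg)
    have "norm x \<le> r * s" if x_in: "x \<in> Q + dilate_sum P I k" for x
    proof -
      obtain q y where x: "x = q + y" "q \<in> Q" "y \<in> dilate_sum P I k"
        using x_in by (auto simp: set_plus_def)
      have "norm y \<le> r * (\<Sum>i\<in>I. real (k i))"
        using r by (intro norm_dilate_sum[OF I x(3)]) auto
      moreover have "norm q \<le> r" using r x by auto
      ultimately show ?thesis using norm_triangle_ineq[of q y] by (simp add: x s_def algebra_simps)
    qed
    then have "real (card ((Q + dilate_sum P I k) \<inter> L)) \<le> (2 * (r * s) + 1) ^ CARD('n)"
      using r s by (intro card_box_bound[THEN conjunct2]) auto
    also have "\<dots> \<le> ((2 * r + 1) * s) ^ CARD('n)"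
      using r s by (intro power_mono) (auto simp: algebra_simps)
    finally show ?thesis by (simp add: dilate_count_def lattice_count_def power_mult_distrib s_def)
  qed
  then show ?thesis using that by blast
qed

lemma L_scaleR_int: "v \<in> L \<Longrightarrow> real_of_int z *\<^sub>R v \<in> L"
proof (induction z rule: int_induct[of _ 0])
  case (step1 i)
  then show ?case by (auto simp: scaleR_add_left intro: L_add)
next
  case (step2 i)
  then show ?case by (auto simp: scaleR_diff_left intro: L_diff)
qed simp

lemma base_in_L: "b \<in> B \<Longrightarrow> b \<in> L"
  by (simp add: L_eq group_closure.base)

lemma sum_representation: "(\<Sum>b\<in>B. representation B x b *\<^sub>R b) = x"
  using real_vector.sum_representation_eq[OF indep _ finite_B order_refl, of x] span_B by simp

lemma bounded_subset_lattice_hull: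
  assumes "bounded A"
  obtains V where "finite V" "V \<noteq> {}" "V \<subseteq> L" "A \<subseteq> convex hull V"
proof -
  obtain r where r: "r > 0" "\<And>x. x \<in> A \<Longrightarrow> norm x \<le> r"
    using assms unfolding bounded_pos by blast
  have "\<exists>m>0. \<forall>x. \<bar>representation B x b\<bar> \<le> norm x * m" for b
    using bounded_linear.pos_bounded[OF bounded_linear_representation[OF indep span_B]] by auto
  then obtain m where m: "\<And>b. m b > 0" "\<And>b x. \<bar>representation B x b\<bar> \<le> norm x * m b" by metis
  \<comment> \<open>A point x is the mean of the \<open>CARD('n)\<close> points
    \<open>(CARD('n) * representation B x b) *\<^sub>R b\<close>, so \<open>M\<close> has to
    dominate these coefficients. The ceiling makes the vertices lattice points, and the summand 1
    keeps \<open>M\<close> positive.\<close>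
  define M where "M = \<lceil>real CARD('n) * (\<Sum>b\<in>B. r * m b) + 1\<rceil>"
  have M: "real CARD('n) * \<bar>representation B x b\<bar> \<le> of_int M" if "x \<in> A" "b \<in> B" for x b
  proof -
    have "\<bar>representation B x b\<bar> \<le> r * m b"
      using m(2)[of x b] mult_right_mono[OF r(2)[OF that(1)], of "m b"] m(1)[of b] by linarith
    also have "\<dots> \<le> (\<Sum>b\<in>B. r * m b)"
      using that finite_B r m(1) by (intro member_le_sum) (auto intro: less_imp_le)
    finally have "real CARD('n) * \<bar>representation B x b\<bar> \<le> real CARD('n) * (\<Sum>b\<in>B. r * m b)"
      by (intro mult_left_mono) auto
    then show ?thesis unfolding M_def by linarith
  qed
  have "0 \<le> real CARD('n) * (\<Sum>b\<in>B. r * m b)"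
    using r m(1) by (intro mult_nonneg_nonneg sum_nonneg) (auto intro: less_imp_le)
  then have M0: "of_int M > (0::real)" unfolding M_def by linarith
  define V where "V = (\<lambda>b. of_int M *\<^sub>R b) ` B \<union> (\<lambda>b. of_int (- M) *\<^sub>R b) ` B"
  have "B \<noteq> {}" using card_B by auto
  then have V: "finite V" "V \<noteq> {}" "V \<subseteq> L"
    using finite_B by (auto simp: V_def simp del: of_int_minus intro!: L_scaleR_int[OF base_in_L])
  have seg: "t *\<^sub>R b \<in> convex hull V" if "b \<in> B" "\<bar>t\<bar> \<le> of_int M" for t b
  proof -
    define u where "u = (t + of_int M) / (2 * of_int M)"
    have u: "0 \<le> u" "u \<le> 1" using that M0 by (auto simp: u_def abs_le_iff)
    have "(1 - u) *\<^sub>R (of_int (- M) *\<^sub>R b) + u *\<^sub>R (of_int M *\<^sub>R b) \<in> convex hull V"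
      using that u by (intro convexD hull_inc) (auto simp: V_def)
    moreover have "(1 - u) * of_int (- M) + u * of_int M = t"
      using M0 by (simp add: u_def field_simps)
    ultimately show ?thesis by (simp flip: scaleR_diff_left)
  qed
  have "x \<in> convex hull V" if "x \<in> A" for x
  proof -
    have "(\<Sum>b\<in>B. (1 / real CARD('n)) *\<^sub>R ((real CARD('n) * representation B x b) *\<^sub>R b)) \<in> convex hull V"
      using finite_B card_B M[OF that]
      by (intro convex_sum seg) (auto simp: abs_mult)
    then show ?thesis by (simp add: sum_representation)
  qed
  then show ?thesis using that V by blast
qed

text \<open>The effect of enlarging \<open>Q\<close> to \<open>Q'\<close> is dominated by that of adding a lattice polytope to \<open>Q\<close>, which
  changes the polynomial counting function only in degrees below \<open>n\<close>.\<close>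

lemma dilate_count_mixed_difference_eq:
  assumes I: "finite I" "card I = CARD('n)" and P: "\<And>j. j \<in> I \<Longrightarrow> lattice_polytope L (P j)"
    and Q: "polytope Q" "Q \<noteq> {}" "polytope Q'" "Q \<subseteq> Q'"
  shows "(\<Sum>J\<in>Pow I. (-1) ^ card J * dilate_count Q P I (ind J)) =
    (\<Sum>J\<in>Pow I. (-1) ^ card J * dilate_count Q' P I (ind J))"
proof -
  obtain q where q: "q \<in> Q" using Q by blast
  \<comment> \<open>Shifting by a point \<open>q\<close> of \<open>Q\<close> yields \<open>Q'
    \<subseteq> q + convex hull V \<subseteq> Q + convex hull V\<close>.\<close>
  have "bounded ((\<lambda>x. x - q) ` Q')"
    using bounded_translation[of Q' "- q"] polytope_imp_bounded[OF Q(3)] by simp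
  from bounded_subset_lattice_hull[OF this] obtain V where
    V: "finite V" "V \<noteq> {}" "V \<subseteq> L" "(\<lambda>x. x - q) ` Q' \<subseteq> convex hull V" by metis
  \<comment> \<open>The fresh variable \<open>z\<close> counts copies of
    \<open>convex hull V\<close>. The difference in \<open>z\<close> at multiplicity 0 compares
    \<open>Q + convex hull V\<close> with \<open>Q\<close>, and \<open>pdiff_growth\<close> bounds
    it with exponent \<open>CARD('n) - 1\<close>.\<close>
  obtain z where z: "z \<notin> I" using I(1) ex_new_if_finite infinite_UNIV_nat by blast
  define P' where "P' = P(z := convex hull V)"
  define G where "G = dilate_count Q P' (insert z I)"
  define H where "H k = dilate_count Q' P I k - dilate_count Q P I k" for k
  have P': "lattice_polytope L (P' j)" if "j \<in> insert z I" for j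
    using that P lattice_polytope_convex_hull[OF V(1-3)] by (auto simp: P'_def)
  then have P'p: "polytope (P' j)" if "j \<in> insert z I" for j
    using that by (auto simp: lattice_polytope_def)
  have Pp: "polytope (P j)" if "j \<in> I" for j using that P by (auto simp: lattice_polytope_def)
  obtain d where d: "CARD('n) = Suc d" using gr0_implies_Suc[OF zero_less_card_finite] by blast
  have "polyfun (insert z I) G"
    unfolding G_def by (rule dilate_count_polyfun) (use I P' Q in auto)
  moreover obtain C where C: "\<And>k. \<bar>G k\<bar> \<le> C * (1 + (\<Sum>i\<in>insert z I. real (k i))) ^ Suc d"
    using dilate_count_growth[of "insert z I" P' Q] I P'p Q unfolding G_def d by blast
  ultimately obtain D where D: "\<And>k. \<bar>pdiff z G k\<bar> \<le> D * (1 + (\<Sum>i\<in>insert z I. real (k i))) ^ d"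
    using pdiff_growth[of "insert z I" G C d z] I(1) by blast
  have sum_I: "dilate_sum P' (insert z I) k = (*\<^sub>R) (real (k z)) ` (convex hull V) + dilate_sum P I k" for k
  proof -
    have "(\<Sum>j\<in>I. (*\<^sub>R) (real (k j)) ` P' j) = (\<Sum>j\<in>I. (*\<^sub>R) (real (k j)) ` P j)"
      using z by (intro sum.cong) (auto simp: P'_def)
    then show ?thesis unfolding dilate_sum_def using I z by (simp add: P'_def)
  qed
  \<comment> \<open>\<open>H\<close> lies between 0 and this difference, hence has growth of degree
    \<open>d < CARD('n)\<close> and is annihilated by differences in all variables of
    \<open>I\<close>.\<close>
  have "\<bar>H k\<bar> \<le> D * (1 + (\<Sum>i\<in>I. real (k i))) ^ d" for k
  proof -
    define k0 where "k0 = k(z := 0)"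
    have "dilate_sum P I k0 = dilate_sum P I k" "dilate_sum P I (k0(z := Suc (k0 z))) = dilate_sum P I k"
      using z by (auto intro!: dilate_sum_cong simp: k0_def)
    then have G0: "G k0 = dilate_count Q P I k"
      and G1: "G (k0(z := Suc (k0 z))) = real_of_int (lattice_count L (Q + (convex hull V + dilate_sum P I k)))"
      using V(2) by (simp_all add: G_def dilate_count_def sum_I k0_def image_constant_conv flip: set_zero)
    have bdd: "bounded (A + dilate_sum P I k)" if "bounded A" for A
      using that Pp by (intro bounded_set_plus polytope_imp_bounded[OF polytope_dilate_sum])
    have "dilate_count Q P I k \<le> dilate_count Q' P I k"
      using Q unfolding dilate_count_def of_int_le_iff
      by (intro lattice_count_mono bdd polytope_imp_bounded set_plus_mono2) auto
    moreover have "Q' \<subseteq> Q + convex hull V"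
    proof
      fix x assume "x \<in> Q'"
      then have "x - q \<in> convex hull V" using V(4) by auto
      then have "q + (x - q) \<in> Q + convex hull V" using q by (intro set_plus_intro)
      then show "x \<in> Q + convex hull V" by simp
    qed
    then have "dilate_count Q' P I k \<le> G (k0(z := Suc (k0 z)))"
      unfolding G1 dilate_count_def of_int_le_iff add.assoc[symmetric]
      using V Q by (intro lattice_count_mono bdd bounded_set_plus polytope_imp_bounded polytope_convex_hull set_plus_mono2) auto
    ultimately have "\<bar>H k\<bar> \<le> \<bar>pdiff z G k0\<bar>"
      by (simp add: H_def pdiff_def G0)
    also have "\<dots> \<le> D * (1 + (\<Sum>i\<in>insert z I. real (k0 i))) ^ d" by (rule D)
    also have "(\<Sum>i\<in>insert z I. real (k0 i)) = (\<Sum>i\<in>I. real (k i))"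
      using I z by (auto simp: k0_def intro!: sum.cong)
    finally show ?thesis .
  qed
  moreover have "polyfun I H"
    unfolding H_def using I P Q by (intro polyfun_diff dilate_count_polyfun)
  ultimately have "(\<Sum>J\<in>Pow I. (-1) ^ card J * H (ind J)) = 0"
    using I d by (intro mixed_difference_eq_0[of I H D d]) auto
  then show ?thesis by (simp add: H_def right_diff_distrib sum_subtractf)
qed

text \<open>Differs from the mixed difference with signs \<open>(-1) ^ (CARD('n) - card J)\<close>
  by the factor \<open>(-1) ^ CARD('n)\<close>; this form avoids natural number subtraction in the
  exponent.\<close>

definition mixed_count :: "(nat \<Rightarrow> (real ^ 'n) set) \<Rightarrow> nat set \<Rightarrow> (real ^ 'n) set \<Rightarrow> int" where
  "mixed_count P I Q = (\<Sum>J\<in>Pow I. (-1) ^ card J * lattice_count L (Q + (\<Sum>j\<in>J. P j)))"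

theorem mixed_count_independent:
  assumes I: "finite I" "card I = CARD('n)" and P: "\<And>j. j \<in> I \<Longrightarrow> lattice_polytope L (P j)"
    and Q: "polytope Q" "Q \<noteq> {}" and Q': "polytope Q'" "Q' \<noteq> {}"
  shows "mixed_count P I Q = mixed_count P I Q'"
proof -
  obtain V V' where V: "finite V" "Q = convex hull V" "finite V'" "Q' = convex hull V'"
    using Q Q' by (auto simp: polytope_def)
  \<comment> \<open>A polytope containing both reduces the claim to the nested case.\<close>
  define R where "R = convex hull (V \<union> V')"
  have R: "polytope R" "Q \<subseteq> R" "Q' \<subseteq> R"
    using V by (auto simp: R_def intro!: polytope_convex_hull hull_mono simp del: Un_subset_iff)
  have eq: "(\<Sum>J\<in>Pow I. (-1) ^ card J * dilate_count A P I (ind J)) = real_of_int (mixed_count P I A)" for A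
    using I P by (auto simp: mixed_count_def dilate_count_def dilate_sum_ind lattice_polytope_def intro!: sum.cong)
  have "real_of_int (mixed_count P I Q) = real_of_int (mixed_count P I R)"
    "real_of_int (mixed_count P I Q') = real_of_int (mixed_count P I R)"
    using dilate_count_mixed_difference_eq[of I P Q R] dilate_count_mixed_difference_eq[of I P Q' R] I P Q Q' R
    unfolding eq by auto
  then show ?thesis by simp
qed

end

section \<open>Averaging over a fundamental domain\<close>

lemma emeasure_lebesgue_translation:
  "emeasure lebesgue ((+) a ` S) = emeasure lebesgue S" for S :: "'a::euclidean_space set"
  using emeasure_lebesgue_affine[of 1 a S] by (simp add: ac_simps cong: image_cong_simp)

lemma mem_translation_iff: "x \<in> (+) v ` F \<longleftrightarrow> x - v \<in> F" for v :: "'a::ab_group_add"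
  by (force simp: image_iff)

lemma mem_singleton_plus_iff: "x \<in> {v} + F \<longleftrightarrow> x - v \<in> F" for v :: "'a::ab_group_add"
  by (force simp: set_plus_def)

lemma fundamental_domain_sets:
  assumes "fundamental_domain L F" shows "(+) v ` F \<in> sets lebesgue"
  using assms by (intro lebesgue_sets_translation) (auto simp: fundamental_domain_def)

lemma fundamental_domain_disjoint:
  assumes "fundamental_domain L F"
  shows "disjoint_family_on (\<lambda>v. (+) v ` F) L"
  unfolding disjoint_family_on_def
proof (intro ballI impI)
  fix v w assume "v \<in> L" "w \<in> L" "v \<noteq> w"
  then show "(+) v ` F \<inter> (+) w ` F = {}"
    using assms unfolding fundamental_domain_def by (auto simp: mem_translation_iff disjoint_iff)
qed

lemma fundamental_domain_cover:
  assumes "fundamental_domain L F"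
  shows "(\<Union>v\<in>L. (+) v ` F) = UNIV"
  using assms unfolding fundamental_domain_def by (auto simp: mem_translation_iff) blast

text \<open>The left side omits the empty set, hence the hypothesis. It is met by volumes because
  the empty Minkowski sum is a single point.\<close>

lemma card_sum_Pow:
  fixes f :: "nat set \<Rightarrow> real"
  assumes "f {} = 0"
  shows "(\<Sum>k=1..n. \<Sum>I | I \<subseteq> {1..n} \<and> card I = k. f I) = (\<Sum>I\<in>Pow {1..n}. f I)"
proof -
  have "(\<Sum>k=1..n. \<Sum>I | I \<subseteq> {1..n} \<and> card I = k. f I) =
      (\<Sum>k=1..n. sum f {I \<in> Pow {1..n} - {{}}. card I = k})"
    by (intro sum.cong arg_cong2[of _ _ _ _ sum]) auto
  also have "\<dots> = sum f (Pow {1..n} - {{}})"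
  proof (rule sum.group)
    show "card ` (Pow {1..n} - {{}}) \<subseteq> {1..n}"
    proof
      fix k assume "k \<in> card ` (Pow {1..n} - {{}})"
      then obtain I where I: "I \<subseteq> {1..n}" "I \<noteq> {}" "k = card I" by blast
      then have "card I \<le> n" "finite I" using card_mono[of "{1..n}" I] by (auto intro: finite_subset)
      then show "k \<in> {1..n}" using I by (auto simp: Suc_le_eq card_gt_0_iff)
    qed
  qed auto
  also have "\<dots> = (\<Sum>I\<in>Pow {1..n}. f I)"
    using assms by (intro sum.mono_neutral_left) auto
  finally show ?thesis .
qed

lemma minus_one_power_diff: "k \<le> n \<Longrightarrow> (-1 :: 'a::ring_1) ^ (n - k) = (-1) ^ n * (-1) ^ k"
  by (simp add: minus_one_power_iff)

lemma mixed_volume_eq_sum_Pow: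
  fixes P :: "nat \<Rightarrow> (real ^ 'n) set"
  shows "mixed_volume L P = (\<Sum>I\<in>Pow {1..CARD('n)}. (-1) ^ (CARD('n) - card I) *
    measure lebesgue (\<Sum>i\<in>I. P i)) / covolume L"
proof -
  let ?I = "{1..CARD('n)}"
  have "mixed_volume L P = 1 / fact CARD('n) *
      (\<Sum>k = 1..CARD('n). \<Sum>I | I \<subseteq> ?I \<and> card I = k. (-1) ^ (CARD('n) - card I) * lattice_vol L (\<Sum>i\<in>I. P i))"
    unfolding mixed_volume_def sum_distrib_left by (intro arg_cong2[of _ _ _ _ "(*)"] sum.cong refl) auto
  also have "\<dots> = 1 / fact CARD('n) * (\<Sum>I\<in>Pow ?I. (-1) ^ (CARD('n) - card I) * lattice_vol L (\<Sum>i\<in>I. P i))"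
    by (subst card_sum_Pow) (simp_all add: lattice_vol_def)
  also have "\<dots> = 1 / fact CARD('n) * (\<Sum>I\<in>Pow ?I. (fact CARD('n) / covolume L) *
      ((-1) ^ (CARD('n) - card I) * measure lebesgue (\<Sum>i\<in>I. P i)))"
    by (rule arg_cong[of _ _ "(*) (1 / fact CARD('n))"], rule sum.cong[OF refl]) (simp add: lattice_vol_def)
  also have "\<dots> = (\<Sum>I\<in>Pow ?I. (-1) ^ (CARD('n) - card I) * measure lebesgue (\<Sum>i\<in>I. P i)) / covolume L"
    unfolding sum_distrib_left[symmetric] by simp
  finally show ?thesis .
qed

context full_lattice
begin

lemma countable_L: "countable L"
proof -
  have "\<exists>n::nat. x \<in> ball 0 (real n)" for x :: "real ^ 'n"
    using reals_Archimedean2[of "norm x"] by simp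
  then have "L = (\<Union>n::nat. ball 0 (real n) \<inter> L)" by blast
  moreover have "countable (\<Union>n::nat. ball 0 (real n) \<inter> L)"
    by (rule countable_UN) (auto intro: countable_finite finite_L)
  ultimately show ?thesis by simp
qed

lemma representation_diff_B: "representation B (x - y) b = representation B x b - representation B y b"
  using span_B by (simp add: real_vector.representation_diff[OF indep])

lemma L_coords: "x \<in> L \<longleftrightarrow> (\<forall>b\<in>B. representation B x b \<in> \<int>)"
proof
  assume "x \<in> L"
  then show "\<forall>b\<in>B. representation B x b \<in> \<int>"
    unfolding L_eq
  proof (induction rule: group_closure.induct)
    case (base s)
    then show ?case
      using indep by (auto simp: real_vector.representation_basis real_vector.representation_zero)
  qed (simp add: representation_diff_B)
next
  assume int: "\<forall>b\<in>B. representation B x b \<in> \<int>"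
  have "(\<Sum>b\<in>B. representation B x b *\<^sub>R b) \<in> L"
  proof (intro L_sum)
    fix b assume b: "b \<in> B"
    then obtain z where "representation B x b = of_int z" using int by (auto elim: Ints_cases)
    then show "representation B x b *\<^sub>R b \<in> L" using L_scaleR_int[OF base_in_L[OF b]] by simp
  qed
  then show "x \<in> L" by (simp add: sum_representation)
qed

lemma representation_sum_B:
  assumes "b \<in> B"
  shows "representation B (\<Sum>c\<in>B. f c *\<^sub>R c) b = f b"
proof -
  have "representation B (\<Sum>c\<in>B. f c *\<^sub>R c) b = (\<Sum>c\<in>B. f c * representation B c b)"
    using span_B by (simp add: real_vector.representation_sum[OF indep] real_vector.representation_scale[OF indep])
  also have "\<dots> = (\<Sum>c\<in>B. if c = b then f c else 0)"
    using indep by (intro sum.cong) (auto simp: real_vector.representation_basis)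
  finally show ?thesis using assms finite_B by simp
qed

definition half_open_cell :: "(real ^ 'n) set" where
  "half_open_cell = {x. \<forall>b\<in>B. 0 \<le> representation B x b \<and> representation B x b < 1}"

lemma fundamental_domain_cell: "fundamental_domain L half_open_cell"
  unfolding fundamental_domain_def
proof (intro conjI allI)
  have B: "B \<noteq> {}" using card_B by auto
  have cont: "continuous_on UNIV (\<lambda>x. representation B x b)" for b
    using bounded_linear_representation[OF indep span_B] by (intro linear_continuous_on)
  have eq: "half_open_cell = (\<Inter>b\<in>B. {x. 0 \<le> representation B x b} \<inter> {x. representation B x b < 1})"
    by (auto simp: half_open_cell_def)
  have "half_open_cell \<in> sets borel"
    unfolding eq using finite_B B
    by (intro sets.finite_INT sets.Int borel_closed borel_open closed_Collect_le open_Collect_less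
      cont continuous_on_const) auto
  then show "half_open_cell \<in> sets lebesgue" by simp
next
  fix x
  show "\<exists>!v. v \<in> L \<and> x - v \<in> half_open_cell"
  proof (rule ex1I)
    let ?v = "\<Sum>b\<in>B. of_int \<lfloor>representation B x b\<rfloor> *\<^sub>R b"
    show "?v \<in> L \<and> x - ?v \<in> half_open_cell"
      by (auto simp: L_coords half_open_cell_def representation_sum_B representation_diff_B) linarith
    fix v assume v: "v \<in> L \<and> x - v \<in> half_open_cell"
    have "representation B v b = of_int \<lfloor>representation B x b\<rfloor>" if b: "b \<in> B" for b
    proof -
      obtain z where z: "representation B v b = of_int z"
        using v b by (auto simp: L_coords elim: Ints_cases)
      have "0 \<le> representation B x b - of_int z" "representation B x b - of_int z < 1"
        using v b by (auto simp: half_open_cell_def representation_diff_B z)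
      then have "\<lfloor>representation B x b\<rfloor> = z" by linarith
      then show ?thesis by (simp add: z)
    qed
    then have "(\<Sum>b\<in>B. representation B v b *\<^sub>R b) = ?v" by (intro sum.cong) auto
    then show "v = ?v" by (simp add: sum_representation)
  qed
qed

lemma bounded_half_open_cell: "bounded half_open_cell"
  unfolding bounded_iff
proof (intro exI ballI)
  fix x assume x: "x \<in> half_open_cell"
  have "norm (\<Sum>b\<in>B. representation B x b *\<^sub>R b) \<le> (\<Sum>b\<in>B. norm b)"
    using x by (intro sum_norm_le) (auto simp: half_open_cell_def intro!: mult_left_le_one_le)
  then show "norm x \<le> (\<Sum>b\<in>B. norm b)" by (simp add: sum_representation)
qed

lemma emeasure_split_fundamental_domain:
  assumes "fundamental_domain L F" "A \<in> sets lebesgue"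
  shows "emeasure lebesgue A = (\<integral>\<^sup>+v. emeasure lebesgue (A \<inter> (+) v ` F) \<partial>count_space L)"
proof -
  have "A = (\<Union>v\<in>L. A \<inter> (+) v ` F)"
    by (simp only: Int_UN_distrib[symmetric] fundamental_domain_cover[OF assms(1)] Int_UNIV_right)
  then have "emeasure lebesgue A = emeasure lebesgue (\<Union>v\<in>L. A \<inter> (+) v ` F)" by (rule arg_cong)
  also have "\<dots> = (\<integral>\<^sup>+v. emeasure lebesgue (A \<inter> (+) v ` F) \<partial>count_space L)"
    using fundamental_domain_disjoint[OF assms(1)] countable_L
    by (intro emeasure_UN_countable sets.Int assms(2) fundamental_domain_sets[OF assms(1)])
      (fastforce simp: disjoint_family_on_def)+
  finally show ?thesis .
qed

text \<open>Each domain is cut by the translates of the other, and the pieces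
  \<open>F \<inter> (v + F')\<close> and \<open>F' \<inter> (- v + F)\<close> are translates of each
  other. Extended measures are compared because neither domain is assumed to have finite
  measure.\<close>

lemma emeasure_fundamental_domain_eq:
  assumes "fundamental_domain L F" "fundamental_domain L F'"
  shows "emeasure lebesgue F = emeasure lebesgue F'"
proof -
  have swap: "emeasure lebesgue (F \<inter> (+) v ` F') = emeasure lebesgue (F' \<inter> (+) (- v) ` F)" for v
  proof -
    have "F \<inter> (+) v ` F' = (+) v ` (F' \<inter> (+) (- v) ` F)"
      by (intro set_eqI) (auto simp only: mem_translation_iff Int_iff diff_minus_eq_add diff_add_cancel)
    then show ?thesis by (simp only: emeasure_lebesgue_translation)
  qed
  have "bij_betw uminus L L"
    by (rule bij_betw_byWitness[of _ uminus]) (auto simp: L_eq)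
  have "emeasure lebesgue F = (\<integral>\<^sup>+v. emeasure lebesgue (F' \<inter> (+) (- v) ` F) \<partial>count_space L)"
    using assms by (subst emeasure_split_fundamental_domain[OF assms(2)])
      (auto simp: swap fundamental_domain_def)
  also have "\<dots> = (\<integral>\<^sup>+v. emeasure lebesgue (F' \<inter> (+) v ` F) \<partial>count_space L)"
    by (rule nn_integral_bij_count_space) fact
  also have "\<dots> = emeasure lebesgue F'"
    using assms by (intro emeasure_split_fundamental_domain[symmetric]) (auto simp: fundamental_domain_def)
  finally show ?thesis .
qed

lemma lmeasurable_cell: "half_open_cell \<in> lmeasurable"
  using fundamental_domain_cell bounded_half_open_cell
  by (intro bounded_set_imp_lmeasurable) (auto simp: fundamental_domain_def)

lemma covolume_eq: "covolume L = measure lebesgue half_open_cell"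
proof -
  have "fundamental_domain L (SOME F. fundamental_domain L F)"
    using fundamental_domain_cell by (rule someI)
  from emeasure_fundamental_domain_eq[OF this fundamental_domain_cell]
  show ?thesis by (simp add: covolume_def measure_def)
qed

lemma covolume_pos: "covolume L > 0"
proof -
  have "emeasure lebesgue half_open_cell \<noteq> 0"
  proof
    assume "emeasure lebesgue half_open_cell = 0"
    then have "emeasure lebesgue ((+) v ` half_open_cell) = 0" for v
      by (simp add: emeasure_lebesgue_translation)
    then have "emeasure lebesgue (UNIV :: (real ^ 'n) set) = 0"
      using emeasure_split_fundamental_domain[OF fundamental_domain_cell, of UNIV] by simp
    moreover have "emeasure lebesgue (UNIV :: (real ^ 'n) set) = \<infinity>"
      using emeasure_lborel_UNIV by simp
    ultimately show False by simp
  qed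
  then show ?thesis
    using lmeasurable_cell by (simp add: covolume_eq emeasure_eq_measure2 zero_less_measure_iff)
qed

text \<open>The lattice translates of the cell tile \<open>A\<close>. The piece of \<open>A\<close>
  in the translate by v, moved back by v, is the set of x in the cell with
  \<open>x + v \<in> A\<close>, so integrating the count over the cell adds up the measures of all
  pieces. Only the finitely many v in \<open>X\<close> contribute.\<close>

lemma integral_translated_count:
  assumes A: "compact A"
  shows "has_bochner_integral lebesgue
    (\<lambda>x. indicator half_open_cell x * real_of_int (lattice_count L ({- x} + A))) (measure lebesgue A)"
proof -
  let ?F = half_open_cell
  define X where "X = {v \<in> L. \<exists>x\<in>?F. x + v \<in> A}"
  have "bounded (A + uminus ` ?F)"
    using A bounded_half_open_cell by (intro bounded_set_plus) (auto intro: compact_imp_bounded)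
  moreover have "X \<subseteq> (A + uminus ` ?F) \<inter> L"
  proof
    fix v assume "v \<in> X"
    then obtain x where x: "v \<in> L" "x \<in> ?F" "x + v \<in> A" by (auto simp: X_def)
    then have "(x + v) + (- x) \<in> A + uminus ` ?F" by (intro set_plus_intro) auto
    then show "v \<in> (A + uminus ` ?F) \<inter> L" using x by simp
  qed
  ultimately have X: "finite X" "X \<subseteq> L" using finite_subset[OF _ finite_L] by auto
  have A_meas: "A \<in> lmeasurable" using A by (rule lmeasurable_compact)
  have meas: "?F \<inter> (+) (- v) ` A \<in> lmeasurable" for v
    using A_meas lmeasurable_cell by (intro fmeasurable.Int measurable_translation)
  have count: "indicator ?F x * real_of_int (lattice_count L ({- x} + A)) =
      (\<Sum>v\<in>X. indicator (?F \<inter> (+) (- v) ` A) x)" for x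
  proof (cases "x \<in> ?F")
    case True
    have "v \<in> {- x} + A \<longleftrightarrow> x + v \<in> A" for v
      by (simp add: mem_singleton_plus_iff add.commute[of x v])
    then have "({- x} + A) \<inter> L = {v \<in> X. x + v \<in> A}"
      using True by (auto simp: X_def)
    moreover have "(\<Sum>v\<in>X. indicator (?F \<inter> (+) (- v) ` A) x) = (\<Sum>v\<in>X. of_bool (x + v \<in> A) :: real)"
      using True by (simp only: indicator_def Int_iff mem_translation_iff diff_minus_eq_add) simp
    ultimately show ?thesis
      using True X(1) by (simp add: lattice_count_def of_bool_def sum.If_cases Int_def)
  qed simp
  have "(\<Sum>v\<in>X. measure lebesgue (?F \<inter> (+) (- v) ` A)) = (\<Sum>v\<in>X. measure lebesgue (A \<inter> (+) v ` ?F))"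
  proof (intro sum.cong refl)
    fix v
    have "A \<inter> (+) v ` ?F = (+) v ` (?F \<inter> (+) (- v) ` A)"
      by (intro set_eqI) (auto simp only: mem_translation_iff Int_iff diff_minus_eq_add diff_add_cancel)
    then show "measure lebesgue (?F \<inter> (+) (- v) ` A) = measure lebesgue (A \<inter> (+) v ` ?F)"
      by (simp only: measure_translation)
  qed
  also have "\<dots> = measure lebesgue (\<Union>v\<in>X. A \<inter> (+) v ` ?F)"
    using fundamental_domain_disjoint[OF fundamental_domain_cell] X A_meas lmeasurable_cell
    by (intro measure_UNION'[symmetric] fmeasurable.Int measurable_translation)
      (auto simp: disjoint_family_on_def pairwise_def disjnt_def)
  also have "(\<Union>v\<in>X. A \<inter> (+) v ` ?F) = A"
  proof
    show "A \<subseteq> (\<Union>v\<in>X. A \<inter> (+) v ` ?F)"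
    proof
      fix a assume a: "a \<in> A"
      obtain v where v: "v \<in> L" "a \<in> (+) v ` ?F"
        using fundamental_domain_cover[OF fundamental_domain_cell] by blast
      then have "v \<in> X" using a by (auto simp: X_def add.commute)
      then show "a \<in> (\<Union>v\<in>X. A \<inter> (+) v ` ?F)" using a v by blast
    qed
  qed blast
  finally have sum_eq: "(\<Sum>v\<in>X. measure lebesgue (?F \<inter> (+) (- v) ` A)) = measure lebesgue A" .
  have "has_bochner_integral lebesgue (indicator (?F \<inter> (+) (- v) ` A)) (measure lebesgue (?F \<inter> (+) (- v) ` A))" for v
    using meas[of v] by (intro has_bochner_integral_real_indicator) (auto simp: fmeasurable_def)
  then have "has_bochner_integral lebesgue (\<lambda>x. \<Sum>v\<in>X. indicator (?F \<inter> (+) (- v) ` A) x)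
      (\<Sum>v\<in>X. measure lebesgue (?F \<inter> (+) (- v) ` A))"
    by (intro has_bochner_integral_sum)
  then show ?thesis by (simp only: count sum_eq)
qed

theorem mixed_volume_eq_mixed_count:
  assumes P: "\<And>j. j \<in> {1..CARD('n)} \<Longrightarrow> lattice_polytope L (P j)"
    and Q: "polytope Q" "Q \<noteq> {}"
  shows "mixed_volume L P = real_of_int ((-1) ^ CARD('n) * mixed_count P {1..CARD('n)} Q)"
proof -
  let ?I = "{1..CARD('n)}" and ?F = half_open_cell
  define c where "c = real_of_int (mixed_count P ?I Q)"
  \<comment> \<open>By independence the alternating sum of the counts is the constant
    \<open>c\<close> at every x, so its integral over the cell is \<open>covolume L * c\<close>;
    termwise, the integral is the alternating sum of volumes.\<close>
  have c: "real_of_int (mixed_count P ?I {- x}) = c" for x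
    unfolding c_def using mixed_count_independent[of ?I P "{- x}" Q] P Q by (simp add: polytope_sing)
  have "has_bochner_integral lebesgue
      (\<lambda>x. \<Sum>J\<in>Pow ?I. (-1) ^ card J * (indicator ?F x * real_of_int (lattice_count L ({- x} + (\<Sum>j\<in>J. P j)))))
      (\<Sum>J\<in>Pow ?I. (-1) ^ card J * measure lebesgue (\<Sum>j\<in>J. P j))"
  proof (intro has_bochner_integral_sum has_bochner_integral_mult_right)
    fix J assume "J \<in> Pow ?I"
    then have "polytope (\<Sum>j\<in>J. P j)" using P by (intro polytope_set_sum) (auto simp: lattice_polytope_def)
    then show "has_bochner_integral lebesgue
      (\<lambda>x. indicator ?F x * real_of_int (lattice_count L ({- x} + (\<Sum>j\<in>J. P j)))) (measure lebesgue (\<Sum>j\<in>J. P j))"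
      by (intro integral_translated_count polytope_imp_compact)
  qed
  also have "(\<lambda>x. \<Sum>J\<in>Pow ?I. (-1) ^ card J * (indicator ?F x * real_of_int (lattice_count L ({- x} + (\<Sum>j\<in>J. P j)))))
      = (\<lambda>x. indicator ?F x * c)"
  proof (rule ext)
    fix x
    show "(\<Sum>J\<in>Pow ?I. (-1) ^ card J * (indicator ?F x * real_of_int (lattice_count L ({- x} + (\<Sum>j\<in>J. P j)))))
      = indicator ?F x * c"
      unfolding c[of x, symmetric] mixed_count_def of_int_sum sum_distrib_left
      by (intro sum.cong refl) (simp only: of_int_mult of_int_power of_int_minus of_int_1 mult.left_commute)
  qed
  finally have 1: "has_bochner_integral lebesgue (\<lambda>x. indicator ?F x * c)
      (\<Sum>J\<in>Pow ?I. (-1) ^ card J * measure lebesgue (\<Sum>j\<in>J. P j))" .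
  have "has_bochner_integral lebesgue (\<lambda>x. indicator ?F x * c) (measure lebesgue ?F * c)"
    using lmeasurable_cell
    by (intro has_bochner_integral_mult_left has_bochner_integral_real_indicator) (auto simp: fmeasurable_def)
  from has_bochner_integral_eq[OF 1 this]
  have vol: "(\<Sum>J\<in>Pow ?I. (-1) ^ card J * measure lebesgue (\<Sum>j\<in>J. P j)) = covolume L * c"
    by (simp add: covolume_eq)
  have "mixed_volume L P = (\<Sum>I\<in>Pow ?I. (-1) ^ CARD('n) *
      ((-1) ^ card I * measure lebesgue (\<Sum>i\<in>I. P i))) / covolume L"
    unfolding mixed_volume_eq_sum_Pow
  proof (intro arg_cong[of _ _ "\<lambda>x. x / covolume L"] sum.cong refl)
    fix I assume "I \<in> Pow ?I"
    then have "card I \<le> CARD('n)" using card_mono[of ?I I] by simp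
    then show "(-1) ^ (CARD('n) - card I) * measure lebesgue (\<Sum>i\<in>I. P i) =
      (-1) ^ CARD('n) * ((-1) ^ card I * measure lebesgue (\<Sum>i\<in>I. P i))"
      by (simp add: minus_one_power_diff)
  qed
  also have "\<dots> = (-1) ^ CARD('n) * c"
    unfolding sum_distrib_left[symmetric] vol using covolume_pos by simp
  finally show ?thesis by (simp add: c_def)
qed

end

section \<open>Relative interiors\<close>

text \<open>Convexity confines \<open>I\<close> to one side of 0 unless \<open>0 \<in> I\<close>. If
  \<open>0 \<in> I\<close>, openness at 0 provides points on both sides, and all four terms are
  1.\<close>

lemma open_interval_split:
  fixes I :: "real set"
  assumes "convex I" "0 \<in> I \<Longrightarrow> \<exists>d>0. {-d<..<d} \<subseteq> I"
  shows "of_bool (0 \<in> I) + of_bool (\<exists>t\<in>I. -1 < t \<and> t < 1) =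
    (of_bool (\<exists>t\<in>I. 0 < t \<and> t < 1) + of_bool (\<exists>t\<in>I. -1 < t \<and> t < 0) :: int)"
proof -
  have 1: "0 \<in> I" if "s \<in> I" "t \<in> I" "s \<le> 0" "0 \<le> t" for s t
    using that assms(1) by (meson convex_contains_segment closed_segment_eq_real_ivl1 is_interval_convex_1 mem_is_interval_1_I)
  have 2: "(\<exists>t\<in>I. 0 < t \<and> t < 1) \<and> (\<exists>t\<in>I. -1 < t \<and> t < 0)" if I0: "0 \<in> I"
  proof -
    obtain d where d: "d > 0" "{-d<..<d} \<subseteq> I" using assms(2)[OF I0] by blast
    define e where "e = min d 1 / 2"
    have "0 < e" "e < 1" "e < d" using d(1) by (auto simp: e_def)
    then have "e \<in> I" "- e \<in> I" using d(2) by auto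
    with \<open>0 < e\<close> \<open>e < 1\<close> show ?thesis by force
  qed
  consider "0 \<in> I" | "0 \<notin> I" "\<exists>t\<in>I. 0 < t \<and> t < 1" | "0 \<notin> I" "\<not> (\<exists>t\<in>I. 0 < t \<and> t < 1)" by blast
  then show ?thesis
  proof cases
    case 1
    moreover have "\<exists>t\<in>I. -1 < t \<and> t < 1" using 1 by force
    ultimately show ?thesis using 2 by simp
  next
    case 2
    then have "\<not> (\<exists>t\<in>I. -1 < t \<and> t < 0)" using 1 less_imp_le by blast
    moreover have "\<exists>t\<in>I. -1 < t \<and> t < 1" using 2 by force
    ultimately show ?thesis using 2 by simp
  next
    case 3
    have "t < 0 \<longleftrightarrow> t < 1" if "t \<in> I" for t using 3 that by (cases t "0::real" rule: linorder_cases) auto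
    then have "(\<exists>t\<in>I. -1 < t \<and> t < 1) \<longleftrightarrow> (\<exists>t\<in>I. -1 < t \<and> t < 0)" by blast
    then show ?thesis using 3 by simp
  qed
qed

lemma rel_interior_plus_segment:
  fixes R :: "'a::euclidean_space set"
  assumes "convex R" "a < b" "e \<noteq> 0"
  shows "x \<in> rel_interior (R + closed_segment (a *\<^sub>R e) (b *\<^sub>R e)) \<longleftrightarrow>
    (\<exists>t. a < t \<and> t < b \<and> x - t *\<^sub>R e \<in> rel_interior R)"
proof -
  have ne: "a *\<^sub>R e \<noteq> b *\<^sub>R e" using assms by simp
  have os: "open_segment (a *\<^sub>R e) (b *\<^sub>R e) = {t *\<^sub>R e | t. a < t \<and> t < b}" (is "?l = ?r")
  proof (intro set_eqI iffI)
    fix y assume "y \<in> ?l"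
    then obtain u where u: "0 < u" "u < 1" "y = (1 - u) *\<^sub>R a *\<^sub>R e + u *\<^sub>R b *\<^sub>R e"
      by (auto simp: in_segment)
    have "y = (a + u * (b - a)) *\<^sub>R e" by (simp add: u algebra_simps)
    moreover have "u * (b - a) < b - a" using u assms by (simp add: mult_less_cancel_right1)
    then have "a + u * (b - a) < b" by simp
    moreover have "a < a + u * (b - a)" using u assms by simp
    ultimately show "y \<in> ?r" by blast
  next
    fix y assume "y \<in> ?r"
    then obtain t where t: "a < t" "t < b" "y = t *\<^sub>R e" by blast
    define u where "u = (t - a) / (b - a)"
    have "0 < u" "u < 1" using t assms by (auto simp: u_def)
    moreover have "u * (b - a) = t - a" using assms by (simp add: u_def)
    then have "(1 - u) * a + u * b = t" by (simp add: algebra_simps)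
    then have "y = (1 - u) *\<^sub>R a *\<^sub>R e + u *\<^sub>R b *\<^sub>R e" by (simp add: t flip: scaleR_add_left)
    ultimately show "y \<in> ?l" using ne by (auto simp: in_segment)
  qed
  have "rel_interior (R + closed_segment (a *\<^sub>R e) (b *\<^sub>R e)) = rel_interior R + {t *\<^sub>R e | t. a < t \<and> t < b}"
    using assms ne by (simp add: rel_interior_sum convex_closed_segment rel_interior_closed_segment os)
  moreover have "x \<in> rel_interior R + {t *\<^sub>R e | t. a < t \<and> t < b} \<longleftrightarrow>
      (\<exists>t. a < t \<and> t < b \<and> x - t *\<^sub>R e \<in> rel_interior R)"
  proof
    assume "x \<in> rel_interior R + {t *\<^sub>R e | t. a < t \<and> t < b}"
    then show "\<exists>t. a < t \<and> t < b \<and> x - t *\<^sub>R e \<in> rel_interior R"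
      by (auto simp: set_plus_def)
  next
    assume "\<exists>t. a < t \<and> t < b \<and> x - t *\<^sub>R e \<in> rel_interior R"
    then obtain t where t: "a < t" "t < b" "x - t *\<^sub>R e \<in> rel_interior R" by blast
    then have "(x - t *\<^sub>R e) + t *\<^sub>R e \<in> rel_interior R + {t *\<^sub>R e | t. a < t \<and> t < b}"
      by (intro set_plus_intro) auto
    then show "x \<in> rel_interior R + {t *\<^sub>R e | t. a < t \<and> t < b}" by simp
  qed
  ultimately show ?thesis by simp
qed

lemma aff_dim_plus_segment:
  fixes R :: "'a::euclidean_space set"
  assumes r: "r \<in> R" and ab: "a < b" "a \<le> 0" "0 \<le> b"
  shows "aff_dim (R + closed_segment (a *\<^sub>R e) (b *\<^sub>R e)) =
    (if e \<in> span ((\<lambda>x. - r + x) ` R) then aff_dim R else aff_dim R + 1)"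
proof -
  let ?S = "R + closed_segment (a *\<^sub>R e) (b *\<^sub>R e)"
  have seg: "t *\<^sub>R e \<in> closed_segment (a *\<^sub>R e) (b *\<^sub>R e)" if "a \<le> t" "t \<le> b" for t
  proof -
    define u where "u = (t - a) / (b - a)"
    have "0 \<le> u" "u \<le> 1" using that ab by (auto simp: u_def)
    moreover have "u * (b - a) = t - a" using ab by (simp add: u_def)
    then have "(1 - u) * a + u * b = t" by (simp add: algebra_simps)
    then have "t *\<^sub>R e = (1 - u) *\<^sub>R a *\<^sub>R e + u *\<^sub>R b *\<^sub>R e" by (simp flip: scaleR_add_left)
    ultimately show ?thesis by (auto simp: in_segment)
  qed
  have sub: "x + t *\<^sub>R e \<in> ?S" if "x \<in> R" "a \<le> t" "t \<le> b" for x t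
    using that seg by (intro set_plus_intro)
  have R_sub: "R \<subseteq> ?S" using sub[where t = 0] ab by auto
  have "span ((\<lambda>x. - r + x) ` ?S) = span (insert e ((\<lambda>x. - r + x) ` R))"
  proof (rule span_eq[THEN iffD2], intro conjI subsetI)
    fix y assume "y \<in> (\<lambda>x. - r + x) ` ?S"
    then obtain x u where x: "x \<in> R" "y = - r + (x + ((1 - u) *\<^sub>R a *\<^sub>R e + u *\<^sub>R b *\<^sub>R e))"
      by (auto simp: set_plus_def in_segment)
    have "y = (- r + x) + ((1 - u) * a + u * b) *\<^sub>R e" by (simp add: x scaleR_add_left)
    also have "\<dots> \<in> span (insert e ((\<lambda>x. - r + x) ` R))"
      using x by (intro span_add span_scale span_base) auto
    finally show "y \<in> span (insert e ((\<lambda>x. - r + x) ` R))" .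
  next
    fix y assume "y \<in> insert e ((\<lambda>x. - r + x) ` R)"
    then show "y \<in> span ((\<lambda>x. - r + x) ` ?S)"
    proof
      assume y: "y = e"
      obtain t where t: "a \<le> t" "t \<le> b" "t \<noteq> 0" using ab by (metis dual_order.refl less_le)
      have "- r + (r + t *\<^sub>R e) \<in> (\<lambda>x. - r + x) ` ?S" using sub[OF r t(1,2)] by blast
      then have "t *\<^sub>R e \<in> span ((\<lambda>x. - r + x) ` ?S)" by (intro span_base) simp
      then have "(1 / t) *\<^sub>R t *\<^sub>R e \<in> span ((\<lambda>x. - r + x) ` ?S)" by (rule span_scale)
      then show ?thesis using t y by simp
    next
      assume "y \<in> (\<lambda>x. - r + x) ` R"
      then show ?thesis using R_sub by (intro span_base) auto
    qed
  qed
  then have "dim ((\<lambda>x. - r + x) ` ?S) = dim (insert e ((\<lambda>x. - r + x) ` R))"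
    by (metis dim_span)
  moreover have "aff_dim ?S = int (dim ((\<lambda>x. - r + x) ` ?S))" "aff_dim R = int (dim ((\<lambda>x. - r + x) ` R))"
    using r R_sub by (intro aff_dim_eq_dim hull_inc; blast)+
  ultimately show ?thesis by (simp add: dim_insert)
qed

lemma rel_interior_line_open:
  fixes R :: "'a::euclidean_space set"
  assumes r: "r \<in> R" and e: "e \<in> span ((\<lambda>x. - r + x) ` R)" and x: "x \<in> rel_interior R"
  shows "\<exists>d>0. \<forall>t. \<bar>t\<bar> < d \<longrightarrow> x - t *\<^sub>R e \<in> rel_interior R"
proof -
  have hull: "affine hull R = (\<lambda>x. r + x) ` span ((\<lambda>x. - r + x) ` R)"
    using r by (intro affine_hull_span_gen hull_inc)
  obtain d where d: "d > 0" "ball x d \<inter> affine hull R \<subseteq> rel_interior R"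
    using openin_rel_interior[of R] x unfolding openin_contains_ball by blast
  have "x \<in> affine hull R"
    using x rel_interior_subset hull_subset[of R affine] by blast
  then obtain w where w: "w \<in> span ((\<lambda>x. - r + x) ` R)" "x = r + w" unfolding hull by blast
  have aff: "x - t *\<^sub>R e \<in> affine hull R" for t
  proof -
    have "w - t *\<^sub>R e \<in> span ((\<lambda>x. - r + x) ` R)" using w e by (intro span_diff span_scale)
    then have "r + (w - t *\<^sub>R e) \<in> affine hull R" unfolding hull by blast
    then show ?thesis by (simp add: w add_diff_eq)
  qed
  have "x - t *\<^sub>R e \<in> rel_interior R" if "\<bar>t\<bar> < d / (norm e + 1)" for t
  proof -
    have "\<bar>t\<bar> * norm e \<le> \<bar>t\<bar> * (norm e + 1)" by (intro mult_left_mono) auto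
    also have "\<dots> < d" using that by (simp add: pos_less_divide_eq add_nonneg_pos)
    finally have "x - t *\<^sub>R e \<in> ball x d" by (simp add: dist_norm)
    then show ?thesis using d(2) aff by blast
  qed
  moreover have "d / (norm e + 1) > 0" using d(1) by (simp add: add_nonneg_pos)
  ultimately show ?thesis by blast
qed

section \<open>The interior count as a valuation, and the formula for interiors\<close>

context full_lattice
begin

lemma signed_interior_count_eq_sum:
  assumes "finite X" "rel_interior A \<inter> L \<subseteq> X" "X \<subseteq> L"
  shows "signed_interior_count L A = (\<Sum>x\<in>X. (-1) ^ nat (aff_dim A) * of_bool (x \<in> rel_interior A))"
  unfolding signed_interior_count_def lattice_count_eq_sum[OF assms] by (rule sum_distrib_left)

text \<open>The signed interior count is a valuation; here \<open>R + [-e, e]\<close> is cut along \<open>R\<close>.\<close>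

lemma signed_interior_count_cut:
  assumes R: "convex R" "bounded R" "R \<noteq> {}" and e: "e \<noteq> 0"
  defines "S \<equiv> \<lambda>a b. R + closed_segment (a *\<^sub>R e) (b *\<^sub>R e)"
  shows "signed_interior_count L R + signed_interior_count L (S (-1) 1) =
    signed_interior_count L (S 0 1) + signed_interior_count L (S (-1) 0)"
proof -
  obtain r where r: "r \<in> R" using R by blast
  let ?in = "e \<in> span ((\<lambda>x. - r + x) ` R)"
  define X where "X = S (-1) 1 \<inter> L"
  define s where "s A = (-1 :: int) ^ nat (aff_dim A)" for A :: "(real ^ 'n) set"
  have X: "finite X" "X \<subseteq> L"
    using R by (auto simp: X_def S_def intro!: finite_L bounded_set_plus bounded_closed_segment)
  have ri: "x \<in> rel_interior (S a b) \<longleftrightarrow> (\<exists>t. a < t \<and> t < b \<and> x - t *\<^sub>R e \<in> rel_interior R)" if "a < b" for a b x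
    unfolding S_def using rel_interior_plus_segment[OF R(1) that e] .
  have seg_mem: "t *\<^sub>R e \<in> closed_segment ((-1) *\<^sub>R e) (1 *\<^sub>R e)" if "-1 \<le> t" "t \<le> 1" for t
  proof -
    have "t *\<^sub>R e = (1 - (t + 1) / 2) *\<^sub>R ((-1) *\<^sub>R e) + ((t + 1) / 2) *\<^sub>R (1 *\<^sub>R e)"
      by (simp flip: scaleR_diff_left)
    moreover have "0 \<le> (t + 1) / 2" "(t + 1) / 2 \<le> 1" using that by auto
    ultimately show ?thesis unfolding in_segment by blast
  qed
  have in_S: "x \<in> S (-1) 1" if "x - t *\<^sub>R e \<in> rel_interior R" "-1 \<le> t" "t \<le> 1" for x t
  proof -
    have "(x - t *\<^sub>R e) + t *\<^sub>R e \<in> S (-1) 1"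
      unfolding S_def using that rel_interior_subset seg_mem by (intro set_plus_intro) blast+
    then show ?thesis by simp
  qed
  have sub: "rel_interior R \<inter> L \<subseteq> X" "rel_interior (S (-1) 1) \<inter> L \<subseteq> X"
    "rel_interior (S 0 1) \<inter> L \<subseteq> X" "rel_interior (S (-1) 0) \<inter> L \<subseteq> X"
    using in_S[where t = 0] in_S by (auto simp: X_def ri intro: less_imp_le)
  have dim: "s (S a b) = (if ?in then s R else - s R)" if "a < b" "a \<le> 0" "0 \<le> b" for a b
  proof -
    have "aff_dim R \<ge> 0" using aff_dim_eq_dim[OF hull_inc[OF r]] by simp
    then show ?thesis
      using aff_dim_plus_segment[OF r that, of e] by (simp add: s_def S_def nat_add_distrib)
  qed
  have "s R * of_bool (x \<in> rel_interior R) + s (S (-1) 1) * of_bool (x \<in> rel_interior (S (-1) 1)) =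
    s (S 0 1) * of_bool (x \<in> rel_interior (S 0 1)) + s (S (-1) 0) * of_bool (x \<in> rel_interior (S (-1) 0))" for x
  proof -
    define I where "I = {t. x - t *\<^sub>R e \<in> rel_interior R}"
    have mem: "x \<in> rel_interior R \<longleftrightarrow> 0 \<in> I" "x \<in> rel_interior (S (-1) 1) \<longleftrightarrow> (\<exists>t\<in>I. -1 < t \<and> t < 1)"
      "x \<in> rel_interior (S 0 1) \<longleftrightarrow> (\<exists>t\<in>I. 0 < t \<and> t < 1)"
      "x \<in> rel_interior (S (-1) 0) \<longleftrightarrow> (\<exists>t\<in>I. -1 < t \<and> t < 0)"
      by (auto simp: ri I_def)
    \<comment> \<open>If \<open>e\<close> is parallel to the affine hull of \<open>R\<close>, all
      four sets have the same dimension and the claim is \<open>open_interval_split\<close>.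
      Otherwise the three thickened sets gain a dimension, so their sign is opposite to that of
      \<open>R\<close>; at most one t is admissible for x, and it is negative, zero or
      positive.\<close>
    show ?thesis
    proof (cases ?in)
      case True
      have "convex I"
      proof (rule convexI)
        fix t t' u v :: real assume *: "t \<in> I" "t' \<in> I" "0 \<le> u" "0 \<le> v" "u + v = 1"
        then have "u *\<^sub>R (x - t *\<^sub>R e) + v *\<^sub>R (x - t' *\<^sub>R e) \<in> rel_interior R"
          by (intro convexD[OF convex_rel_interior[OF R(1)]]) (auto simp: I_def)
        moreover have "u *\<^sub>R (x - t *\<^sub>R e) + v *\<^sub>R (x - t' *\<^sub>R e) = (u + v) *\<^sub>R x - (u * t + v * t') *\<^sub>R e"
          by (simp add: algebra_simps)
        ultimately show "u *\<^sub>R t + v *\<^sub>R t' \<in> I" using *(5) by (simp add: I_def)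
      qed
      moreover have "\<exists>d>0. {-d<..<d} \<subseteq> I" if "0 \<in> I"
        using rel_interior_line_open[OF r True, of x] that by (fastforce simp: I_def abs_less_iff)
      ultimately have "of_bool (0 \<in> I) + of_bool (\<exists>t\<in>I. -1 < t \<and> t < 1) =
        (of_bool (\<exists>t\<in>I. 0 < t \<and> t < 1) + of_bool (\<exists>t\<in>I. -1 < t \<and> t < 0) :: int)"
        by (rule open_interval_split)
      then show ?thesis using True unfolding mem by (simp add: dim flip: distrib_left)
    next
      case False
      have uniq: "t = t'" if "t \<in> I" "t' \<in> I" for t t'
      proof (rule ccontr)
        assume "t \<noteq> t'"
        have "x - t *\<^sub>R e \<in> R" "x - t' *\<^sub>R e \<in> R"
          using that rel_interior_subset[of R] by (auto simp: I_def)
        then have "(- r + (x - t *\<^sub>R e)) - (- r + (x - t' *\<^sub>R e)) \<in> span ((\<lambda>x. - r + x) ` R)"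
          by (intro span_diff span_base imageI)
        then have "(t' - t) *\<^sub>R e \<in> span ((\<lambda>x. - r + x) ` R)" by (simp add: algebra_simps)
        then have "(1 / (t' - t)) *\<^sub>R (t' - t) *\<^sub>R e \<in> span ((\<lambda>x. - r + x) ` R)" by (rule span_scale)
        then show False using False \<open>t \<noteq> t'\<close> by simp
      qed
      have "of_bool (\<exists>t\<in>I. -1 < t \<and> t < 1) = (of_bool (0 \<in> I) + of_bool (\<exists>t\<in>I. 0 < t \<and> t < 1)
          + of_bool (\<exists>t\<in>I. -1 < t \<and> t < 0) :: int)"
      proof (cases "\<exists>t\<in>I. -1 < t \<and> t < 1")
        case True
        then obtain t where t: "t \<in> I" "-1 < t" "t < 1" by blast
        then have "I = {t}" using uniq by blast
        then show ?thesis using t by (cases "t = 0"; cases "0 < t") auto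
      qed force
      then show ?thesis using False unfolding mem by (simp add: dim algebra_simps)
    qed
  qed
  then show ?thesis
    unfolding signed_interior_count_eq_sum[OF X(1) sub(1) X(2)] signed_interior_count_eq_sum[OF X(1) sub(2) X(2)]
      signed_interior_count_eq_sum[OF X(1) sub(3) X(2)] signed_interior_count_eq_sum[OF X(1) sub(4) X(2)]
      s_def[symmetric] sum.distrib[symmetric] by (intro sum.cong refl)
qed

definition mixed_interior_count :: "(nat \<Rightarrow> (real ^ 'n) set) \<Rightarrow> nat set \<Rightarrow> (real ^ 'n) set \<Rightarrow> int" where
  "mixed_interior_count P I Q = (\<Sum>J\<in>Pow I. (-1) ^ card J * signed_interior_count L (Q + (\<Sum>j\<in>J. P j)))"

lemma mixed_interior_count_cut:
  assumes P: "\<And>j. j \<in> I \<Longrightarrow> polytope (P j) \<and> P j \<noteq> {}" and Q: "polytope Q" "Q \<noteq> {}" and e: "e \<noteq> 0"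
  defines "S \<equiv> \<lambda>a b. Q + closed_segment (a *\<^sub>R e) (b *\<^sub>R e)"
  shows "mixed_interior_count P I Q + mixed_interior_count P I (S (-1) 1) =
    mixed_interior_count P I (S 0 1) + mixed_interior_count P I (S (-1) 0)"
proof -
  have "signed_interior_count L (Q + sum P J) + signed_interior_count L (S (-1) 1 + sum P J) =
      signed_interior_count L (S 0 1 + sum P J) + signed_interior_count L (S (-1) 0 + sum P J)" if "J \<in> Pow I" for J
  proof -
    have "polytope (Q + sum P J)" using that P Q by (intro polytope_set_plus polytope_set_sum) auto
    moreover have "Q + sum P J \<noteq> {}" using that P Q by (intro set_plus_nonempty set_sum_nonempty) auto
    moreover have "S a b + sum P J = (Q + sum P J) + closed_segment (a *\<^sub>R e) (b *\<^sub>R e)" for a b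
      by (simp add: S_def add_ac)
    ultimately show ?thesis
      using signed_interior_count_cut[of "Q + sum P J" e] e by (simp add: polytope_imp_convex polytope_imp_bounded)
  qed
  then show ?thesis
    unfolding mixed_interior_count_def sum.distrib[symmetric] distrib_left[symmetric] by (intro sum.cong) auto
qed

text \<open>For full-dimensional \<open>Q\<close> the interior of \<open>Q + sum P J\<close> is
  \<open>interior Q + sum P J\<close>. Each of its finitely many lattice points thus uses some point
  of \<open>interior Q\<close>; the hull \<open>Q'\<close> of the chosen points, over all
  \<open>J\<close>, stays in \<open>interior Q\<close> and yields the same lattice points. All sums
  have full dimension, so the sign is constant.\<close>

lemma mixed_interior_count_full_dim:
  assumes I: "finite I" "card I = CARD('n)" and P: "\<And>j. j \<in> I \<Longrightarrow> lattice_polytope L (P j)"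
    and Q: "polytope Q" "aff_dim Q = int CARD('n)"
  shows "mixed_interior_count P I Q = (-1) ^ CARD('n) * mixed_count P I Q"
proof -
  have Q_ne: "Q \<noteq> {}" using Q(2) by auto
  have A: "polytope (sum P J)" "sum P J \<noteq> {}" if "J \<in> Pow I" for J
  proof -
    show "polytope (sum P J)" using that P by (intro polytope_set_sum) (auto simp: lattice_polytope_def)
    show "sum P J \<noteq> {}" using that P by (intro set_sum_nonempty) (auto simp: lattice_polytope_def)
  qed
  have convQ: "convex Q" using Q(1) by (rule polytope_imp_convex)
  have hullQ: "affine hull Q = UNIV" using Q(2) aff_dim_eq_full[of Q] by simp
  have dim: "aff_dim (Q + sum P J) = int CARD('n)" if J: "J \<in> Pow I" for J
  proof -
    obtain a where a: "a \<in> sum P J" using A(2)[OF J] by blast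
    have "(+) a ` Q \<subseteq> Q + sum P J" using a by (auto simp: set_plus_def add.commute)
    then have "aff_dim Q \<le> aff_dim (Q + sum P J)" using aff_dim_subset by (metis aff_dim_translation_eq)
    moreover have "aff_dim (Q + sum P J) \<le> int CARD('n)" using aff_dim_le_DIM[of "Q + sum P J"] by simp
    ultimately show ?thesis using Q(2) by simp
  qed
  have ri: "rel_interior (Q + sum P J) = interior Q + sum P J" if J: "J \<in> Pow I" for J
  proof
    have convA: "convex (sum P J)" using A(1)[OF J] by (rule polytope_imp_convex)
    have "rel_interior (Q + sum P J) = interior Q + rel_interior (sum P J)"
      using convQ convA hullQ by (simp add: rel_interior_sum rel_interior_interior)
    also have "\<dots> \<subseteq> interior Q + sum P J"
      using rel_interior_subset by (intro set_plus_mono2) auto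
    finally show "rel_interior (Q + sum P J) \<subseteq> interior Q + sum P J" .
    have "open (interior Q + sum P J)"
    proof -
      have "interior Q + sum P J = (\<Union>a\<in>sum P J. (+) a ` interior Q)"
        by (subst add.commute) (auto simp: set_plus_def)
      then show ?thesis by (auto intro: open_translation)
    qed
    then have "interior Q + sum P J \<subseteq> interior (Q + sum P J)"
      using interior_subset by (intro interior_maximal set_plus_mono2) auto
    also have "\<dots> \<subseteq> rel_interior (Q + sum P J)" by (rule interior_subset_rel_interior)
    finally show "interior Q + sum P J \<subseteq> rel_interior (Q + sum P J)" .
  qed
  have "interior Q \<noteq> {}"
    using rel_interior_eq_empty[OF convQ] rel_interior_interior[OF hullQ] Q_ne by simp
  then obtain q where q: "q \<in> interior Q" by blast
  have "\<exists>y\<in>interior Q. x \<in> {y} + sum P J" if "J \<in> Pow I" "x \<in> rel_interior (Q + sum P J)" for J x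
    using that ri by (auto simp: set_plus_def)
  then obtain y where y: "\<And>J x. J \<in> Pow I \<Longrightarrow> x \<in> rel_interior (Q + sum P J) \<Longrightarrow>
      y J x \<in> interior Q \<and> x \<in> {y J x} + sum P J" by metis
  \<comment> \<open>The point \<open>q\<close> keeps \<open>Q'\<close> nonempty when none of the
    interiors contains a lattice point.\<close>
  define Y where "Y = insert q (\<Union>J\<in>Pow I. y J ` (rel_interior (Q + sum P J) \<inter> L))"
  define Q' where "Q' = convex hull Y"
  have "bounded (rel_interior (Q + sum P J))" if "J \<in> Pow I" for J
    using polytope_imp_bounded[OF polytope_set_plus[OF Q(1) A(1)[OF that]]] rel_interior_subset bounded_subset by blast
  then have "finite Y" using I(1) by (auto simp: Y_def intro!: finite_L)
  then have Q': "polytope Q'" "Q' \<noteq> {}" by (auto simp: Q'_def Y_def polytope_convex_hull)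
  have "Y \<subseteq> interior Q" using q y by (auto simp: Y_def)
  then have Q'_sub: "Q' \<subseteq> interior Q"
    unfolding Q'_def by (intro hull_minimal convex_interior convQ)
  have "signed_interior_count L (Q + sum P J) = (-1) ^ CARD('n) * lattice_count L (Q' + sum P J)" if J: "J \<in> Pow I" for J
  proof -
    have "rel_interior (Q + sum P J) \<inter> L = (Q' + sum P J) \<inter> L"
    proof
      have "Q' + sum P J \<subseteq> rel_interior (Q + sum P J)"
        unfolding ri[OF J] by (intro set_plus_mono2 Q'_sub order_refl)
      then show "(Q' + sum P J) \<inter> L \<subseteq> rel_interior (Q + sum P J) \<inter> L" by blast
      show "rel_interior (Q + sum P J) \<inter> L \<subseteq> (Q' + sum P J) \<inter> L"
      proof
        fix x assume x: "x \<in> rel_interior (Q + sum P J) \<inter> L"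
        then have "y J x \<in> Y" using J by (auto simp: Y_def)
        then have "{y J x} \<subseteq> Q'" by (simp add: Q'_def hull_inc)
        then have "{y J x} + sum P J \<subseteq> Q' + sum P J" by (intro set_plus_mono2) auto
        then show "x \<in> (Q' + sum P J) \<inter> L" using y[OF J, of x] x by blast
      qed
    qed
    then show ?thesis by (simp add: signed_interior_count_def lattice_count_def dim[OF J])
  qed
  then have "mixed_interior_count P I Q = (-1) ^ CARD('n) * mixed_count P I Q'"
    unfolding mixed_interior_count_def mixed_count_def sum_distrib_left
    by (intro sum.cong) (auto simp: mult_ac)
  also have "mixed_count P I Q' = mixed_count P I Q"
    by (rule mixed_count_independent[OF I P Q' Q(1) Q_ne])
  finally show ?thesis .
qed

text \<open>Induction on the codimension of \<open>Q\<close>. The separate polytope \<open>R\<close>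
  keeps the right-hand side fixed while \<open>Q\<close> is thickened.\<close>

theorem mixed_interior_count_eq:
  assumes I: "finite I" "card I = CARD('n)" and P: "\<And>j. j \<in> I \<Longrightarrow> lattice_polytope L (P j)"
    and Q: "polytope Q" "Q \<noteq> {}" and R: "polytope R" "R \<noteq> {}"
  shows "mixed_interior_count P I Q = (-1) ^ CARD('n) * mixed_count P I R"
  using Q
proof (induction "nat (int CARD('n) - aff_dim Q)" arbitrary: Q rule: less_induct)
  case less
  have indep_eq: "mixed_count P I Q = mixed_count P I R"
    by (rule mixed_count_independent[OF I P less.prems R])
  show ?case
  proof (cases "aff_dim Q = int CARD('n)")
    case True
    then show ?thesis using mixed_interior_count_full_dim[OF I P less.prems(1)] indep_eq by simp
  next
    case False
    then have lt: "aff_dim Q < int CARD('n)" using aff_dim_le_DIM[of Q] by simp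
    obtain q where q: "q \<in> Q" using less.prems by blast
    have "span ((\<lambda>x. - q + x) ` Q) \<noteq> UNIV"
    proof
      assume "span ((\<lambda>x. - q + x) ` Q) = UNIV"
      then have "dim ((\<lambda>x. - q + x) ` Q) = CARD('n)" by (metis dim_span dim_UNIV DIM_cart DIM_real mult.right_neutral)
      then show False using lt aff_dim_eq_dim[of q Q] q by (simp add: hull_inc)
    qed
    then obtain e where e: "e \<notin> span ((\<lambda>x. - q + x) ` Q)" by blast
    then have e0: "e \<noteq> 0" using span_zero by blast
    \<comment> \<open>As \<open>e\<close> is not parallel to \<open>Q\<close>, all three thickened
      polytopes have larger dimension and share one value. The cutting identity then leaves this
      same value for \<open>Q\<close>.\<close>
    have IH: "mixed_interior_count P I (Q + closed_segment (a *\<^sub>R e) (b *\<^sub>R e)) = (-1) ^ CARD('n) * mixed_count P I R"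
      if ab: "a < b" "a \<le> 0" "0 \<le> b" for a b
    proof (rule less.hyps)
      show "nat (int CARD('n) - aff_dim (Q + closed_segment (a *\<^sub>R e) (b *\<^sub>R e))) < nat (int CARD('n) - aff_dim Q)"
        using aff_dim_plus_segment[OF q ab, of e] e lt by simp
      show "polytope (Q + closed_segment (a *\<^sub>R e) (b *\<^sub>R e))"
        using less.prems by (intro polytope_set_plus) (auto simp: segment_convex_hull polytope_convex_hull)
      show "Q + closed_segment (a *\<^sub>R e) (b *\<^sub>R e) \<noteq> {}"
        using less.prems by (intro set_plus_nonempty) auto
    qed
    have "mixed_interior_count P I Q + mixed_interior_count P I (Q + closed_segment ((-1) *\<^sub>R e) (1 *\<^sub>R e)) =
      mixed_interior_count P I (Q + closed_segment (0 *\<^sub>R e) (1 *\<^sub>R e)) +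
      mixed_interior_count P I (Q + closed_segment ((-1) *\<^sub>R e) (0 *\<^sub>R e))"
      using P less.prems e0 by (intro mixed_interior_count_cut) (auto simp: lattice_polytope_def)
    then show ?thesis by (simp only: IH)
  qed
qed

end

section \<open>Mixed discriminants\<close>

lemma PiE_UNIV_eq: "PiE UNIV (\<lambda>_. S) = {f. \<forall>i. f i \<in> S}"
  by (auto simp: PiE_def Pi_def)

lemma det_multilinear:
  fixes x :: "'n::finite \<Rightarrow> 'a \<Rightarrow> 'b::comm_ring_1 ^ 'n"
  assumes S: "finite S"
  shows "det (\<chi> i. \<Sum>a\<in>S. x i a) = (\<Sum>f | \<forall>i. f i \<in> S. det (\<chi> i. x i (f i)))"
proof -
  have "det (\<chi> i. \<Sum>a\<in>S. x i a) =
      (\<Sum>p | p permutes UNIV. \<Sum>f | \<forall>i. f i \<in> S. of_int (sign p) * (\<Prod>i\<in>UNIV. x i (f i) $ p i))"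
    using S by (simp add: det_def prod_sum_PiE PiE_UNIV_eq sum_distrib_left)
  also have "\<dots> = (\<Sum>f | \<forall>i. f i \<in> S. det (\<chi> i. x i (f i)))"
    by (subst sum.swap) (simp add: det_def)
  finally show ?thesis .
qed

text \<open>Expanding by rows picks a rank one summand \<open>h\<close> for each matrix, up to the
  permutation \<open>p\<close> assigning matrices to rows. Reordering the rows gives
  \<open>det (\<chi> r. u (h r))\<close> with the sign of \<open>p\<close>, and the sum over
  \<open>p\<close> of the remaining factors is the same determinant again, whence the
  square.\<close>

lemma sum_rank_one_det:
  fixes u :: "'a \<Rightarrow> real ^ 'n" and w :: "'n \<Rightarrow> 'a \<Rightarrow> real"
  assumes S: "finite S"
  shows "(\<Sum>p | p permutes UNIV. det (\<chi> r. \<Sum>a\<in>S. (w (p r) a * u a $ r) *s u a)) =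
    (\<Sum>h | \<forall>r. h r \<in> S. (\<Prod>r\<in>UNIV. w r (h r)) * (det (\<chi> r. u (h r)))\<^sup>2)"
proof -
  let ?H = "{h. \<forall>r::'n. h r \<in> S}"
  have "det (\<chi> r. \<Sum>a\<in>S. (w (p r) a * u a $ r) *s u a) =
      (\<Sum>h\<in>?H. (\<Prod>r\<in>UNIV. w r (h r)) * det (\<chi> r. u (h r)) * (of_int (sign p) * (\<Prod>r\<in>UNIV. u (h (p r)) $ r)))"
    if p: "p permutes UNIV" for p
  proof -
    have "det (\<chi> r. \<Sum>a\<in>S. (w (p r) a * u a $ r) *s u a) =
      (\<Sum>g\<in>?H. det (\<chi> r. (w (p r) (g r) * u (g r) $ r) *s u (g r)))"
      by (rule det_multilinear[OF S])
    also have "\<dots> = (\<Sum>g\<in>?H. (\<Prod>r\<in>UNIV. w (p r) (g r) * u (g r) $ r) * det (\<chi> r. u (g r)))"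
      by (simp only: det_rows_mul)
    also have "\<dots> = (\<Sum>h\<in>?H. (\<Prod>r\<in>UNIV. w (p r) (h (p r)) * u (h (p r)) $ r) * det (\<chi> r. u (h (p r))))"
    proof (rule sum.reindex_bij_witness[of _ "\<lambda>h r. h (p r)" "\<lambda>g r. g (inv p r)"])
    qed (use p in \<open>auto simp: permutes_inverses\<close>)
    also have "\<dots> = (\<Sum>h\<in>?H. (\<Prod>r\<in>UNIV. w r (h r)) * det (\<chi> r. u (h r)) * (of_int (sign p) * (\<Prod>r\<in>UNIV. u (h (p r)) $ r)))"
    proof (intro sum.cong refl)
      fix h
      have "(\<Prod>r\<in>UNIV. w (p r) (h (p r))) = (\<Prod>r\<in>UNIV. w r (h r))"
        by (rule prod.permute[OF p, of "\<lambda>r. w r (h r)", unfolded o_def, symmetric])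
      moreover have "det (\<chi> r. u (h (p r))) = of_int (sign p) * det (\<chi> r. u (h r))"
        using det_permute_rows[OF p, of "\<chi> r. u (h r)"] by simp
      ultimately show "(\<Prod>r\<in>UNIV. w (p r) (h (p r)) * u (h (p r)) $ r) * det (\<chi> r. u (h (p r))) =
        (\<Prod>r\<in>UNIV. w r (h r)) * det (\<chi> r. u (h r)) * (of_int (sign p) * (\<Prod>r\<in>UNIV. u (h (p r)) $ r))"
        by (simp add: prod.distrib mult_ac)
    qed
    finally show ?thesis .
  qed
  then have "(\<Sum>p | p permutes UNIV. det (\<chi> r. \<Sum>a\<in>S. (w (p r) a * u a $ r) *s u a)) =
    (\<Sum>p | p permutes UNIV. \<Sum>h\<in>?H. (\<Prod>r\<in>UNIV. w r (h r)) * det (\<chi> r. u (h r)) * (of_int (sign p) * (\<Prod>r\<in>UNIV. u (h (p r)) $ r)))"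
    by (intro sum.cong) auto
  also have "\<dots> = (\<Sum>h\<in>?H. (\<Prod>r\<in>UNIV. w r (h r)) * det (\<chi> r. u (h r)) *
      (\<Sum>p | p permutes UNIV. of_int (sign p) * (\<Prod>r\<in>UNIV. u (h (p r)) $ r)))"
    unfolding sum_distrib_left by (rule sum.swap)
  also have "\<dots> = (\<Sum>h\<in>?H. (\<Prod>r\<in>UNIV. w r (h r)) * (det (\<chi> r. u (h r)))\<^sup>2)"
  proof (intro sum.cong refl)
    fix h
    have "(\<Sum>p | p permutes UNIV. of_int (sign p) * (\<Prod>r\<in>UNIV. u (h (p r)) $ r)) = det (transpose (\<chi> r. u (h r)))"
      by (simp add: det_def transpose_def)
    then show "(\<Prod>r\<in>UNIV. w r (h r)) * det (\<chi> r. u (h r)) *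
      (\<Sum>p | p permutes UNIV. of_int (sign p) * (\<Prod>r\<in>UNIV. u (h (p r)) $ r)) =
      (\<Prod>r\<in>UNIV. w r (h r)) * (det (\<chi> r. u (h r)))\<^sup>2"
      by (simp add: power2_eq_square mult.assoc)
  qed
  finally show ?thesis .
qed

lemma sum_rank_one_det_nonneg:
  fixes u :: "'a \<Rightarrow> real ^ 'n" and w :: "'n \<Rightarrow> 'a \<Rightarrow> real"
  assumes "finite S" "\<And>r a. a \<in> S \<Longrightarrow> 0 \<le> w r a"
  shows "0 \<le> (\<Sum>p | p permutes UNIV. det (\<chi> r. \<Sum>a\<in>S. (w (p r) a * u a $ r) *s u a))"
  unfolding sum_rank_one_det[OF assms(1)]
  using assms(2) by (intro sum_nonneg mult_nonneg_nonneg prod_nonneg) auto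

lemma rank_one_det_nonneg:
  fixes u :: "'a \<Rightarrow> real ^ 'n" and w :: "'a \<Rightarrow> real"
  assumes "finite S" "\<And>a. a \<in> S \<Longrightarrow> 0 \<le> w a"
  shows "0 \<le> det (\<chi> r. \<Sum>a\<in>S. (w a * u a $ r) *s u a)"
proof -
  \<comment> \<open>With equal weights every permutation contributes the same determinant, so a sum
    of nonnegative value has nonnegative terms.\<close>
  have "0 \<le> (\<Sum>p\<in>{p. p permutes (UNIV :: 'n set)}. det (\<chi> r. \<Sum>a\<in>S. (w a * u a $ r) *s u a))"
    using sum_rank_one_det_nonneg[OF assms(1), of "\<lambda>_. w" u] assms(2) by blast
  moreover have "card {p. p permutes (UNIV :: 'n set)} > 0"
    by (simp add: card_permutations)
  ultimately show ?thesis unfolding sum_constant by (meson mult_pos_neg not_le of_nat_0_less_iff)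
qed

lemma sum_supersets_sign:
  assumes "finite I" "K \<subseteq> I"
  shows "(\<Sum>J\<in>Pow I. (-1) ^ card J * of_bool (K \<subseteq> J)) = ((-1) ^ card I * of_bool (K = I) :: real)"
proof (cases "K = I")
  case True
  have "(\<Sum>J\<in>Pow I. (-1) ^ card J * of_bool (K \<subseteq> J)) = (\<Sum>J\<in>{I}. (-1) ^ card J * of_bool (K \<subseteq> J) :: real)"
    using assms True by (intro sum.mono_neutral_right) auto
  then show ?thesis using True by simp
next
  case False
  then obtain i where i: "i \<in> I" "i \<notin> K" using assms by blast
  then obtain I' where I': "I = insert i I'" "i \<notin> I'" by (meson mk_disjoint_insert)
  then have fin: "finite I'" using assms by simp
  have "K \<subseteq> insert i J \<longleftrightarrow> K \<subseteq> J" for J using i by auto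
  then have "(\<Sum>J\<in>Pow I. (-1) ^ card J * of_bool (K \<subseteq> J)) = (0 :: real)"
    unfolding I'(1) sum_Pow_insert[OF fin I'(2)] by simp
  then show ?thesis using False by simp
qed

text \<open>The positive semidefinite matrices enter as sums of rank one matrices \<open>w j a *\<^sub>R (u a)(u a)\<^sup>T\<close>.\<close>

lemma mixed_discriminant_nonneg:
  fixes u :: "'a \<Rightarrow> real ^ 'n" and w :: "'i \<Rightarrow> 'a \<Rightarrow> real"
  assumes S: "finite S" and I: "finite I" "card I = CARD('n)" and w: "\<And>j a. j \<in> I \<Longrightarrow> a \<in> S \<Longrightarrow> 0 \<le> w j a"
  shows "0 \<le> (\<Sum>J\<in>Pow I. (-1) ^ (CARD('n) - card J) * det (\<chi> r. \<Sum>a\<in>S. ((\<Sum>j\<in>J. w j a) * u a $ r) *s u a))"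
proof -
  define R where "R j r = (\<Sum>a\<in>S. (w j a * u a $ r) *s u a)" for j r
  define d where "d f = det (\<chi> r. R (f r) r)" for f
  let ?F = "{f. \<forall>r::'n. f r \<in> I}"
  have finF: "finite ?F" using I by (simp add: finite_PiE flip: PiE_UNIV_eq)
  have det_J: "det (\<chi> r. \<Sum>a\<in>S. ((\<Sum>j\<in>J. w j a) * u a $ r) *s u a) = (\<Sum>f\<in>?F. of_bool (range f \<subseteq> J) * d f)"
    if J: "J \<in> Pow I" for J
  proof -
    have "finite J" using J I by (auto intro: finite_subset)
    have "(\<Sum>a\<in>S. ((\<Sum>j\<in>J. w j a) * u a $ r) *s u a) = (\<Sum>j\<in>J. R j r)" for r
      unfolding R_def by (subst sum.swap) (simp add: vec_eq_iff sum_distrib_right)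
    then have "det (\<chi> r. \<Sum>a\<in>S. ((\<Sum>j\<in>J. w j a) * u a $ r) *s u a) = det (\<chi> r. \<Sum>j\<in>J. R j r)" by simp
    also have "\<dots> = (\<Sum>f | \<forall>r. f r \<in> J. d f)"
      unfolding d_def by (rule det_multilinear) fact
    also have "\<dots> = (\<Sum>f\<in>?F. of_bool (range f \<subseteq> J) * d f)"
      using J by (intro sum.mono_neutral_cong_left[OF finF]) (auto simp: image_subset_iff)
    finally show ?thesis .
  qed
  have "(\<Sum>J\<in>Pow I. (-1) ^ (CARD('n) - card J) * det (\<chi> r. \<Sum>a\<in>S. ((\<Sum>j\<in>J. w j a) * u a $ r) *s u a)) =
    (\<Sum>J\<in>Pow I. \<Sum>f\<in>?F. (-1) ^ CARD('n) * d f * ((-1) ^ card J * of_bool (range f \<subseteq> J)))"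
  proof (intro sum.cong refl)
    fix J assume J: "J \<in> Pow I"
    then have "card J \<le> CARD('n)" using I card_mono[of I J] by auto
    then show "(-1) ^ (CARD('n) - card J) * det (\<chi> r. \<Sum>a\<in>S. ((\<Sum>j\<in>J. w j a) * u a $ r) *s u a) =
      (\<Sum>f\<in>?F. (-1) ^ CARD('n) * d f * ((-1) ^ card J * of_bool (range f \<subseteq> J)))"
      unfolding det_J[OF J] sum_distrib_left by (simp add: minus_one_power_diff mult_ac)
  qed
  also have "\<dots> = (\<Sum>f\<in>?F. (-1) ^ CARD('n) * d f * (\<Sum>J\<in>Pow I. (-1) ^ card J * of_bool (range f \<subseteq> J)))"
    unfolding sum_distrib_left by (rule sum.swap)
  \<comment> \<open>Inclusion-exclusion over \<open>J\<close> leaves the assignments of matrices to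
    rows that use every matrix. As \<open>card I = CARD('n)\<close>, these are bijections, hence
    permutations after identifying \<open>I\<close> with the row indices by
    \<open>\<sigma>\<close>.\<close>
  also have "\<dots> = (\<Sum>f\<in>?F. of_bool (range f = I) * d f)"
  proof (intro sum.cong refl)
    fix f assume "f \<in> ?F"
    then have "range f \<subseteq> I" by auto
    then show "(-1) ^ CARD('n) * d f * (\<Sum>J\<in>Pow I. (-1) ^ card J * of_bool (range f \<subseteq> J)) = of_bool (range f = I) * d f"
      by (subst sum_supersets_sign[OF I(1)]) (auto simp: I(2) simp flip: power_add)
  qed
  also have "\<dots> = (\<Sum>f | range f = I. d f)"
    by (intro sum.mono_neutral_cong_right[OF finF]) auto
  finally have eq: "(\<Sum>J\<in>Pow I. (-1) ^ (CARD('n) - card J) * det (\<chi> r. \<Sum>a\<in>S. ((\<Sum>j\<in>J. w j a) * u a $ r) *s u a)) =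
    (\<Sum>f | range f = I. d f)" .
  obtain \<sigma> where \<sigma>: "bij_betw \<sigma> (UNIV :: 'n set) I"
    using I finite_same_card_bij[of "UNIV :: 'n set" I] by auto
  have "(\<Sum>f | range f = I. d f) = (\<Sum>p | p permutes UNIV. d (\<lambda>r. \<sigma> (p r)))"
  proof (rule sum.reindex_bij_witness[of _ "\<lambda>p r. \<sigma> (p r)" "\<lambda>f r. inv_into UNIV \<sigma> (f r)"])
    fix f :: "'n \<Rightarrow> 'i" assume f: "f \<in> {f. range f = I}"
    then show "(\<lambda>r. \<sigma> (inv_into UNIV \<sigma> (f r))) = f"
      using \<sigma> by (auto simp: bij_betw_def f_inv_into_f)
    have "inj f" using f I(2) by (intro eq_card_imp_inj_on) auto
    then have "bij_betw f UNIV I" using f by (auto simp: bij_betw_def)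
    from bij_betw_trans[OF this bij_betw_inv_into[OF \<sigma>]]
    show "(\<lambda>r. inv_into UNIV \<sigma> (f r)) \<in> {p. p permutes UNIV}"
      by (auto simp: comp_def intro: bij_imp_permutes)
    show "d (\<lambda>r. \<sigma> (inv_into UNIV \<sigma> (f r))) = d f"
      using \<open>(\<lambda>r. \<sigma> (inv_into UNIV \<sigma> (f r))) = f\<close> by simp
  next
    fix p :: "'n \<Rightarrow> 'n" assume p: "p \<in> {p. p permutes UNIV}"
    show "(\<lambda>r. inv_into UNIV \<sigma> (\<sigma> (p r))) = p"
      using \<sigma> by (simp add: bij_betw_def)
    show "(\<lambda>r. \<sigma> (p r)) \<in> {f. range f = I}"
      using bij_betw_trans[OF permutes_imp_bij \<sigma>, of p] p by (auto simp: bij_betw_def comp_def)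
  qed
  also have "\<dots> \<ge> 0"
    unfolding d_def R_def
    using w \<sigma> by (intro sum_rank_one_det_nonneg[OF S, of "\<lambda>r. w (\<sigma> r)"]) (auto simp: bij_betw_def)
  finally show ?thesis unfolding eq .
qed

section \<open>Gradients of log-sum-exp functions\<close>

definition expsum :: "'a::euclidean_space set \<Rightarrow> 'a \<Rightarrow> real" where
  "expsum V x = (\<Sum>v\<in>V. exp (v \<bullet> x))"

definition gibbs :: "'a::euclidean_space set \<Rightarrow> 'a \<Rightarrow> 'a \<Rightarrow> real" where
  "gibbs V x v = (if v \<in> V then exp (v \<bullet> x) / expsum V x else 0)"

text \<open>The gradient of \<open>ln (expsum V x)\<close>.\<close>

definition gibbs_mean :: "'a::euclidean_space set \<Rightarrow> 'a \<Rightarrow> 'a" where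
  "gibbs_mean V x = (\<Sum>v\<in>V. gibbs V x v *\<^sub>R v)"

lemma expsum_pos: "finite V \<Longrightarrow> V \<noteq> {} \<Longrightarrow> expsum V x > 0"
  unfolding expsum_def by (intro sum_pos) auto

lemma gibbs_nonneg: "0 \<le> gibbs V x v"
  by (auto simp: gibbs_def expsum_def intro!: divide_nonneg_nonneg sum_nonneg)

lemma sum_gibbs: "finite V \<Longrightarrow> V \<noteq> {} \<Longrightarrow> (\<Sum>v\<in>V. gibbs V x v) = 1"
  using expsum_pos[of V x] by (simp add: gibbs_def flip: sum_divide_distrib) (simp add: expsum_def)

lemma gibbs_mean_in_hull: "finite V \<Longrightarrow> V \<noteq> {} \<Longrightarrow> gibbs_mean V x \<in> convex hull V"
  unfolding gibbs_mean_def
  by (intro convex_sum) (auto simp: sum_gibbs gibbs_nonneg hull_inc)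

lemma sum_antisym:
  fixes f :: "'a \<Rightarrow> 'a \<Rightarrow> 'b::real_vector"
  shows "(\<Sum>v\<in>V. \<Sum>w\<in>V. f v w) = (1/2) *\<^sub>R (\<Sum>v\<in>V. \<Sum>w\<in>V. f v w + f w v)"
proof -
  have "(\<Sum>v\<in>V. \<Sum>w\<in>V. f w v) = (\<Sum>v\<in>V. \<Sum>w\<in>V. f v w)" by (rule sum.swap)
  then show ?thesis by (simp add: sum.distrib flip: scaleR_2)
qed

lemma expsum_has_derivative:
  "(expsum V has_derivative (\<lambda>h. \<Sum>v\<in>V. exp (v \<bullet> x) * (v \<bullet> h))) (at x)"
  unfolding expsum_def[abs_def]
  by (auto intro!: derivative_eq_intros sum.cong simp: fun_eq_iff mult.commute)

lemma gibbs_has_derivative: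
  assumes V: "finite V" "V \<noteq> {}" and v: "v \<in> V"
  shows "((\<lambda>x. gibbs V x v) has_derivative
    (\<lambda>h. \<Sum>w\<in>V. gibbs V x v * gibbs V x w * ((v - w) \<bullet> h))) (at x)"
proof -
  let ?Z = "expsum V x"
  have Z: "?Z \<noteq> 0" using expsum_pos[OF V, of x] by simp
  have "((\<lambda>x. exp (v \<bullet> x) / expsum V x) has_derivative
    (\<lambda>h. ((exp (v \<bullet> x) * (v \<bullet> h)) * ?Z - exp (v \<bullet> x) * (\<Sum>w\<in>V. exp (w \<bullet> x) * (w \<bullet> h))) / (?Z * ?Z))) (at x)"
    by (intro has_derivative_divide' expsum_has_derivative Z) (auto intro!: derivative_eq_intros)
  moreover have "((exp (v \<bullet> x) * (v \<bullet> h)) * ?Z - exp (v \<bullet> x) * (\<Sum>w\<in>V. exp (w \<bullet> x) * (w \<bullet> h))) / (?Z * ?Z) =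
    (\<Sum>w\<in>V. gibbs V x v * gibbs V x w * ((v - w) \<bullet> h))" for h
  proof -
    have "(exp (v \<bullet> x) * (v \<bullet> h)) * ?Z - exp (v \<bullet> x) * (\<Sum>w\<in>V. exp (w \<bullet> x) * (w \<bullet> h)) =
      (\<Sum>w\<in>V. exp (v \<bullet> x) * exp (w \<bullet> x) * ((v - w) \<bullet> h))"
      unfolding expsum_def sum_distrib_left sum_subtractf[symmetric]
      by (intro sum.cong refl) (simp add: inner_diff_left algebra_simps)
    then show ?thesis using v by (simp add: gibbs_def sum_divide_distrib)
  qed
  ultimately show ?thesis using v by (simp add: gibbs_def)
qed

text \<open>The derivative is the covariance matrix of the Gibbs weights. Symmetrizing in v and w
  displays it as a nonnegative combination of rank one matrices in \<open>v - w\<close>, which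
  explains the factor 1/2.\<close>

lemma gibbs_mean_has_derivative:
  fixes V :: "'a::euclidean_space set"
  assumes V: "finite V" "V \<noteq> {}"
  shows "(gibbs_mean V has_derivative
    (\<lambda>h. \<Sum>v\<in>V. \<Sum>w\<in>V. (gibbs V x v * gibbs V x w / 2 * ((v - w) \<bullet> h)) *\<^sub>R (v - w))) (at x)"
proof -
  have "(gibbs_mean V has_derivative
    (\<lambda>h. \<Sum>v\<in>V. (\<Sum>w\<in>V. gibbs V x v * gibbs V x w * ((v - w) \<bullet> h)) *\<^sub>R v)) (at x)"
    unfolding gibbs_mean_def[abs_def]
    by (intro has_derivative_sum has_derivative_scaleR_left gibbs_has_derivative V)
  moreover have "(\<Sum>v\<in>V. (\<Sum>w\<in>V. gibbs V x v * gibbs V x w * ((v - w) \<bullet> h)) *\<^sub>R v) =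
    (\<Sum>v\<in>V. \<Sum>w\<in>V. (gibbs V x v * gibbs V x w / 2 * ((v - w) \<bullet> h)) *\<^sub>R (v - w))" for h
  proof -
    have "(\<Sum>v\<in>V. (\<Sum>w\<in>V. gibbs V x v * gibbs V x w * ((v - w) \<bullet> h)) *\<^sub>R v) =
      (\<Sum>v\<in>V. \<Sum>w\<in>V. (gibbs V x v * gibbs V x w * ((v - w) \<bullet> h)) *\<^sub>R v)"
      by (simp add: scaleR_sum_left)
    also have "\<dots> = (1/2) *\<^sub>R (\<Sum>v\<in>V. \<Sum>w\<in>V. (gibbs V x v * gibbs V x w * ((v - w) \<bullet> h)) *\<^sub>R v +
        (gibbs V x w * gibbs V x v * ((w - v) \<bullet> h)) *\<^sub>R w)"
      by (rule sum_antisym)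
    also have "\<dots> = (\<Sum>v\<in>V. \<Sum>w\<in>V. (gibbs V x v * gibbs V x w / 2 * ((v - w) \<bullet> h)) *\<^sub>R (v - w))"
      unfolding scaleR_sum_right
    proof (intro sum.cong refl)
      fix v w :: 'a
      have "(1/2) *\<^sub>R ((c * D) *\<^sub>R v + (c * (- D)) *\<^sub>R w) = (c / 2 * D) *\<^sub>R (v - w)" for c D :: real
        by (simp add: scaleR_add_right scaleR_diff_right)
      moreover have "(w - v) \<bullet> h = - ((v - w) \<bullet> h)" by (simp add: inner_diff_left)
      ultimately show "(1/2) *\<^sub>R ((gibbs V x v * gibbs V x w * ((v - w) \<bullet> h)) *\<^sub>R v +
        (gibbs V x w * gibbs V x v * ((w - v) \<bullet> h)) *\<^sub>R w) =
        (gibbs V x v * gibbs V x w / 2 * ((v - w) \<bullet> h)) *\<^sub>R (v - w)"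
        by (simp only: mult.commute[of "gibbs V x w"])
    qed
    finally show ?thesis .
  qed
  ultimately show ?thesis by simp
qed

text \<open>After clearing denominators and symmetrizing, each term \<open>t v w\<close> is a
  difference of two exponentials times the difference \<open>d v - d w\<close> of their exponents;
  both factors have the same sign. The strict form yields injectivity of the gradient map.\<close>

lemma gibbs_mean_monotone:
  assumes V: "finite V" "V \<noteq> {}"
  shows "0 \<le> (gibbs_mean V x - gibbs_mean V y) \<bullet> (x - y)" (is ?nonneg)
    and "v \<in> V \<Longrightarrow> w \<in> V \<Longrightarrow> v \<bullet> (x - y) \<noteq> w \<bullet> (x - y) \<Longrightarrow>
      0 < (gibbs_mean V x - gibbs_mean V y) \<bullet> (x - y)" (is "_ \<Longrightarrow> _ \<Longrightarrow> _ \<Longrightarrow> ?pos")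
proof -
  define d where "d v = v \<bullet> (x - y)" for v
  define t where "t v w = (exp (v \<bullet> x + w \<bullet> y) - exp (w \<bullet> x + v \<bullet> y)) * (d v - d w)" for v w
  have t: "0 \<le> t v w" "d v \<noteq> d w \<Longrightarrow> 0 < t v w" for v w
  proof -
    have e: "(v \<bullet> x + w \<bullet> y) - (w \<bullet> x + v \<bullet> y) = d v - d w"
      by (simp add: d_def inner_diff_right)
    have "0 \<le> t v w \<and> (d v \<noteq> d w \<longrightarrow> 0 < t v w)"
    proof (cases "d v" "d w" rule: linorder_cases)
      case less
      then have "exp (v \<bullet> x + w \<bullet> y) < exp (w \<bullet> x + v \<bullet> y)" using e by simp
      then have "0 < t v w" using less by (simp add: t_def mult_neg_neg)
      then show ?thesis by simp
    next
      case greater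
      then have "exp (w \<bullet> x + v \<bullet> y) < exp (v \<bullet> x + w \<bullet> y)" using e by simp
      then have "0 < t v w" using greater by (simp add: t_def)
      then show ?thesis by simp
    qed (simp add: t_def)
    then show "0 \<le> t v w" "d v \<noteq> d w \<Longrightarrow> 0 < t v w" by auto
  qed
  let ?A = "expsum V x" and ?B = "expsum V y"
  have pos: "?A > 0" "?B > 0" using expsum_pos[OF V] by auto
  have mean: "gibbs_mean V z \<bullet> (x - y) = (\<Sum>v\<in>V. exp (v \<bullet> z) * d v) / expsum V z" for z
    unfolding gibbs_mean_def inner_sum_left sum_divide_distrib by (intro sum.cong refl) (simp add: gibbs_def d_def)
  have "(gibbs_mean V x - gibbs_mean V y) \<bullet> (x - y) =
      ((\<Sum>v\<in>V. exp (v \<bullet> x) * d v) * ?B - ?A * (\<Sum>w\<in>V. exp (w \<bullet> y) * d w)) / (?A * ?B)"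
    using pos by (simp add: inner_diff_left mean field_simps)
  also have "(\<Sum>v\<in>V. exp (v \<bullet> x) * d v) * ?B - ?A * (\<Sum>w\<in>V. exp (w \<bullet> y) * d w) =
      (\<Sum>v\<in>V. \<Sum>w\<in>V. exp (v \<bullet> x + w \<bullet> y) * (d v - d w))"
    unfolding expsum_def sum_product sum_subtractf[symmetric]
    by (intro sum.cong refl) (simp add: exp_add algebra_simps)
  also have "\<dots> = (1/2) *\<^sub>R (\<Sum>v\<in>V. \<Sum>w\<in>V. exp (v \<bullet> x + w \<bullet> y) * (d v - d w) + exp (w \<bullet> x + v \<bullet> y) * (d w - d v))"
    by (rule sum_antisym)
  also have "\<dots> = (\<Sum>v\<in>V. \<Sum>w\<in>V. t v w) / 2"
    by (simp add: t_def algebra_simps)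
  finally have eq: "(gibbs_mean V x - gibbs_mean V y) \<bullet> (x - y) = (\<Sum>v\<in>V. \<Sum>w\<in>V. t v w) / 2 / (?A * ?B)" .
  show ?nonneg unfolding eq using pos t by (auto intro!: divide_nonneg_pos sum_nonneg)
  show ?pos if "v \<in> V" "w \<in> V" "v \<bullet> (x - y) \<noteq> w \<bullet> (x - y)"
  proof -
    have "0 < (\<Sum>w\<in>V. t v w)"
      using V t that by (intro sum_pos2[of _ w]) (auto simp: d_def)
    then have "0 < (\<Sum>v\<in>V. \<Sum>w\<in>V. t v w)"
      by (rule sum_pos2[OF V(1) that(1)]) (use t(1) in \<open>auto intro: sum_nonneg\<close>)
    then show ?thesis unfolding eq using pos by simp
  qed
qed

lemma inner_le_ln_expsum:
  assumes V: "finite V" "V \<noteq> {}" and q: "q \<in> convex hull V"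
  shows "q \<bullet> x \<le> ln (expsum V x)"
proof -
  have "V \<subseteq> {q. x \<bullet> q \<le> ln (expsum V x)}"
  proof
    fix v assume "v \<in> V"
    then have "exp (v \<bullet> x) \<le> expsum V x"
      unfolding expsum_def using V by (intro member_le_sum) auto
    then show "v \<in> {q. x \<bullet> q \<le> ln (expsum V x)}"
      using expsum_pos[OF V, of x] by (simp add: ln_ge_iff inner_commute)
  qed
  then have "convex hull V \<subseteq> {q. x \<bullet> q \<le> ln (expsum V x)}"
    by (intro hull_minimal convex_halfspace_le)
  then show ?thesis using q by (auto simp: inner_commute)
qed

text \<open>The value \<open>y\<close> is attained where \<open>F\<close>, whose gradient is the map
  minus \<open>y\<close>, has a minimum. A ball around \<open>y\<close> inside the polytope makes
  \<open>F\<close> grow at least like \<open>\<delta> * norm x\<close>, so a minimum over a large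
  ball is global.\<close>

lemma interior_subset_range_gibbs_mean:
  fixes V :: "'i \<Rightarrow> 'a::euclidean_space set"
  assumes J: "finite J" and V: "\<And>j. j \<in> J \<Longrightarrow> finite (V j)" "\<And>j. j \<in> J \<Longrightarrow> V j \<noteq> {}"
    and y: "y \<in> interior (\<Sum>j\<in>J. convex hull (V j))"
  shows "y \<in> range (\<lambda>x. \<Sum>j\<in>J. gibbs_mean (V j) x)"
proof -
  let ?P = "\<Sum>j\<in>J. convex hull (V j)"
  define F where "F x = (\<Sum>j\<in>J. ln (expsum (V j) x)) - y \<bullet> x" for x
  obtain \<delta> where \<delta>: "\<delta> > 0" "cball y \<delta> \<subseteq> ?P" using y unfolding mem_interior_cball by blast
  have coercive: "\<delta> * norm x \<le> F x" for x
  proof -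
    \<comment> \<open>The point of the ball around \<open>y\<close> farthest in direction
      \<open>x\<close>; its inner product with \<open>x\<close> exceeds that of \<open>y\<close> by
      \<open>\<delta> * norm x\<close>.\<close>
    define z where "z = (if x = 0 then y else y + (\<delta> / norm x) *\<^sub>R x)"
    have "z \<in> cball y \<delta>" using \<delta>(1) by (auto simp: z_def dist_norm)
    then have "z \<in> ?P" using \<delta>(2) by blast
    then obtain s where s: "z = sum s J" "\<And>j. j \<in> J \<Longrightarrow> s j \<in> convex hull (V j)"
      unfolding set_sum_alt[OF J] by auto
    have "z \<bullet> x = (\<Sum>j\<in>J. s j \<bullet> x)" by (simp add: s(1) inner_sum_left)
    also have "\<dots> \<le> (\<Sum>j\<in>J. ln (expsum (V j) x))"
      using s(2) V by (intro sum_mono inner_le_ln_expsum) auto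
    finally have "z \<bullet> x \<le> (\<Sum>j\<in>J. ln (expsum (V j) x))" .
    moreover have "z \<bullet> x = y \<bullet> x + \<delta> * norm x"
      by (simp add: z_def inner_add_left dot_square_norm power2_eq_square)
    ultimately show ?thesis by (simp add: F_def)
  qed
  have der: "(F has_derivative (\<lambda>h. ((\<Sum>j\<in>J. gibbs_mean (V j) x) - y) \<bullet> h)) (at x)" for x
  proof -
    have ln: "((\<lambda>x. ln (expsum (V j) x)) has_derivative (\<lambda>h. gibbs_mean (V j) x \<bullet> h)) (at x)" if "j \<in> J" for j
    proof -
      have "((\<lambda>x. ln (expsum (V j) x)) has_derivative
          (\<lambda>h. (\<Sum>v\<in>V j. exp (v \<bullet> x) * (v \<bullet> h)) * inverse (expsum (V j) x))) (at x)"
        using expsum_pos[of "V j" x] V that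
        by (intro has_derivative_ln expsum_has_derivative) auto
      moreover have "(\<Sum>v\<in>V j. exp (v \<bullet> x) * (v \<bullet> h)) * inverse (expsum (V j) x) = gibbs_mean (V j) x \<bullet> h" for h
        unfolding gibbs_mean_def inner_sum_left sum_distrib_right
        by (intro sum.cong refl) (simp add: gibbs_def divide_inverse)
      ultimately show ?thesis by simp
    qed
    have "(F has_derivative (\<lambda>h. (\<Sum>j\<in>J. gibbs_mean (V j) x \<bullet> h) - y \<bullet> h)) (at x)"
      unfolding F_def[abs_def]
      by (intro has_derivative_diff has_derivative_sum ln has_derivative_inner_right has_derivative_ident)
    then show ?thesis by (simp add: inner_diff_left inner_sum_left)
  qed
  define C where "C = cball (0::'a) (\<bar>F 0\<bar> / \<delta>)"
  have "continuous_on C F"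
    by (rule has_derivative_continuous_on, rule has_derivative_at_withinI, rule der)
  moreover have "compact C" "0 \<in> C" using \<delta>(1) by (auto simp: C_def)
  ultimately obtain x0 where x0: "x0 \<in> C" "\<And>x. x \<in> C \<Longrightarrow> F x0 \<le> F x"
    using continuous_attains_inf[of C F] by blast
  have "F x0 \<le> F x" for x
  proof (cases "x \<in> C")
    case False
    then have "\<bar>F 0\<bar> < \<delta> * norm x" using \<delta>(1) by (simp add: C_def field_simps)
    then show ?thesis using coercive[of x] x0(2)[OF \<open>0 \<in> C\<close>] by linarith
  qed (rule x0(2))
  then have "(\<lambda>h. ((\<Sum>j\<in>J. gibbs_mean (V j) x0) - y) \<bullet> h) = (\<lambda>h. 0)"
    by (intro differential_zero_maxmin[OF _ _ der, of x0 UNIV]) auto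
  then have "((\<Sum>j\<in>J. gibbs_mean (V j) x0) - y) \<bullet> ((\<Sum>j\<in>J. gibbs_mean (V j) x0) - y) = 0"
    by (rule fun_cong)
  then have "(\<Sum>j\<in>J. gibbs_mean (V j) x0) = y" by simp
  then show ?thesis by blast
qed

definition pair_weight :: "'a::euclidean_space set \<Rightarrow> 'a \<Rightarrow> 'a \<times> 'a \<Rightarrow> real" where
  "pair_weight V x = (\<lambda>(v, w). gibbs V x v * gibbs V x w / 2)"

lemma matrix_rank_one_sum:
  fixes u :: "'a \<Rightarrow> real ^ 'n"
  shows "matrix (\<lambda>h. \<Sum>a\<in>S. (c a * (u a \<bullet> h)) *\<^sub>R u a) = (\<chi> r. \<Sum>a\<in>S. (c a * u a $ r) *s u a)"
  by (simp add: matrix_def vec_eq_iff inner_axis mult_ac)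

text \<open>Writing all derivatives over the common set \<open>U \<times> U\<close> leaves the
  dependence on \<open>j\<close> in the weights only, as \<open>mixed_discriminant_nonneg\<close>
  demands. It is possible because Gibbs weights vanish outside their set.\<close>

lemma sum_gibbs_mean_has_derivative:
  fixes V :: "'i \<Rightarrow> 'a::euclidean_space set"
  assumes J: "finite J" and V: "\<And>j. j \<in> J \<Longrightarrow> finite (V j)" "\<And>j. j \<in> J \<Longrightarrow> V j \<noteq> {}"
    and U: "finite U" "\<And>j. j \<in> J \<Longrightarrow> V j \<subseteq> U"
  shows "((\<lambda>x. \<Sum>j\<in>J. gibbs_mean (V j) x) has_derivative
    (\<lambda>h. \<Sum>a\<in>U \<times> U. ((\<Sum>j\<in>J. pair_weight (V j) x a) * ((fst a - snd a) \<bullet> h)) *\<^sub>R (fst a - snd a))) (at x)"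
proof -
  have "(\<Sum>v\<in>V j. \<Sum>w\<in>V j. (gibbs (V j) x v * gibbs (V j) x w / 2 * ((v - w) \<bullet> h)) *\<^sub>R (v - w)) =
    (\<Sum>a\<in>U \<times> U. (pair_weight (V j) x a * ((fst a - snd a) \<bullet> h)) *\<^sub>R (fst a - snd a))" if j: "j \<in> J" for j h
  proof -
    have "(\<Sum>v\<in>V j. \<Sum>w\<in>V j. (gibbs (V j) x v * gibbs (V j) x w / 2 * ((v - w) \<bullet> h)) *\<^sub>R (v - w)) =
      (\<Sum>a\<in>V j \<times> V j. (pair_weight (V j) x a * ((fst a - snd a) \<bullet> h)) *\<^sub>R (fst a - snd a))"
      unfolding sum.cartesian_product by (intro sum.cong) (auto simp: pair_weight_def)
    also have "\<dots> = (\<Sum>a\<in>U \<times> U. (pair_weight (V j) x a * ((fst a - snd a) \<bullet> h)) *\<^sub>R (fst a - snd a))"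
      using U j by (intro sum.mono_neutral_left) (auto simp: pair_weight_def gibbs_def split: if_splits)
    finally show ?thesis .
  qed
  then have "(\<Sum>j\<in>J. \<Sum>v\<in>V j. \<Sum>w\<in>V j. (gibbs (V j) x v * gibbs (V j) x w / 2 * ((v - w) \<bullet> h)) *\<^sub>R (v - w)) =
    (\<Sum>a\<in>U \<times> U. ((\<Sum>j\<in>J. pair_weight (V j) x a) * ((fst a - snd a) \<bullet> h)) *\<^sub>R (fst a - snd a))" for h
    by (simp add: sum_distrib_right scaleR_sum_left sum.swap[of _ _ J])
  moreover have "((\<lambda>x. \<Sum>j\<in>J. gibbs_mean (V j) x) has_derivative
    (\<lambda>h. \<Sum>j\<in>J. \<Sum>v\<in>V j. \<Sum>w\<in>V j. (gibbs (V j) x v * gibbs (V j) x w / 2 * ((v - w) \<bullet> h)) *\<^sub>R (v - w))) (at x)"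
    using V by (intro has_derivative_sum gibbs_mean_has_derivative)
  ultimately show ?thesis by simp
qed

text \<open>The gradient of \<open>\<Sum>j\<in>J. ln (expsum (V j) x)\<close> maps the space injectively onto the Minkowski sum
  of the hulls up to boundary points, unless that sum lies in a hyperplane.\<close>

lemma volume_has_integral:
  fixes V :: "'i \<Rightarrow> (real ^ 'n::{finite,wellorder}) set"
  assumes J: "finite J" and V: "\<And>j. j \<in> J \<Longrightarrow> finite (V j)" "\<And>j. j \<in> J \<Longrightarrow> V j \<noteq> {}"
    and U: "finite U" "\<And>j. j \<in> J \<Longrightarrow> V j \<subseteq> U"
  shows "((\<lambda>x. det (\<chi> r. \<Sum>a\<in>U \<times> U. ((\<Sum>j\<in>J. pair_weight (V j) x a) * (fst a - snd a) $ r) *s (fst a - snd a)))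
    has_integral measure lebesgue (\<Sum>j\<in>J. convex hull (V j))) UNIV"
proof -
  let ?P = "\<Sum>j\<in>J. convex hull (V j)"
  define f where "f x = (\<Sum>j\<in>J. gibbs_mean (V j) x)" for x
  define f' where "f' x h = (\<Sum>a\<in>U \<times> U. ((\<Sum>j\<in>J. pair_weight (V j) x a) * ((fst a - snd a) \<bullet> h)) *\<^sub>R (fst a - snd a))" for x h
  have der: "(f has_derivative f' x) (at x)" for x
    unfolding f_def[abs_def] f'_def[abs_def] by (rule sum_gibbs_mean_has_derivative[OF J V U])
  have mat: "(\<chi> r. \<Sum>a\<in>U \<times> U. ((\<Sum>j\<in>J. pair_weight (V j) x a) * (fst a - snd a) $ r) *s (fst a - snd a)) = matrix (f' x)" for x
    unfolding f'_def[abs_def] by (rule matrix_rank_one_sum[symmetric])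
  have nonneg: "0 \<le> det (matrix (f' x))" for x
    unfolding mat[symmetric] using U
    by (intro rank_one_det_nonneg) (auto simp: pair_weight_def intro!: sum_nonneg mult_nonneg_nonneg gibbs_nonneg)
  have elem: "\<exists>s. z = sum s J \<and> (\<forall>j\<in>J. s j \<in> convex hull (V j))" if "z \<in> ?P" for z
    using that unfolding set_sum_alt[OF J] by auto
  show ?thesis
  \<comment> \<open>Such an \<open>a\<close> is orthogonal to all edges: the Minkowski sum lies in a
    hyperplane and the derivative kills \<open>a\<close>, so both sides are 0.\<close>
  proof (cases "\<exists>a. a \<noteq> 0 \<and> (\<forall>j\<in>J. \<forall>v\<in>V j. \<forall>w\<in>V j. a \<bullet> v = a \<bullet> w)")
    case True
    then obtain a where a: "a \<noteq> 0" "\<And>j v w. j \<in> J \<Longrightarrow> v \<in> V j \<Longrightarrow> w \<in> V j \<Longrightarrow> a \<bullet> v = a \<bullet> w" by blast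
    have "det (matrix (f' x)) = 0" for x
    proof -
      have *: "(\<Sum>j\<in>J. pair_weight (V j) x b) * ((fst b - snd b) \<bullet> a) = 0" for b
        unfolding sum_distrib_right
      proof (intro sum.neutral ballI)
        fix j assume "j \<in> J"
        then show "pair_weight (V j) x b * ((fst b - snd b) \<bullet> a) = 0"
          using a(2)[of j "fst b" "snd b"]
          by (cases "fst b \<in> V j \<and> snd b \<in> V j")
            (auto simp: pair_weight_def gibbs_def split_def inner_diff_right inner_commute[of _ a])
      qed
      have "f' x a = f' x 0" by (simp only: f'_def * inner_zero_right mult_zero_right)
      then have "\<not> inj (f' x)" using a(1) by (auto dest: injD)
      moreover have "linear (f' x)" using der by (blast intro: has_derivative_linear)
      ultimately show ?thesis using det_nz_iff_inj by blast
    qed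
    moreover have "negligible ?P"
    proof (rule negligible_subset[OF negligible_hyperplane])
      define c where "c j = a \<bullet> (SOME v. v \<in> V j)" for j
      have c: "convex hull (V j) \<subseteq> {z. a \<bullet> z = c j}" if j: "j \<in> J" for j
      proof (intro hull_minimal convex_hyperplane subsetI)
        fix v assume v: "v \<in> V j"
        then have "(SOME v. v \<in> V j) \<in> V j" by (rule someI)
        then show "v \<in> {z. a \<bullet> z = c j}" using a(2)[OF j v] by (simp add: c_def)
      qed
      show "?P \<subseteq> {z. a \<bullet> z = (\<Sum>j\<in>J. c j)}"
      proof
        fix z assume "z \<in> ?P"
        then obtain s where "z = sum s J" "\<forall>j\<in>J. s j \<in> convex hull (V j)" using elem by blast
        then show "z \<in> {z. a \<bullet> z = (\<Sum>j\<in>J. c j)}" using c by (auto simp: inner_sum_right intro!: sum.cong)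
      qed
      show "a \<noteq> 0 \<or> (\<Sum>j\<in>J. c j) \<noteq> 0" using a(1) by simp
    qed
    ultimately show ?thesis unfolding mat by (simp add: negligible_imp_measure0)
  next
    case False
    have "inj f"
    proof (rule injI, rule ccontr)
      fix x y assume eq: "f x = f y" and ne: "x \<noteq> y"
      from ne False obtain j v w where j: "j \<in> J" "v \<in> V j" "w \<in> V j" "(x - y) \<bullet> v \<noteq> (x - y) \<bullet> w"
        by (metis right_minus_eq)
      have "0 < (\<Sum>j\<in>J. (gibbs_mean (V j) x - gibbs_mean (V j) y) \<bullet> (x - y))"
      proof (rule sum_pos2[OF J j(1)])
        show "0 < (gibbs_mean (V j) x - gibbs_mean (V j) y) \<bullet> (x - y)"
          using j V by (intro gibbs_mean_monotone(2)[of _ v w]) (auto simp: inner_commute)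
        show "0 \<le> (gibbs_mean (V i) x - gibbs_mean (V i) y) \<bullet> (x - y)" if "i \<in> J" for i
          using that V by (intro gibbs_mean_monotone(1)) auto
      qed
      also have "\<dots> = (f x - f y) \<bullet> (x - y)"
        by (simp add: f_def inner_sum_left flip: sum_subtractf)
      finally show False using eq by simp
    qed
    have poly: "polytope ?P" using V by (intro polytope_set_sum polytope_convex_hull)
    have "f x \<in> ?P" for x
      unfolding f_def set_sum_alt[OF J] using V by (blast intro: gibbs_mean_in_hull)
    then have "range f \<subseteq> ?P" by blast
    moreover have "interior ?P \<subseteq> range f"
      using interior_subset_range_gibbs_mean[of J V] J V unfolding f_def[abs_def] by blast
    ultimately have "(?P - range f) \<union> (range f - ?P) \<subseteq> frontier ?P"
      using closure_subset by (auto simp: frontier_def)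
    then have neg: "negligible ((?P - range f) \<union> (range f - ?P))"
      using negligible_convex_frontier[OF polytope_imp_convex[OF poly]] negligible_subset by blast
    have P: "?P \<in> lmeasurable" using poly by (intro lmeasurable_compact polytope_imp_compact)
    have "range f \<in> lmeasurable" "measure lebesgue (range f) = measure lebesgue ?P"
      using lmeasurable_negligible_symdiff[OF P neg] measure_negligible_symdiff[OF P neg] by auto
    \<comment> \<open>The change of variables produces an absolute value. Removing it by
      \<open>nonneg\<close> matters: only the determinant itself expands multilinearly when the sets
      \<open>J\<close> are combined.\<close>
    then have "((\<lambda>x. \<bar>det (matrix (f' x))\<bar>) has_integral measure lebesgue ?P) UNIV"
      using has_measure_differentiable_image[of UNIV f f' "measure lebesgue ?P"] der \<open>inj f\<close> by simp
    then show ?thesis unfolding mat using nonneg by simp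
  qed
qed

lemma mixed_volume_sum_nonneg:
  fixes V :: "'i \<Rightarrow> (real ^ 'n::{finite,wellorder}) set"
  assumes I: "finite I" "card I = CARD('n)" and V: "\<And>j. j \<in> I \<Longrightarrow> finite (V j)" "\<And>j. j \<in> I \<Longrightarrow> V j \<noteq> {}"
  shows "0 \<le> (\<Sum>J\<in>Pow I. (-1) ^ (CARD('n) - card J) * measure lebesgue (\<Sum>j\<in>J. convex hull (V j)))"
proof -
  define U where "U = (\<Union>j\<in>I. V j)"
  have "finite U" using I V by (auto simp: U_def)
  let ?D = "\<lambda>J x. det (\<chi> r. \<Sum>a\<in>U \<times> U. ((\<Sum>j\<in>J. pair_weight (V j) x a) * (fst a - snd a) $ r) *s (fst a - snd a))"
  have "(?D J has_integral measure lebesgue (\<Sum>j\<in>J. convex hull (V j))) UNIV" if "J \<in> Pow I" for J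
    using that I V \<open>finite U\<close> by (intro volume_has_integral) (auto simp: U_def intro: finite_subset)
  then have "((\<lambda>x. \<Sum>J\<in>Pow I. (-1) ^ (CARD('n) - card J) * ?D J x) has_integral
    (\<Sum>J\<in>Pow I. (-1) ^ (CARD('n) - card J) * measure lebesgue (\<Sum>j\<in>J. convex hull (V j)))) UNIV"
    using I(1) by (intro has_integral_sum has_integral_mult_right) auto
  then show ?thesis
  proof (rule has_integral_nonneg)
    fix x
    show "0 \<le> (\<Sum>J\<in>Pow I. (-1) ^ (CARD('n) - card J) * ?D J x)"
      using \<open>finite U\<close>
      by (intro mixed_discriminant_nonneg[OF _ I, of "U \<times> U" "\<lambda>j. pair_weight (V j) x" "\<lambda>a. fst a - snd a"])
        (auto simp: pair_weight_def intro!: gibbs_nonneg mult_nonneg_nonneg)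
  qed
qed

section \<open>Nonnegativity and the theorem\<close>

text \<open>The change of variables theorem of the library needs a well-ordered index type, so
  nonnegativity is transported from the copy of the index type below.\<close>

typedef ('a::finite) ordered_index = "{..<CARD('a)}"
  by (rule exI[of _ 0]) simp

lemma card_ordered_index: "CARD('a::finite ordered_index) = CARD('a)"
  using type_definition.card[OF type_definition_ordered_index[where ?'a = 'a]] by simp

instance ordered_index :: (finite) finite
proof
  show "finite (UNIV :: 'a ordered_index set)"
    using type_definition.univ[OF type_definition_ordered_index[where ?'a = 'a]]
    by (metis finite_imageI finite_lessThan)
qed

instantiation ordered_index :: (finite) wellorder
begin

definition less_eq_ordered_index :: "'a ordered_index \<Rightarrow> 'a ordered_index \<Rightarrow> bool" where
  "x \<le> y \<longleftrightarrow> Rep_ordered_index x \<le> Rep_ordered_index y"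

definition less_ordered_index :: "'a ordered_index \<Rightarrow> 'a ordered_index \<Rightarrow> bool" where
  "x < y \<longleftrightarrow> Rep_ordered_index x < Rep_ordered_index y"

instance
proof
  fix P :: "'a ordered_index \<Rightarrow> bool" and a
  assume "\<And>x. (\<And>y. y < x \<Longrightarrow> P y) \<Longrightarrow> P x"
  then show "P a"
    unfolding less_ordered_index_def by (rule measure_induct_rule[of Rep_ordered_index])
qed (auto simp: less_eq_ordered_index_def less_ordered_index_def Rep_ordered_index_inject)

end

section \<open>Transport along a linear isomorphism\<close>

lemma image_set_plus:
  fixes f :: "'a::real_vector \<Rightarrow> 'b::real_vector"
  assumes "linear f"
  shows "f ` (A + B) = f ` A + f ` B"
proof
  show "f ` (A + B) \<subseteq> f ` A + f ` B"
    unfolding set_plus_def by (auto simp: linear_add[OF assms]) blast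
  show "f ` A + f ` B \<subseteq> f ` (A + B)"
  proof
    fix y assume "y \<in> f ` A + f ` B"
    then obtain a b where "y = f (a + b)" "a \<in> A" "b \<in> B"
      by (auto simp: set_plus_def linear_add[OF assms])
    then show "y \<in> f ` (A + B)" by (auto intro: set_plus_intro)
  qed
qed

lemma image_set_sum:
  fixes f :: "'a::real_vector \<Rightarrow> 'b::real_vector"
  assumes "linear f"
  shows "f ` (\<Sum>j\<in>J. P j) = (\<Sum>j\<in>J. f ` P j)"
  by (induction J rule: infinite_finite_induct) (auto simp: image_set_plus[OF assms] linear_0[OF assms])

lemma group_closure_linear_image:
  fixes f :: "'a::real_vector \<Rightarrow> 'b::real_vector"
  assumes "linear f"
  shows "group_closure (f ` B) = f ` group_closure B"
proof
  show "group_closure (f ` B) \<subseteq> f ` group_closure B"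
  proof
    fix x assume "x \<in> group_closure (f ` B)"
    then show "x \<in> f ` group_closure B"
    proof (induction rule: group_closure.induct)
      case (base s)
      then have "s \<in> f ` insert 0 B" using linear_0[OF assms] by auto
      then show ?case using group_closure.base[of _ B] by blast
    next
      case (diff s t)
      then obtain a b where "a \<in> group_closure B" "b \<in> group_closure B" "s = f a" "t = f b" by blast
      then have "a - b \<in> group_closure B" "s - t = f (a - b)"
        by (auto simp: linear_diff[OF assms] intro: group_closure.diff)
      then show ?case by blast
    qed
  qed
  show "f ` group_closure B \<subseteq> group_closure (f ` B)"
  proof
    fix y assume "y \<in> f ` group_closure B"
    then obtain x where x: "y = f x" "x \<in> group_closure B" by blast
    have "f x \<in> group_closure (f ` B)"
      using x(2)
    proof (induction rule: group_closure.induct)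
      case (base s)
      then have "f s \<in> insert 0 (f ` B)" using linear_0[OF assms] by auto
      then show ?case by (rule group_closure.base)
    next
      case (diff s t)
      then show ?case by (simp add: linear_diff[OF assms] group_closure.diff)
    qed
    then show "y \<in> group_closure (f ` B)" by (simp add: x)
  qed
qed

lemma mixed_volume_nonneg_wellorder:
  fixes L :: "(real ^ 'n::{finite,wellorder}) set"
  assumes "full_lattice L B" and P: "\<And>j. j \<in> {1..CARD('n)} \<Longrightarrow> lattice_polytope L (P j)"
  shows "0 \<le> mixed_volume L P"
proof -
  interpret full_lattice L B by fact
  have "\<exists>V. finite V \<and> V \<noteq> {} \<and> P j = convex hull V" if "j \<in> {1..CARD('n)}" for j
    using lattice_polytope_hull[OF P[OF that]] by metis
  then obtain V where V: "\<And>j. j \<in> {1..CARD('n)} \<Longrightarrow> finite (V j) \<and> V j \<noteq> {} \<and> P j = convex hull (V j)"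
    by metis
  have "(\<Sum>I\<in>Pow {1..CARD('n)}. (-1) ^ (CARD('n) - card I) * measure lebesgue (\<Sum>i\<in>I. P i)) =
    (\<Sum>I\<in>Pow {1..CARD('n)}. (-1) ^ (CARD('n) - card I) * measure lebesgue (\<Sum>i\<in>I. convex hull (V i)))"
    using V by (intro sum.cong refl arg_cong2[of _ _ _ _ "(*)"] arg_cong[of _ _ "measure lebesgue"]) auto
  also have "\<dots> \<ge> 0"
    using V by (intro mixed_volume_sum_nonneg) auto
  finally show ?thesis
    unfolding mixed_volume_eq_sum_Pow using covolume_pos by simp
qed

text \<open>The transport goes through \<open>mixed_count\<close>: lattice point counts are
  preserved by an injective linear map, so no volumes or covolumes have to be compared between the
  two spaces.\<close>

lemma mixed_volume_nonneg:
  fixes L :: "(real ^ 'n) set"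
  assumes L: "full_lattice L B" and P: "\<And>j. j \<in> {1..CARD('n)} \<Longrightarrow> lattice_polytope L (P j)"
  shows "0 \<le> mixed_volume L P"
proof -
  interpret full_lattice L B by (rule L)
  obtain \<sigma> where \<sigma>: "bij_betw \<sigma> (UNIV :: 'n ordered_index set) (UNIV :: 'n set)"
    using finite_same_card_bij[of "UNIV :: 'n ordered_index set" "UNIV :: 'n set"] by (auto simp: card_ordered_index)
  define f :: "real ^ 'n \<Rightarrow> real ^ 'n ordered_index" where "f x = (\<chi> i. x $ \<sigma> i)" for x
  have lin: "linear f" by (rule linearI) (simp_all add: f_def vec_eq_iff)
  have "inj f"
  proof (rule injI)
    fix x y assume "f x = f y"
    then have "x $ \<sigma> i = y $ \<sigma> i" for i by (simp add: f_def vec_eq_iff)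
    then show "x = y" using \<sigma> by (metis bij_betw_def surjD vec_eq_iff)
  qed
  have full: "full_lattice (f ` L) (f ` B)"
  proof
    show "independent (f ` B)"
      using linear_independent_injective_image[OF lin indep] \<open>inj f\<close> by (simp add: inj_on_subset)
    show "card (f ` B) = CARD('n ordered_index)"
      using \<open>inj f\<close> card_B by (simp add: card_image inj_on_subset card_ordered_index)
    show "f ` L = group_closure (f ` B)"
      by (simp add: L_eq group_closure_linear_image[OF lin])
    show "f ` L \<subseteq> integer_vectors"
      using integral by (auto simp: integer_vectors_def f_def)
  qed
  have P': "lattice_polytope (f ` L) (f ` P j)" if j: "j \<in> {1..CARD('n)}" for j
  proof -
    obtain V where V: "finite V" "V \<noteq> {}" "V \<subseteq> L" "P j = convex hull V"
      using lattice_polytope_hull[OF P[OF j]] by metis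
    then have "f ` P j = convex hull (f ` V)" by (simp add: convex_hull_linear_image[OF lin])
    then show ?thesis using V by (simp add: lattice_polytope_convex_hull image_mono)
  qed
  have count: "lattice_count (f ` L) (f ` A) = lattice_count L A" for A
    using \<open>inj f\<close> by (simp add: lattice_count_def card_image inj_on_subset flip: image_Int)
  have "real_of_int ((-1) ^ CARD('n) * full_lattice.mixed_count (f ` L) (\<lambda>j. f ` P j) {1..CARD('n)} (f ` {0})) =
      mixed_volume (f ` L) (\<lambda>j. f ` P j)"
    using full_lattice.mixed_volume_eq_mixed_count[OF full, of "\<lambda>j. f ` P j" "f ` {0}"] P'
    by (simp add: card_ordered_index polytope_sing)
  also have "\<dots> \<ge> 0"
    using P' by (intro mixed_volume_nonneg_wellorder[OF full]) (simp add: card_ordered_index)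
  also have "full_lattice.mixed_count (f ` L) (\<lambda>j. f ` P j) {1..CARD('n)} (f ` {0}) = mixed_count P {1..CARD('n)} {0}"
    unfolding full_lattice.mixed_count_def[OF full] mixed_count_def
      image_set_sum[OF lin, symmetric] image_set_plus[OF lin, symmetric] count ..
  finally show ?thesis
    using mixed_volume_eq_mixed_count[of P "{0}"] P by (simp add: polytope_sing)
qed

theorem proposition3p2:
  fixes L :: "(real ^ 'n) set" and \<Delta> :: "nat \<Rightarrow> (real ^ 'n) set"
  assumes "L \<subseteq> integer_vectors" and "lattice_of_rank CARD('n) L"
    and "\<And>j. j \<in> {1..CARD('n)} \<Longrightarrow> lattice_polytope L (\<Delta> j)"
    and "polytope (\<Delta> 0)" and "\<Delta> 0 \<noteq> {}"
  shows "mixed_volume L \<Delta> \<in> \<nat> \<and>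
    mixed_volume L \<Delta> =
      real_of_int (\<Sum>J\<in>Pow {1..CARD('n)}.
        (-1) ^ card J * signed_interior_count L (\<Sum>j\<in>insert 0 J. \<Delta> j)) \<and>
    mixed_volume L \<Delta> =
      real_of_int (\<Sum>J\<in>Pow {1..CARD('n)}.
        (-1) ^ (CARD('n) - card J) * lattice_count L (\<Sum>j\<in>insert 0 J. \<Delta> j))"
proof -
  obtain B where "independent B" "card B = CARD('n)" "L = group_closure B"
    using assms(2) by (auto simp: lattice_of_rank_def)
  then interpret full_lattice L B using assms(1) by unfold_locales
  let ?I = "{1..CARD('n)}"
  have insert: "(\<Sum>j\<in>insert 0 J. \<Delta> j) = \<Delta> 0 + (\<Sum>j\<in>J. \<Delta> j)" if "J \<in> Pow ?I" for J
    using that by (subst sum.insert) (auto intro: finite_subset)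
  have MV: "mixed_volume L \<Delta> = real_of_int ((-1) ^ CARD('n) * mixed_count \<Delta> ?I (\<Delta> 0))"
    by (rule mixed_volume_eq_mixed_count[OF assms(3-5)])
  also have "(-1) ^ CARD('n) * mixed_count \<Delta> ?I (\<Delta> 0) =
      (\<Sum>J\<in>Pow ?I. (-1) ^ (CARD('n) - card J) * lattice_count L (\<Sum>j\<in>insert 0 J. \<Delta> j))"
    unfolding mixed_count_def sum_distrib_left
  proof (intro sum.cong refl)
    fix J assume J: "J \<in> Pow ?I"
    then have "card J \<le> CARD('n)" using card_mono[of ?I J] by simp
    then show "(-1) ^ CARD('n) * ((-1) ^ card J * lattice_count L (\<Delta> 0 + (\<Sum>j\<in>J. \<Delta> j))) =
      (-1) ^ (CARD('n) - card J) * lattice_count L (\<Sum>j\<in>insert 0 J. \<Delta> j)"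
      by (simp only: insert[OF J] minus_one_power_diff mult.assoc)
  qed
  finally have closed_count: "mixed_volume L \<Delta> = real_of_int (\<Sum>J\<in>Pow ?I.
      (-1) ^ (CARD('n) - card J) * lattice_count L (\<Sum>j\<in>insert 0 J. \<Delta> j))" .
  have "mixed_interior_count \<Delta> ?I (\<Delta> 0) = (-1) ^ CARD('n) * mixed_count \<Delta> ?I (\<Delta> 0)"
    using assms by (intro mixed_interior_count_eq) auto
  moreover have "mixed_interior_count \<Delta> ?I (\<Delta> 0) =
      (\<Sum>J\<in>Pow ?I. (-1) ^ card J * signed_interior_count L (\<Sum>j\<in>insert 0 J. \<Delta> j))"
    unfolding mixed_interior_count_def by (intro sum.cong refl) (simp only: insert)
  ultimately have "mixed_volume L \<Delta> = real_of_int (\<Sum>J\<in>Pow ?I.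
      (-1) ^ card J * signed_interior_count L (\<Sum>j\<in>insert 0 J. \<Delta> j))"
    using MV by simp
  \<comment> \<open>Integrality comes from the counts and nonnegativity from the integral of mixed
    discriminants.\<close>
  moreover have "mixed_volume L \<Delta> \<in> \<nat>"
  proof -
    have "mixed_volume L \<Delta> \<in> \<int>" unfolding MV by (rule Ints_of_int)
    moreover have "0 \<le> mixed_volume L \<Delta>"
      using assms(3) by (intro mixed_volume_nonneg[OF full_lattice_axioms])
    ultimately show ?thesis by (simp add: Nats_altdef2)
  qed
  ultimately show ?thesis using closed_count by blast
qed

end
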